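(* There is a universal constant $C>0$ such that the following holds. Let $\pi\colon\mathrm{GL}(n_1)\times\dots\times\mathrm{GL}(n_k)\to\mathrm{GL}(m)$ be a polynomial representation satisfying the assumptions described in the context, with degrees bounded by $d\ge1$ and coefficient bound $R$, and let $n:=n_1+\dots+n_k$. Let $\|\cdot\|$ be the norm of an inner product on $\mathbb C^m$ that is invariant under the compact subgroup $\mathrm{SU}(n_1)\times\dots\times\mathrm{SU}(n_k)$, and assume that $\|w\|_2\le\mathcal K\|w\|$ for all $w\in\mathbb C^m$, for some $\mathcal K\ge1$. If $v\in\mathbb Z[i]^m$ is a vector with $\operatorname{cap}(v)>0$, where the capacity is taken with respect to the action of $\mathrm{SL}(n_1)\times\dots\times\mathrm{SL}(n_k)$, then $$-\log\operatorname{cap}(v)\le C\bigl(k^2dn^2\log(dn)+k\log(Rm\mathcal K)\bigr).$$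
   Context: Capacity: $\operatorname{cap}(v)=\inf\{\|\pi(g)v\|:g\in\mathrm{SL}(n_1)\times\dots\times\mathrm{SL}(n_k)\}$. $\|\cdot\|_2$ is the standard Euclidean norm on $\mathbb C^m$. Assumptions on $\pi$: for $\ell=1,\dots,k$ let $\pi_\ell\colon\mathrm{GL}(n_\ell)\to\mathrm{GL}(m)$ be $\pi_\ell(g)=\pi(I_{n_1},\dots,I_{n_{\ell-1}},g,I_{n_{\ell+1}},\dots,I_{n_k})$. Each $\pi_\ell$ is a polynomial representation of degree at most $d$ that splits into a direct sum $\mathbb C^m=\bigoplus_{r=1}^{s_\ell}\mathbb C^{m_{\ell,r}}$ (with respect to the given coordinates) of homogeneous polynomial representations $\pi_{\ell,r}$. Moreover there are positive integers $N\le R$ such that for all $\ell,r$ the matrix entries of $N\pi_{\ell,r}(g)$ are polynomials in the entries of $g$ with integer coefficients bounded in absolute value by $R$. *)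

theory Defs
  imports
    Complex_Main
    "HOL-Library.Poly_Mapping"
    "HOL-Library.Disjoint_Sets"
    "HOL-Algebra.Product_Groups"
    "Jordan_Normal_Form.Determinant"
    "Jordan_Normal_Form.Schur_Decomposition"
    "Jordan_Normal_Form.DL_Submatrix"
begin

section \<open>Multivariate polynomials\<close>

type_synonym 'x monomial = "'x \<Rightarrow>\<^sub>0 nat"
type_synonym ('x, 'a) mpoly = "'x monomial \<Rightarrow>\<^sub>0 'a"

definition mpoly_eval :: "('x \<Rightarrow> 'a::comm_semiring_1) \<Rightarrow> ('x, 'a) mpoly \<Rightarrow> 'a" where
  "mpoly_eval a p =
     (\<Sum>t\<in>Poly_Mapping.keys p. Poly_Mapping.lookup p t *
        (\<Prod>x\<in>Poly_Mapping.keys t. a x ^ Poly_Mapping.lookup t x))"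

definition mpoly_vars :: "('x, 'a::zero) mpoly \<Rightarrow> 'x set" where
  "mpoly_vars p = (\<Union>t\<in>Poly_Mapping.keys p. Poly_Mapping.keys t)"

definition monomial_degree :: "'x monomial \<Rightarrow> nat" where
  "monomial_degree t = (\<Sum>x\<in>Poly_Mapping.keys t. Poly_Mapping.lookup t x)"

section \<open>Matrix groups\<close>

definition GL :: "nat \<Rightarrow> complex mat monoid" where
  "GL n = \<lparr>carrier = {A \<in> carrier_mat n n. det A \<noteq> 0}, monoid.mult = (*), one = 1\<^sub>m n\<rparr>"

definition SL :: "nat \<Rightarrow> complex mat set" where
  "SL n = {A \<in> carrier_mat n n. det A = 1}"

definition SU :: "nat \<Rightarrow> complex mat set" where
  "SU n = {A \<in> SL n. A * mat_adjoint A = 1\<^sub>m n}"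

lemma group_GL: "Group.group (GL n)"
proof (rule groupI)
  fix A assume A: "A \<in> carrier (GL n)"
  then have "A \<in> Units (ring_mat TYPE(complex) n ())"
    by (intro det_non_zero_imp_unit) (auto simp: GL_def)
  then obtain B where B: "B \<in> carrier_mat n n" "B * A = 1\<^sub>m n"
    by (auto simp: Units_def ring_mat_def)
  have "det B * det A = 1"
    using A B det_mult[of B n A] by (simp add: GL_def)
  then show "\<exists>B\<in>carrier (GL n). B \<otimes>\<^bsub>GL n\<^esub> A = \<one>\<^bsub>GL n\<^esub>"
    using B by (auto simp: GL_def intro!: bexI[of _ B])
qed (auto simp: GL_def det_mult)

text \<open>The factors of \<open>GL(n\<^sub>1) \<times> \<dots> \<times> GL(n\<^sub>k)\<close> are indexed by \<open>{..<k}\<close>; elements of the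
  product are extensional functions on that index set.\<close>

abbreviation GL_prod :: "nat \<Rightarrow> (nat \<Rightarrow> nat) \<Rightarrow> (nat \<Rightarrow> complex mat) monoid" where
  "GL_prod k n \<equiv> product_group {..<k} (\<lambda>l. GL (n l))"

abbreviation SL_prod :: "nat \<Rightarrow> (nat \<Rightarrow> nat) \<Rightarrow> (nat \<Rightarrow> complex mat) set" where
  "SL_prod k n \<equiv> (\<Pi>\<^sub>E l\<in>{..<k}. SL (n l))"

abbreviation SU_prod :: "nat \<Rightarrow> (nat \<Rightarrow> nat) \<Rightarrow> (nat \<Rightarrow> complex mat) set" where
  "SU_prod k n \<equiv> (\<Pi>\<^sub>E l\<in>{..<k}. SU (n l))"

section \<open>Polynomial representations\<close>

definition polynomial_rep_prod ::
  "nat \<Rightarrow> (nat \<Rightarrow> nat) \<Rightarrow> nat \<Rightarrow> ((nat \<Rightarrow> complex mat) \<Rightarrow> complex mat) \<Rightarrow> bool" where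
  "polynomial_rep_prod k n m \<pi> \<longleftrightarrow>
     \<pi> \<in> hom (GL_prod k n) (GL m) \<and>
     (\<forall>i<m. \<forall>j<m. \<exists>p. mpoly_vars p \<subseteq> (SIGMA l:{..<k}. {..<n l} \<times> {..<n l}) \<and>
        (\<forall>g\<in>carrier (GL_prod k n). \<pi> g $$ (i, j) = mpoly_eval (\<lambda>(l, x). g l $$ x) p))"

definition polynomial_rep_deg_le ::
  "nat \<Rightarrow> nat \<Rightarrow> nat \<Rightarrow> (complex mat \<Rightarrow> complex mat) \<Rightarrow> bool" where
  "polynomial_rep_deg_le n m d \<rho> \<longleftrightarrow>
     \<rho> \<in> hom (GL n) (GL m) \<and>
     (\<forall>i<m. \<forall>j<m. \<exists>p. mpoly_vars p \<subseteq> {..<n} \<times> {..<n} \<and>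
        (\<forall>t\<in>Poly_Mapping.keys p. monomial_degree t \<le> d) \<and>
        (\<forall>g\<in>carrier (GL n). \<rho> g $$ (i, j) = mpoly_eval (\<lambda>x. g $$ x) p))"

definition homogeneous_polynomial_rep ::
  "nat \<Rightarrow> nat \<Rightarrow> (complex mat \<Rightarrow> complex mat) \<Rightarrow> bool" where
  "homogeneous_polynomial_rep n m \<rho> \<longleftrightarrow>
     \<rho> \<in> hom (GL n) (GL m) \<and>
     (\<exists>e. \<forall>i<m. \<forall>j<m. \<exists>p. mpoly_vars p \<subseteq> {..<n} \<times> {..<n} \<and>
        (\<forall>t\<in>Poly_Mapping.keys p. monomial_degree t = e) \<and>
        (\<forall>g\<in>carrier (GL n). \<rho> g $$ (i, j) = mpoly_eval (\<lambda>x. g $$ x) p))"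

definition integral_entries ::
  "nat \<Rightarrow> nat \<Rightarrow> nat \<Rightarrow> nat \<Rightarrow> (complex mat \<Rightarrow> complex mat) \<Rightarrow> bool" where
  "integral_entries n m N R \<rho> \<longleftrightarrow>
     (\<forall>i<m. \<forall>j<m. \<exists>p. mpoly_vars p \<subseteq> {..<n} \<times> {..<n} \<and>
        (\<forall>t. Poly_Mapping.lookup p t \<in> \<int> \<and> cmod (Poly_Mapping.lookup p t) \<le> real R) \<and>
        (\<forall>g\<in>carrier (GL n). (of_nat N \<cdot>\<^sub>m \<rho> g) $$ (i, j) = mpoly_eval (\<lambda>x. g $$ x) p))"

definition factor_rep ::
  "nat \<Rightarrow> (nat \<Rightarrow> nat) \<Rightarrow> ((nat \<Rightarrow> complex mat) \<Rightarrow> complex mat) \<Rightarrow> nat \<Rightarrow> complex mat \<Rightarrow> complex mat"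
  where
  "factor_rep k n \<pi> l g = \<pi> (\<lambda>i\<in>{..<k}. if i = l then g else 1\<^sub>m (n i))"

text \<open>The coordinate set \<open>{..<m}\<close> is partitioned into blocks \<open>S r\<close>, \<open>r < s\<close>, such that every
  \<open>\<rho> g\<close> is block diagonal. The blocks are arbitrary sets of coordinates, not necessarily
  intervals: the splittings attached to different factors of the product group can
  in general not be made contiguous by one common ordering of the coordinates.\<close>

definition coordinate_splitting ::
  "nat \<Rightarrow> nat \<Rightarrow> (complex mat \<Rightarrow> complex mat) \<Rightarrow> nat \<Rightarrow> (nat \<Rightarrow> nat set) \<Rightarrow> bool" where
  "coordinate_splitting n m \<rho> s S \<longleftrightarrow>
     (\<Union>r<s. S r) = {..<m} \<and> disjoint_family_on S {..<s} \<and>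
     (\<forall>g\<in>carrier (GL n). \<forall>r<s. \<forall>r'<s. r \<noteq> r' \<longrightarrow>
        (\<forall>i\<in>S r. \<forall>j\<in>S r'. \<rho> g $$ (i, j) = 0))"

definition block_rep ::
  "(complex mat \<Rightarrow> complex mat) \<Rightarrow> nat set \<Rightarrow> complex mat \<Rightarrow> complex mat" where
  "block_rep \<rho> T g = submatrix (\<rho> g) T T"

definition admissible_rep ::
  "nat \<Rightarrow> (nat \<Rightarrow> nat) \<Rightarrow> nat \<Rightarrow> nat \<Rightarrow> nat \<Rightarrow> ((nat \<Rightarrow> complex mat) \<Rightarrow> complex mat) \<Rightarrow> bool"
  where
  "admissible_rep k n m d R \<pi> \<longleftrightarrow>
     polynomial_rep_prod k n m \<pi> \<and>
     (\<forall>l<k. polynomial_rep_deg_le (n l) m d (factor_rep k n \<pi> l)) \<and>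
     (\<exists>s S N.
        (\<forall>l<k. coordinate_splitting (n l) m (factor_rep k n \<pi> l) (s l) (S l)) \<and>
        (\<forall>l<k. \<forall>r<s l. homogeneous_polynomial_rep (n l) (card (S l r))
                           (block_rep (factor_rep k n \<pi> l) (S l r))) \<and>
        0 < N \<and> N \<le> R \<and>
        (\<forall>l<k. \<forall>r<s l. integral_entries (n l) (card (S l r)) N R
                           (block_rep (factor_rep k n \<pi> l) (S l r))))"

section \<open>Inner products, norms and capacity\<close>

text \<open>Positivity of \<open>Re (ip u u)\<close> suffices: \<open>ip u u\<close> is real by Hermitian symmetry.\<close>

definition hermitian_inner_product ::
  "nat \<Rightarrow> (complex vec \<Rightarrow> complex vec \<Rightarrow> complex) \<Rightarrow> bool" where
  "hermitian_inner_product m ip \<longleftrightarrow>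
     (\<forall>u\<in>carrier_vec m. \<forall>v\<in>carrier_vec m. \<forall>w\<in>carrier_vec m. ip (u + v) w = ip u w + ip v w) \<and>
     (\<forall>c. \<forall>u\<in>carrier_vec m. \<forall>w\<in>carrier_vec m. ip (c \<cdot>\<^sub>v u) w = c * ip u w) \<and>
     (\<forall>u\<in>carrier_vec m. \<forall>w\<in>carrier_vec m. ip w u = cnj (ip u w)) \<and>
     (\<forall>u\<in>carrier_vec m. u \<noteq> 0\<^sub>v m \<longrightarrow> 0 < Re (ip u u))"

definition SU_invariant ::
  "nat \<Rightarrow> (nat \<Rightarrow> nat) \<Rightarrow> nat \<Rightarrow> ((nat \<Rightarrow> complex mat) \<Rightarrow> complex mat) \<Rightarrow>
     (complex vec \<Rightarrow> complex vec \<Rightarrow> complex) \<Rightarrow> bool" where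
  "SU_invariant k n m \<pi> ip \<longleftrightarrow>
     (\<forall>g\<in>SU_prod k n. \<forall>u\<in>carrier_vec m. \<forall>w\<in>carrier_vec m.
        ip (\<pi> g *\<^sub>v u) (\<pi> g *\<^sub>v w) = ip u w)"

definition ip_norm :: "(complex vec \<Rightarrow> complex vec \<Rightarrow> complex) \<Rightarrow> complex vec \<Rightarrow> real" where
  "ip_norm ip w = sqrt (Re (ip w w))"

abbreviation norm2 :: "complex vec \<Rightarrow> real" where
  "norm2 \<equiv> ip_norm (\<lambda>u w. u \<bullet>c w)"

definition capacity ::
  "nat \<Rightarrow> (nat \<Rightarrow> nat) \<Rightarrow> ((nat \<Rightarrow> complex mat) \<Rightarrow> complex mat) \<Rightarrow> (complex vec \<Rightarrow> real) \<Rightarrow>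
     complex vec \<Rightarrow> real" where
  "capacity k n \<pi> nrm v = (INF g\<in>SL_prod k n. nrm (\<pi> g *\<^sub>v v))"

definition gaussian_integers :: "complex set" where
  "gaussian_integers = {z. Re z \<in> \<int> \<and> Im z \<in> \<int>}"

end

theory Submission
  imports
    Defs
    "HOL-Analysis.Continuum_Not_Denumerable"
    "HOL-Computational_Algebra.Fundamental_Theorem_Algebra"
    "HOL-Computational_Algebra.Primes"
begin

text \<open>The capacity of \<open>v\<close> is bounded from below by a single \<open>SL\<close>-invariant polynomial \<open>P\<close> with
\<open>P(v) \<noteq> 0\<close>. If \<open>P\<close> is homogeneous of degree \<open>D > 0\<close>, takes Gaussian integers to
Gaussian integers, and satisfies \<open>\<bar>P(x)\<bar> \<le> (B \<parallel>x\<parallel>\<^sub>2)\<^sup>D\<close>, then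
\<open>1 \<le> \<bar>P(v)\<bar> = \<bar>P(\<pi>(g)v)\<bar> \<le> (B \<parallel>\<pi>(g)v\<parallel>\<^sub>2)\<^sup>D\<close>, so \<open>\<parallel>\<pi>(g)v\<parallel>\<^sub>2 \<ge> 1/B\<close> for every \<open>g\<close>.
The degree \<open>D\<close> disappears with the \<open>D\<close>-th root, so it may be arbitrary as long as all constants grow
at most exponentially with \<open>D\<close>.\<close>

text \<open>The invariants are those of Cayley's Omega process. Let \<open>X = (X\<^sub>1, \<dots>, X\<^sub>k)\<close> be matrices of
indeterminates, let \<open>\<phi>\<^sub>i(X)\<close> be the \<open>i\<close>-th coordinate of \<open>N\<^sup>k \<pi>(X)x\<close>, and let \<open>\<Delta>\<^sup>M\<close> be the
product of the powers \<open>det(X\<^sub>l)\<close> to the \<open>M\<^sub>l\<close>. The Fischer pairing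
\<open>\<langle>p, q\<rangle> = \<Sum>\<^sub>a a! p\<^sub>a q\<^sub>a\<close> turns a linear substitution into its transpose (\<open>fischer_lin_subst\<close>), so
\<open>\<langle>\<Delta>\<^sup>M, \<Prod>\<^sub>i \<phi>\<^sub>i\<^sup>\<beta>\<^sup>i\<rangle>\<close> is an invariant polynomial in \<open>x\<close> (\<open>invariant_SL\<close>). The factorials in the pairing
grow faster than exponentially, but they can be divided out: every monomial of \<open>\<Delta>\<^sup>M\<close> has all row sums
in the \<open>l\<close>-th block equal to \<open>M\<^sub>l\<close>, so \<open>a!\<close> is \<open>\<Prod>\<^sub>l (M\<^sub>l!)\<^bsup>n\<^sub>l\<^esup>\<close> divided by multinomial coefficients, and
these divide powers of \<open>lcm(1, \<dots>, M\<^sub>l) \<le> 4\<^bsup>M\<^sub>l\<^esup>\<close>. The resulting bound is \<open>orbit_norm_ge\<close>.\<close>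

text \<open>It remains to see that some invariant of this kind does not vanish at \<open>v\<close> if the capacity is positive.
Suppose that all of them vanish. Choose \<open>X\<close> with complex entries that satisfy no polynomial relation over
the Gaussian rationals, and rescale it to a point \<open>g\<close> of the product of the \<open>SL(n\<^sub>l)\<close>. A polynomial
relation with non-zero constant term between the coordinates of \<open>\<pi>(g)v\<close> becomes, after multiplication by
a power of the determinants, an identity of polynomials in \<open>X\<close>; pairing it with \<open>\<Delta>\<^sup>M\<close> kills every term
except the constant one and contradicts \<open>\<langle>\<Delta>\<^sup>M, \<Delta>\<^sup>M\<rangle> > 0\<close> (\<open>relation_constant_term\<close>). So there is a place of
the field of complex numbers that sends all coordinates of \<open>\<pi>(g)v\<close> to \<open>0\<close> (\<open>place_exists\<close>, by
Chevalley's theorem \<open>chevalley_extension\<close>).\<close>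

text \<open>Over its valuation ring there is a Cartan decomposition \<open>P g = T Q\<close> with \<open>P\<close>, \<open>Q\<close> integral and \<open>T\<close>
diagonal (\<open>cartan_decomposition\<close>). Reducing \<open>Q\<close> modulo the maximal ideal gives a complex point \<open>Q'\<close>, and
every weight that occurs in \<open>\<pi>(Q')v\<close> takes a value in the maximal ideal at \<open>T\<close>. Since all components of
\<open>T\<close> have determinant \<open>1\<close>, no non-trivial combination of these weights with non-negative integer
coefficients is constant on each factor, and Gordan's alternative (\<open>gordan_alternative\<close>) provides a one-parameter subgroup of the diagonal
torus that contracts \<open>\<pi>(Q')v\<close> to \<open>0\<close>. Therefore the orbit of \<open>v\<close> accumulates at the origin
(\<open>orbit_accumulates_at_zero\<close>) and the capacity is \<open>0\<close>. This is the Hilbert-Mumford criterion, with a place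
of the complex numbers in the role of a curve through the orbit.\<close>

section \<open>Polynomials in several variables\<close>

abbreviation lookup :: "('a \<Rightarrow>\<^sub>0 'b::zero) \<Rightarrow> 'a \<Rightarrow> 'b" where
  "lookup \<equiv> Poly_Mapping.lookup"
abbreviation keys :: "('a \<Rightarrow>\<^sub>0 'b::zero) \<Rightarrow> 'a set" where
  "keys \<equiv> Poly_Mapping.keys"
abbreviation single :: "'a \<Rightarrow> 'b \<Rightarrow> 'a \<Rightarrow>\<^sub>0 'b::zero" where
  "single \<equiv> Poly_Mapping.single"

definition monom_eval :: "('x \<Rightarrow> 'r::comm_semiring_1) \<Rightarrow> 'x monomial \<Rightarrow> 'r" where
  "monom_eval f t = (\<Prod>x\<in>keys t. f x ^ lookup t x)"

lemma monom_eval_superset: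
  assumes "finite S" "keys t \<subseteq> S"
  shows "monom_eval f t = (\<Prod>x\<in>S. f x ^ lookup t x)"
  unfolding monom_eval_def
  by (rule prod.mono_neutral_left) (use assms in \<open>auto simp: in_keys_iff\<close>)

lemma monom_eval_0 [simp]: "monom_eval f 0 = 1"
  by (simp add: monom_eval_def)

lemma monom_eval_single [simp]: "monom_eval f (single x n) = f x ^ n"
  by (cases "n = 0") (auto simp: monom_eval_def)

lemma keys_empty_iff: "keys p = {} \<longleftrightarrow> p = 0"
  by (auto intro!: poly_mapping_eqI simp: in_keys_iff)

lemma keys_add_nat: "keys (s + t :: 'x \<Rightarrow>\<^sub>0 nat) = keys s \<union> keys t"
  by (auto simp: in_keys_iff lookup_add)

lemma monom_eval_add: "monom_eval f (s + t) = monom_eval f s * monom_eval f t"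
proof -
  let ?S = "keys s \<union> keys t"
  have "monom_eval f (s + t) = (\<Prod>x\<in>?S. f x ^ lookup (s + t) x)"
    by (rule monom_eval_superset) (auto simp: keys_add_nat)
  also have "\<dots> = (\<Prod>x\<in>?S. f x ^ lookup s x) * (\<Prod>x\<in>?S. f x ^ lookup t x)"
    by (simp add: lookup_add power_add prod.distrib)
  also have "\<dots> = monom_eval f s * monom_eval f t"
    by (subst (1 2) monom_eval_superset[of ?S]) auto
  finally show ?thesis .
qed

lemma monom_eval_cong: "(\<And>x. x \<in> keys t \<Longrightarrow> f x = g x) \<Longrightarrow> monom_eval f t = monom_eval g t"
  by (simp add: monom_eval_def)

lemma mpoly_eval_monom_eval: "mpoly_eval a p = (\<Sum>t\<in>keys p. lookup p t * monom_eval a t)"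
  by (simp add: mpoly_eval_def monom_eval_def)

lemma mpoly_sum_monomials: "p = (\<Sum>t\<in>keys p. single t (lookup p t))"
  by (rule poly_mapping_eqI)
     (simp add: lookup_sum lookup_single when_def in_keys_iff sum.delta)

lemma mpoly_induct [case_names single add]:
  fixes p :: "('x, 'a::comm_monoid_add) mpoly"
  assumes "\<And>t c. P (single t c)" "\<And>p q. P p \<Longrightarrow> P q \<Longrightarrow> P (p + q)"
  shows "P p"
proof -
  have "P (\<Sum>t\<in>S. single t (lookup p t))" if "finite S" for S
    using that
  proof (induction S rule: finite_induct)
    case empty
    then show ?case using assms(1)[of 0 0] by simp
  qed (auto intro: assms)
  from this[of "keys p"] show ?thesis
    using mpoly_sum_monomials[of p] by simp
qed

text \<open>The coefficient map is kept as a parameter: the identity yields evaluation, and the embedding of constants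
yields composition of polynomials.\<close>

definition mpoly_subst ::
  "('a::zero \<Rightarrow> 'r) \<Rightarrow> ('x \<Rightarrow> 'r::comm_semiring_1) \<Rightarrow> ('x, 'a) mpoly \<Rightarrow> 'r" where
  "mpoly_subst c f p = (\<Sum>t\<in>keys p. c (lookup p t) * monom_eval f t)"

lemma mpoly_eval_subst: "mpoly_eval a p = mpoly_subst (\<lambda>c. c) a p"
  by (simp add: mpoly_eval_monom_eval mpoly_subst_def)

context comm_semiring_hom
begin

lemma subst_superset:
  assumes "finite S" "keys p \<subseteq> S"
  shows "mpoly_subst hom f p = (\<Sum>t\<in>S. hom (lookup p t) * monom_eval f t)"
  unfolding mpoly_subst_def
  by (rule sum.mono_neutral_left) (use assms in \<open>auto simp: in_keys_iff\<close>)

lemma subst_add: "mpoly_subst hom f (p + q) = mpoly_subst hom f p + mpoly_subst hom f q"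
proof -
  let ?S = "keys p \<union> keys q"
  have "mpoly_subst hom f (p + q) = (\<Sum>t\<in>?S. hom (lookup (p + q) t) * monom_eval f t)"
    by (rule subst_superset) (use keys_add[of p q] in auto)
  also have "\<dots> = (\<Sum>t\<in>?S. hom (lookup p t) * monom_eval f t) + (\<Sum>t\<in>?S. hom (lookup q t) * monom_eval f t)"
    by (simp add: lookup_add hom_add distrib_right sum.distrib)
  also have "\<dots> = mpoly_subst hom f p + mpoly_subst hom f q"
    by (subst (1 2) subst_superset[of ?S]) auto
  finally show ?thesis .
qed

lemma subst_zero [simp]: "mpoly_subst hom f 0 = 0"
  by (simp add: mpoly_subst_def)

lemma subst_single: "mpoly_subst hom f (single t c) = hom c * monom_eval f t"
  by (cases "c = 0") (auto simp: mpoly_subst_def)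

lemma subst_one [simp]: "mpoly_subst hom f 1 = 1"
  using subst_single[of f 0 1] by simp

lemma subst_mult: "mpoly_subst hom f (p * q) = mpoly_subst hom f p * mpoly_subst hom f q"
proof (induction p rule: mpoly_induct)
  case (single s c)
  show ?case
    by (induction q rule: mpoly_induct)
       (simp_all add: mult_single subst_single subst_add monom_eval_add hom_mult algebra_simps)
qed (simp_all add: subst_add distrib_right)

lemma subst_power: "mpoly_subst hom f (p ^ n) = mpoly_subst hom f p ^ n"
  by (induction n) (simp_all add: subst_mult)

lemma subst_sum: "mpoly_subst hom f (sum p A) = (\<Sum>i\<in>A. mpoly_subst hom f (p i))"
  by (induction A rule: infinite_finite_induct) (simp_all add: subst_add)

lemma subst_prod: "mpoly_subst hom f (prod p A) = (\<Prod>i\<in>A. mpoly_subst hom f (p i))"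
  by (induction A rule: infinite_finite_induct) (simp_all add: subst_mult)

end

lemma eval_hom: "comm_semiring_hom (\<lambda>c::'a::comm_semiring_1. c)"
  by unfold_locales auto

lemma const_hom: "comm_semiring_hom (single (0::'x monomial) :: 'a::comm_semiring_1 \<Rightarrow> _)"
proof unfold_locales
  show "single (0::'x monomial) (1::'a) = 1"
    by (rule single_one)
qed (simp_all only: single_zero single_add mult_single add_0)

lemmas mpoly_eval_simps =
  comm_semiring_hom.subst_add[OF eval_hom, folded mpoly_eval_subst]
  comm_semiring_hom.subst_zero[OF eval_hom, folded mpoly_eval_subst]
  comm_semiring_hom.subst_single[OF eval_hom, folded mpoly_eval_subst]
  comm_semiring_hom.subst_one[OF eval_hom, folded mpoly_eval_subst]
  comm_semiring_hom.subst_mult[OF eval_hom, folded mpoly_eval_subst]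
  comm_semiring_hom.subst_power[OF eval_hom, folded mpoly_eval_subst]
  comm_semiring_hom.subst_sum[OF eval_hom, folded mpoly_eval_subst]
  comm_semiring_hom.subst_prod[OF eval_hom, folded mpoly_eval_subst]

lemmas mpoly_eval_superset = comm_semiring_hom.subst_superset[OF eval_hom, folded mpoly_eval_subst]

abbreviation mpoly_compose :: "('x \<Rightarrow> ('y, 'a) mpoly) \<Rightarrow> ('x, 'a::comm_semiring_1) mpoly \<Rightarrow> ('y, 'a) mpoly" where
  "mpoly_compose \<equiv> mpoly_subst (single 0)"

lemmas mpoly_compose_simps =
  comm_semiring_hom.subst_add[OF const_hom]
  comm_semiring_hom.subst_zero[OF const_hom]
  comm_semiring_hom.subst_single[OF const_hom]
  comm_semiring_hom.subst_one[OF const_hom]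
  comm_semiring_hom.subst_mult[OF const_hom]
  comm_semiring_hom.subst_power[OF const_hom]
  comm_semiring_hom.subst_sum[OF const_hom]
  comm_semiring_hom.subst_prod[OF const_hom]

lemma mpoly_eval_monom: "mpoly_eval a (monom_eval f t) = monom_eval (\<lambda>x. mpoly_eval a (f x)) t"
  by (simp add: monom_eval_def mpoly_eval_simps)

lemma mpoly_eval_compose: "mpoly_eval a (mpoly_compose f p) = mpoly_eval (\<lambda>x. mpoly_eval a (f x)) p"
  by (induction p rule: mpoly_induct)
     (simp_all add: mpoly_compose_simps mpoly_eval_simps mpoly_eval_monom)

lemma mpoly_eval_uminus: "mpoly_eval a (- p) = - mpoly_eval a (p :: ('x, 'a::comm_ring_1) mpoly)"
  using mpoly_eval_simps(1)[of a p "- p"] by (simp add: mpoly_eval_simps(2) eq_neg_iff_add_eq_0 add.commute)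

lemma mpoly_eval_diff: "mpoly_eval a (p - q) = mpoly_eval a p - mpoly_eval a (q :: ('x, 'a::comm_ring_1) mpoly)"
  using mpoly_eval_simps(1)[of a p "- q"] by (simp add: mpoly_eval_uminus)

lemma mpoly_eval_cong:
  "(\<And>x. x \<in> mpoly_vars p \<Longrightarrow> f x = g x) \<Longrightarrow> mpoly_eval f p = mpoly_eval g p"
  unfolding mpoly_eval_monom_eval mpoly_vars_def
  by (intro sum.cong arg_cong2[where f = "(*)"] monom_eval_cong) auto

lemma mpoly_vars_0 [simp]: "mpoly_vars 0 = {}"
  and mpoly_vars_1 [simp]: "mpoly_vars (1 :: ('x, 'a::comm_semiring_1) mpoly) = {}"
  by (auto simp: mpoly_vars_def)

lemma mpoly_vars_single: "mpoly_vars (single t c) \<subseteq> keys t"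
  by (auto simp: mpoly_vars_def split: if_splits)

lemma mpoly_vars_add: "mpoly_vars (p + q) \<subseteq> mpoly_vars p \<union> mpoly_vars q"
  unfolding mpoly_vars_def using keys_add[of p q] by blast

lemma mpoly_vars_mult: "mpoly_vars (p * q :: ('x, 'a::comm_semiring_1) mpoly) \<subseteq> mpoly_vars p \<union> mpoly_vars q"
proof
  fix x assume "x \<in> mpoly_vars (p * q)"
  then obtain t where t: "t \<in> keys (p * q)" "x \<in> keys t"
    by (auto simp: mpoly_vars_def)
  then obtain u v where "u \<in> keys p" "v \<in> keys q" "t = u + v"
    using keys_mult[of p q] by auto
  then show "x \<in> mpoly_vars p \<union> mpoly_vars q"
    using t by (auto simp: mpoly_vars_def keys_add_nat)
qed

lemma mpoly_vars_sum: "(\<And>i. i \<in> A \<Longrightarrow> mpoly_vars (p i) \<subseteq> V) \<Longrightarrow> mpoly_vars (sum p A) \<subseteq> V"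
proof (induction A rule: infinite_finite_induct)
  case (insert x F)
  then show ?case using mpoly_vars_add[of "p x" "sum p F"] by (simp, blast)
qed auto

lemma mpoly_vars_prod:
  "(\<And>i. i \<in> A \<Longrightarrow> mpoly_vars (p i) \<subseteq> V) \<Longrightarrow>
     mpoly_vars (prod p A :: ('x, 'a::comm_semiring_1) mpoly) \<subseteq> V"
proof (induction A rule: infinite_finite_induct)
  case (insert x F)
  then show ?case using mpoly_vars_mult[of "p x" "prod p F"] by (simp, blast)
qed auto

lemma mpoly_vars_power: "mpoly_vars (p ^ n :: ('x, 'a::comm_semiring_1) mpoly) \<subseteq> mpoly_vars p"
  using mpoly_vars_prod[of "{..<n}" "\<lambda>_. p" "mpoly_vars p"] by simp

definition subsemiring :: "'a::comm_semiring_1 set \<Rightarrow> bool" where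
  "subsemiring K \<longleftrightarrow> 0 \<in> K \<and> 1 \<in> K \<and> (\<forall>a\<in>K. \<forall>b\<in>K. a + b \<in> K) \<and> (\<forall>a\<in>K. \<forall>b\<in>K. a * b \<in> K)"

lemma subsemiringD:
  assumes "subsemiring K"
  shows "0 \<in> K" "1 \<in> K" "a \<in> K \<Longrightarrow> b \<in> K \<Longrightarrow> a + b \<in> K" "a \<in> K \<Longrightarrow> b \<in> K \<Longrightarrow> a * b \<in> K"
  using assms by (auto simp: subsemiring_def)

lemma subsemiring_sum: "subsemiring K \<Longrightarrow> (\<And>i. i \<in> A \<Longrightarrow> f i \<in> K) \<Longrightarrow> sum f A \<in> K"
  by (induction A rule: infinite_finite_induct) (auto dest: subsemiringD)

lemma subsemiring_prod: "subsemiring K \<Longrightarrow> (\<And>i. i \<in> A \<Longrightarrow> f i \<in> K) \<Longrightarrow> prod f A \<in> K"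
  by (induction A rule: infinite_finite_induct) (auto dest: subsemiringD)

lemma subsemiring_power: "subsemiring K \<Longrightarrow> a \<in> K \<Longrightarrow> a ^ n \<in> K"
  by (induction n) (auto dest: subsemiringD)

lemma subsemiring_of_nat: "subsemiring K \<Longrightarrow> of_nat n \<in> K"
  by (induction n) (auto dest: subsemiringD)

definition coeffs_in :: "'a set \<Rightarrow> ('x, 'a::zero) mpoly set" where
  "coeffs_in K = {p. \<forall>t. lookup p t \<in> K}"

lemma coeffs_in_lookup: "p \<in> coeffs_in K \<Longrightarrow> lookup p t \<in> K"
  by (simp add: coeffs_in_def)

lemma coeffs_in_single: "0 \<in> K \<Longrightarrow> c \<in> K \<Longrightarrow> single t c \<in> coeffs_in K"
  by (simp add: coeffs_in_def lookup_single when_def)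

lemma mpoly_mult_monomials:
  "p * q = (\<Sum>s\<in>keys p. \<Sum>t\<in>keys q. single (s + t) (lookup p s * lookup q t))"
proof -
  have "p * q = (\<Sum>s\<in>keys p. single s (lookup p s)) * (\<Sum>t\<in>keys q. single t (lookup q t))"
    using mpoly_sum_monomials[of p] mpoly_sum_monomials[of q] by simp
  then show ?thesis
    by (simp add: sum_product mult_single)
qed

lemma subsemiring_coeffs_in:
  fixes K :: "'a::comm_semiring_1 set"
  assumes K: "subsemiring K"
  shows "subsemiring (coeffs_in K :: ('x, 'a) mpoly set)"
proof -
  note K' = subsemiringD[OF K]
  have "p * q \<in> coeffs_in K" if "p \<in> coeffs_in K" "q \<in> coeffs_in K" for p q :: "('x, 'a) mpoly"
  proof -
    have "lookup (p * q) u \<in> K" for u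
      unfolding mpoly_mult_monomials lookup_sum lookup_single when_def
      using that K' by (intro subsemiring_sum[OF K]) (auto simp: coeffs_in_def)
    then show ?thesis
      by (simp add: coeffs_in_def)
  qed
  then show ?thesis
    using K' by (auto simp: subsemiring_def coeffs_in_def lookup_add lookup_one when_def)
qed

lemma mpoly_eval_in:
  assumes "subsemiring K" "p \<in> coeffs_in K" "\<And>x. x \<in> mpoly_vars p \<Longrightarrow> f x \<in> K"
  shows "mpoly_eval f p \<in> K"
  unfolding mpoly_eval_monom_eval monom_eval_def
  using assms by (intro subsemiring_sum subsemiringD(4) subsemiring_prod subsemiring_power)
    (auto simp: coeffs_in_def mpoly_vars_def)

text \<open>The \<open>\<ell>\<^sup>1\<close> norm of the coefficients; it is submultiplicative, which the maximum norm is not.\<close>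

definition coeff_norm :: "('x, complex) mpoly \<Rightarrow> real" where
  "coeff_norm p = (\<Sum>t\<in>keys p. cmod (lookup p t))"

lemma coeff_norm_superset:
  assumes "finite S" "keys p \<subseteq> S"
  shows "coeff_norm p = (\<Sum>t\<in>S. cmod (lookup p t))"
  unfolding coeff_norm_def
  by (rule sum.mono_neutral_left) (use assms in \<open>auto simp: in_keys_iff\<close>)

lemma coeff_norm_nonneg: "0 \<le> coeff_norm p"
  by (simp add: coeff_norm_def sum_nonneg)

lemma coeff_norm_single [simp]: "coeff_norm (single t c) = cmod c"
  by (cases "c = 0") (auto simp: coeff_norm_def)

lemma coeff_norm_0 [simp]: "coeff_norm 0 = 0"
  by (simp add: coeff_norm_def)

lemma coeff_norm_1 [simp]: "coeff_norm 1 = 1"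
  using coeff_norm_single[of 0 1] by simp

lemma coeff_norm_add: "coeff_norm (p + q) \<le> coeff_norm p + coeff_norm q"
proof -
  let ?S = "keys p \<union> keys q"
  have "coeff_norm (p + q) = (\<Sum>t\<in>?S. cmod (lookup (p + q) t))"
    by (rule coeff_norm_superset) (use keys_add[of p q] in auto)
  also have "\<dots> \<le> (\<Sum>t\<in>?S. cmod (lookup p t)) + (\<Sum>t\<in>?S. cmod (lookup q t))"
    unfolding sum.distrib[symmetric] by (intro sum_mono) (simp add: lookup_add norm_triangle_ineq)
  also have "\<dots> = coeff_norm p + coeff_norm q"
    by (subst (1 2) coeff_norm_superset[of ?S]) auto
  finally show ?thesis .
qed

lemma coeff_norm_sum: "coeff_norm (sum p A) \<le> (\<Sum>i\<in>A. coeff_norm (p i))"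
proof (induction A rule: infinite_finite_induct)
  case (insert x F)
  then show ?case using coeff_norm_add[of "p x" "sum p F"] by simp
qed auto

lemma coeff_norm_mult: "coeff_norm (p * q) \<le> coeff_norm p * coeff_norm q"
proof -
  have "coeff_norm (p * q) \<le> (\<Sum>s\<in>keys p. \<Sum>t\<in>keys q. cmod (lookup p s * lookup q t))"
    unfolding mpoly_mult_monomials
    by (intro order.trans[OF coeff_norm_sum] sum_mono) simp
  also have "\<dots> = coeff_norm p * coeff_norm q"
    by (simp add: coeff_norm_def sum_product norm_mult)
  finally show ?thesis .
qed

lemma coeff_norm_prod: "coeff_norm (prod p A) \<le> (\<Prod>i\<in>A. coeff_norm (p i))"
proof (induction A rule: infinite_finite_induct)
  case (insert x F)
  then have "coeff_norm (p x * prod p F) \<le> coeff_norm (p x) * (\<Prod>i\<in>F. coeff_norm (p i))"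
    by (intro order.trans[OF coeff_norm_mult] mult_left_mono) (auto simp: coeff_norm_nonneg)
  with insert show ?case by simp
qed auto

lemma coeff_norm_power: "coeff_norm (p ^ n) \<le> coeff_norm p ^ n"
  using coeff_norm_prod[of "\<lambda>_. p" "{..<n}"] by simp

section \<open>Generic points\<close>

text \<open>A finitely supported function is determined by the finite list of its keys and values.\<close>

lemma countable_poly_mappings:
  assumes "countable T" "countable K"
  shows "countable {p :: 'a \<Rightarrow>\<^sub>0 'b::comm_monoid_add. keys p \<subseteq> T \<and> (\<forall>t. lookup p t \<in> K)}"
proof (rule countable_subset)
  show "{p. keys p \<subseteq> T \<and> (\<forall>t. lookup p t \<in> K)} \<subseteq>
      (\<lambda>xs. sum_list (map (\<lambda>(t, c). single t c) xs)) ` lists (T \<times> K)"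
  proof
    fix p :: "'a \<Rightarrow>\<^sub>0 'b" assume p: "p \<in> {p. keys p \<subseteq> T \<and> (\<forall>t. lookup p t \<in> K)}"
    obtain ts where ts: "set ts = keys p" "distinct ts"
      using finite_distinct_list[of "keys p"] by auto
    let ?xs = "map (\<lambda>t. (t, lookup p t)) ts"
    have "p = sum_list (map (\<lambda>(t, c). single t c) ?xs)"
      using mpoly_sum_monomials[of p] ts by (simp add: sum_list_distinct_conv_sum_set o_def)
    moreover have "?xs \<in> lists (T \<times> K)"
      using p ts by auto
    ultimately show "p \<in> (\<lambda>xs. sum_list (map (\<lambda>(t, c). single t c) xs)) ` lists (T \<times> K)"
      by blast
  qed
qed (use assms in auto)

lemma monom_eval_upd:
  "monom_eval (X(x := z)) t = z ^ lookup t x * monom_eval X (t - single x (lookup t x))"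
proof -
  let ?t' = "t - single x (lookup t x)"
  have t: "t = ?t' + single x (lookup t x)"
    by (rule poly_mapping_eqI) (auto simp: lookup_add lookup_minus lookup_single when_def)
  have "x \<notin> keys ?t'"
    by (simp add: in_keys_iff lookup_minus)
  then have "monom_eval (X(x := z)) ?t' = monom_eval X ?t'"
    by (intro monom_eval_cong) auto
  then show ?thesis
    by (subst t, subst monom_eval_add) (simp add: mult.commute)
qed

text \<open>Variables are chosen one after the other. If \<open>p \<noteq> 0\<close>, then some coefficient of \<open>p\<close> with respect to the
last variable is a non-zero polynomial in the other variables, so by induction it does not vanish at the
point chosen so far; this leaves finitely many forbidden values for each of countably many polynomials.\<close>

lemma generic_point:
  assumes "finite V" "countable K" "0 \<in> K"
  shows "\<exists>X. \<forall>p :: ('x, complex) mpoly. p \<noteq> 0 \<longrightarrow> mpoly_vars p \<subseteq> V \<longrightarrow> p \<in> coeffs_in K \<longrightarrow> mpoly_eval X p \<noteq> 0"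
  using assms(1)
proof (induction V rule: finite_induct)
  case empty
  have "mpoly_eval (\<lambda>_. 0) p \<noteq> 0" if p: "p \<noteq> 0" "mpoly_vars p \<subseteq> {}" for p :: "('x, complex) mpoly"
  proof -
    have "keys p \<subseteq> {0}"
      using p(2) by (auto simp: mpoly_vars_def)
    then have "keys p = {0}"
      using p(1) keys_empty_iff[of p] by blast
    then show ?thesis
      by (simp add: mpoly_eval_monom_eval in_keys_iff[symmetric])
  qed
  then show ?case by blast
next
  case (insert x V)
  obtain X :: "'x \<Rightarrow> complex" where X: "\<And>p :: ('x, complex) mpoly.
      p \<noteq> 0 \<Longrightarrow> mpoly_vars p \<subseteq> V \<Longrightarrow> p \<in> coeffs_in K \<Longrightarrow> mpoly_eval X p \<noteq> 0"
    using insert.IH by blast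
  define P where "P = {p :: ('x, complex) mpoly. p \<noteq> 0 \<and> mpoly_vars p \<subseteq> insert x V \<and> p \<in> coeffs_in K}"
  define red where "red t = t - single x (lookup t x)" for t :: "'x monomial"
  \<comment> \<open>\<open>u p\<close> is \<open>p\<close> as a univariate polynomial in \<open>x\<close>, all other variables being evaluated at \<open>X\<close>.\<close>
  define u where "u p = (\<Sum>t\<in>keys p. monom (lookup p t * monom_eval X (red t)) (lookup t x))" for p
  have poly_u: "poly (u p) z = mpoly_eval (X(x := z)) p" for p z
    by (simp add: u_def mpoly_eval_monom_eval poly_sum poly_monom monom_eval_upd red_def algebra_simps)
  have "u p \<noteq> 0" if "p \<in> P" for p
  proof -
    from that have "keys p \<noteq> {}"
      by (auto simp: P_def)
    then obtain t0 where t0: "t0 \<in> keys p"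
      by blast
    define k where "k = lookup t0 x"
    \<comment> \<open>\<open>q\<close> is the coefficient of \<open>x\<^sup>k\<close> in \<open>p\<close>; it is non-zero because \<open>t0\<close> contributes to it.\<close>
    define q where "q = (\<Sum>t\<in>{t \<in> keys p. lookup t x = k}. single (red t) (lookup p t))"
    have lookup_q: "lookup q s = (if lookup s x = 0 then lookup p (s + single x k) else 0)" for s
    proof -
      have "red t = s \<longleftrightarrow> lookup s x = 0 \<and> t = s + single x k" if "lookup t x = k" for t
      proof
        assume "red t = s"
        then have s: "s = t - single x k"
          using that by (simp add: red_def)
        have "t = s + single x k"
          unfolding s by (rule poly_mapping_eqI) (use that in \<open>auto simp: lookup_minus lookup_add lookup_single when_def\<close>)
        moreover have "lookup s x = 0"
          by (simp add: s lookup_minus that)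
        ultimately show "lookup s x = 0 \<and> t = s + single x k" by simp
      next
        assume "lookup s x = 0 \<and> t = s + single x k"
        then show "red t = s"
          by (intro poly_mapping_eqI) (simp add: red_def lookup_minus lookup_add)
      qed
      then have "lookup q s = (\<Sum>t\<in>{t \<in> keys p. lookup t x = k}.
          if lookup s x = 0 \<and> t = s + single x k then lookup p t else 0)"
        unfolding q_def lookup_sum lookup_single when_def by (intro sum.cong) auto
      also have "\<dots> = (if lookup s x = 0 then lookup p (s + single x k) else 0)"
        by (cases "lookup s x = 0") (auto simp: sum.delta lookup_add in_keys_iff)
      finally show ?thesis .
    qed
    have "mpoly_vars q \<subseteq> V"
      unfolding q_def
    proof (rule mpoly_vars_sum)
      fix t assume t: "t \<in> {t \<in> keys p. lookup t x = k}"
      have "keys (red t) \<subseteq> keys t - {x}"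
        by (auto simp: red_def in_keys_iff lookup_minus lookup_single when_def)
      moreover have "keys t \<subseteq> insert x V"
        using t \<open>p \<in> P\<close> by (auto simp: P_def mpoly_vars_def)
      ultimately show "mpoly_vars (single (red t) (lookup p t)) \<subseteq> V"
        using mpoly_vars_single[of "red t" "lookup p t"] by blast
    qed
    moreover have "q \<in> coeffs_in K"
      using \<open>p \<in> P\<close> \<open>0 \<in> K\<close> by (auto simp: coeffs_in_def lookup_q P_def)
    moreover have "red t0 + single x k = t0"
      by (rule poly_mapping_eqI) (auto simp: red_def k_def lookup_add lookup_minus lookup_single when_def)
    then have "lookup q (red t0) \<noteq> 0"
      using t0 by (auto simp: lookup_q in_keys_iff red_def lookup_minus)
    then have "q \<noteq> 0"
      by auto
    ultimately have "mpoly_eval X q \<noteq> 0"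
      by (intro X)
    also have "mpoly_eval X q = coeff (u p) k"
      by (simp add: q_def u_def coeff_sum mpoly_eval_simps sum.If_cases Int_def if_distrib cong: if_cong)
    finally show ?thesis
      by auto
  qed
  then have "countable {z. poly (u p) z = 0}" if "p \<in> P" for p
    using that by (intro countable_finite poly_roots_finite) auto
  moreover have "countable {t. keys t \<subseteq> insert x V \<and> (\<forall>x. lookup t x \<in> (UNIV :: nat set))}"
    using insert.hyps by (intro countable_poly_mappings) (auto intro: countable_finite)
  then have "countable {p :: ('x, complex) mpoly. keys p \<subseteq> {t. keys t \<subseteq> insert x V \<and> (\<forall>x. lookup t x \<in> (UNIV :: nat set))} \<and> (\<forall>t. lookup p t \<in> K)}"
    by (rule countable_poly_mappings[OF _ assms(2)])
  then have "countable P"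
    by (rule countable_subset[rotated]) (auto simp: P_def mpoly_vars_def coeffs_in_def)
  ultimately have "countable (\<Union>p\<in>P. {z. poly (u p) z = 0})"
    by blast
  moreover have "uncountable (UNIV :: complex set)"
  proof
    assume "countable (UNIV :: complex set)"
    then have "countable (range complex_of_real)"
      by (rule countable_subset[rotated]) simp
    then have "countable (UNIV :: real set)"
      by (rule countable_image_inj_on) (simp add: inj_on_def)
    then show False
      using uncountable_UNIV_real by blast
  qed
  ultimately obtain z where z: "z \<notin> (\<Union>p\<in>P. {z. poly (u p) z = 0})"
    by (metis UNIV_eq_I)
  then have "mpoly_eval (X(x := z)) p \<noteq> 0" if "p \<in> P" for p
    using that poly_u by auto
  then show ?case
    unfolding P_def by blast
qed

section \<open>Derivatives and linear substitutions\<close>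

definition mvar :: "'x \<Rightarrow> ('x, 'a::comm_semiring_1) mpoly" where
  "mvar x = single (single x 1) 1"

lemma mpoly_eval_mvar [simp]: "mpoly_eval a (mvar x) = a x"
  by (simp add: mvar_def mpoly_eval_simps)

lemma mpoly_eval_const [simp]: "mpoly_eval a (single 0 c) = c"
  by (simp add: mpoly_eval_simps)

lemma mpoly_vars_mvar: "mpoly_vars (mvar x) \<subseteq> {x}"
  using mpoly_vars_single[of "single x 1" 1] by (simp add: mvar_def)

lemma mpoly_vars_const [simp]: "mpoly_vars (single 0 c) = {}"
  using mpoly_vars_single[of 0 c] by simp

lemma mpoly_compose_mvar [simp]: "mpoly_compose f (mvar x) = f x"
  by (simp add: mvar_def mpoly_compose_simps)

lemma mpoly_compose_const [simp]: "mpoly_compose f (single 0 c) = single 0 c"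
  by (simp add: mpoly_compose_simps)

lemma monomial_induct [consumes 1, case_names one step]:
  fixes t :: "'x monomial"
  assumes "keys t \<subseteq> V" "P 0" "\<And>x t. x \<in> V \<Longrightarrow> P t \<Longrightarrow> P (single x 1 + t)"
  shows "P t"
  using assms(1)
proof (induction "\<Sum>x\<in>keys t. lookup t x" arbitrary: t)
  case 0
  then have "t = 0"
    by (intro poly_mapping_eqI) (auto simp: in_keys_iff)
  then show ?case using assms(2) by simp
next
  case (Suc n)
  then obtain x where x: "x \<in> keys t"
    by (metis Suc_neq_Zero sum.empty ex_in_conv)
  let ?s = "t - single x 1"
  have t: "t = single x 1 + ?s"
    using x by (intro poly_mapping_eqI) (auto simp: lookup_add lookup_minus lookup_single when_def in_keys_iff)
  have sub: "keys ?s \<subseteq> keys t"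
    by (auto simp: in_keys_iff lookup_minus)
  have "lookup t y = (if y = x then 1 else 0) + lookup ?s y" for y
  proof -
    have "lookup t y = lookup (single x 1) y + lookup ?s y"
      using t lookup_add by metis
    then show ?thesis by (simp add: lookup_single when_def)
  qed
  then have "(\<Sum>y\<in>keys t. lookup t y) = (\<Sum>y\<in>keys t. (if y = x then 1 else 0) + lookup ?s y)"
    by (intro sum.cong) auto
  also have "\<dots> = (\<Sum>y\<in>keys t. if y = x then 1 else 0) + (\<Sum>y\<in>keys t. lookup ?s y)"
    by (rule sum.distrib)
  also have "(\<Sum>y\<in>keys t. lookup ?s y) = (\<Sum>y\<in>keys ?s. lookup ?s y)"
    by (rule sum.mono_neutral_right) (use sub in \<open>auto simp: in_keys_iff\<close>)
  finally have "n = (\<Sum>y\<in>keys ?s. lookup ?s y)"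
    using Suc.hyps(2) x by simp
  then have "P ?s"
    using Suc.hyps(1)[of ?s] sub Suc.prems by blast
  then show ?case
    using assms(3)[of x ?s] t x Suc.prems by auto
qed

lemma mpoly_vars_induct [consumes 1, case_names const add var]:
  fixes p :: "('x, 'a::comm_semiring_1) mpoly"
  assumes "mpoly_vars p \<subseteq> V"
    and const: "\<And>c. P (single 0 c)"
    and add: "\<And>p q. mpoly_vars p \<subseteq> V \<Longrightarrow> mpoly_vars q \<subseteq> V \<Longrightarrow> P p \<Longrightarrow> P q \<Longrightarrow> P (p + q)"
    and var: "\<And>x p. x \<in> V \<Longrightarrow> mpoly_vars p \<subseteq> V \<Longrightarrow> P p \<Longrightarrow> P (mvar x * p)"
  shows "P p"
proof -
  have mono: "mpoly_vars (single t c) \<subseteq> V \<and> P (single t c)" if "keys t \<subseteq> V" for t and c :: 'a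
    using that
  proof (induction t rule: monomial_induct)
    case (step x t)
    have "single (single x 1 + t) c = mvar x * single t c"
      by (simp add: mvar_def mult_single)
    moreover have "mpoly_vars (mvar x :: ('x, 'a) mpoly) \<subseteq> {x}"
      by (rule mpoly_vars_mvar)
    moreover have "mpoly_vars (single t c) \<subseteq> V" "P (single t c)"
      using step.IH by auto
    moreover from this have "P (mvar x * single t c)"
      using step.hyps by (intro var)
    moreover have "mpoly_vars (mvar x * single t c) \<subseteq> mpoly_vars (mvar x :: ('x, 'a) mpoly) \<union> mpoly_vars (single t c)"
      by (rule mpoly_vars_mult)
    ultimately show ?case
      using step.hyps by auto
  qed (auto simp: const)
  have "mpoly_vars (\<Sum>t\<in>S. single t (lookup p t)) \<subseteq> V \<and> P (\<Sum>t\<in>S. single t (lookup p t))" if "finite S" "S \<subseteq> keys p" for S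
    using that
  proof (induction S rule: finite_induct)
    case empty
    then show ?case using const[of 0] by simp
  next
    case (insert t S)
    then have "keys t \<subseteq> V"
      using assms(1) by (auto simp: mpoly_vars_def)
    from mono[OF this, of "lookup p t"] insert
      show ?case
      using add[of "single t (lookup p t)" "\<Sum>t\<in>S. single t (lookup p t)"]
        mpoly_vars_add[of "single t (lookup p t)" "\<Sum>t\<in>S. single t (lookup p t)"]
      by (simp, blast)
  qed
  from this[of "keys p"] show ?thesis
    using mpoly_sum_monomials[of p] by simp
qed

definition mderiv :: "'x \<Rightarrow> ('x, 'a::comm_semiring_1) mpoly \<Rightarrow> ('x, 'a) mpoly" where
  "mderiv x p = (\<Sum>t\<in>keys p. single (t - single x 1) (of_nat (lookup t x) * lookup p t))"

lemma lookup_mderiv: "lookup (mderiv x p) s = of_nat (Suc (lookup s x)) * lookup p (single x 1 + s)"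
proof -
  have "lookup (mderiv x p) s = (\<Sum>t\<in>keys p. if t = single x 1 + s then of_nat (lookup t x) * lookup p t else 0)"
    unfolding mderiv_def lookup_sum lookup_single when_def
  proof (intro sum.cong refl)
    fix t
    show "(if t - single x 1 = s then of_nat (lookup t x) * lookup p t else 0) =
          (if t = single x 1 + s then of_nat (lookup t x) * lookup p t else 0)"
    proof (cases "lookup t x = 0")
      case False
      then have "t - single x 1 = s \<longleftrightarrow> t = single x 1 + s"
        unfolding poly_mapping_eq_iff fun_eq_iff
        by (auto simp: lookup_minus lookup_add lookup_single when_def)
      then show ?thesis by simp
    qed auto
  qed
  also have "\<dots> = of_nat (Suc (lookup s x)) * lookup p (single x 1 + s)"
    by (auto simp: sum.delta in_keys_iff lookup_add)
  finally show ?thesis .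
qed

lemma mderiv_add: "mderiv x (p + q) = mderiv x p + mderiv x q"
  by (rule poly_mapping_eqI) (simp add: lookup_mderiv lookup_add algebra_simps)

lemma mderiv_const [simp]: "mderiv x (single 0 c) = 0"
proof (rule poly_mapping_eqI)
  fix s :: "'a monomial"
  have "single x 1 + s \<noteq> 0"
    by (metis keys_add_nat keys_zero Un_empty keys_single zero_neq_one insert_not_empty)
  then show "lookup (mderiv x (single 0 c)) s = lookup 0 s"
    by (simp add: lookup_mderiv lookup_single)
qed

lemma mderiv_single: "mderiv x (single t c) = single (t - single x 1) (of_nat (lookup t x) * c)"
  by (cases "c = 0") (auto simp: mderiv_def)

lemma mderiv_mult: "mderiv x (p * q) = mderiv x p * q + p * mderiv x (q :: ('x, 'a::comm_semiring_1) mpoly)"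
proof (induction p rule: mpoly_induct)
  case (single s c)
  show ?case
  proof (induction q rule: mpoly_induct)
    case (single t d)
    have 1: "single (s + t - single x 1) (of_nat (lookup s x) * (c * d)) =
      single ((s - single x 1) + t) (of_nat (lookup s x) * (c * d))"
    proof (cases "lookup s x = 0")
      case False
      then have "s + t - single x 1 = (s - single x 1) + t"
        by (intro poly_mapping_eqI) (auto simp: lookup_minus lookup_add lookup_single when_def)
      then show ?thesis by simp
    qed simp
    have 2: "single (s + t - single x 1) (of_nat (lookup t x) * (c * d)) =
      single (s + (t - single x 1)) (of_nat (lookup t x) * (c * d))"
    proof (cases "lookup t x = 0")
      case False
      then have "s + t - single x 1 = s + (t - single x 1)"
        by (intro poly_mapping_eqI) (auto simp: lookup_minus lookup_add lookup_single when_def)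
      then show ?thesis by simp
    qed simp
    show ?case
      using 1 2 by (simp add: mult_single mderiv_single lookup_add single_add algebra_simps)
  next
    case (add p q)
    then show ?case by (simp add: mderiv_add algebra_simps)
  qed
next
  case (add p q)
  then show ?case by (simp add: mderiv_add algebra_simps)
qed

lemma mderiv_mvar: "mderiv x (mvar y) = (if x = y then 1 else 0)"
  by (auto simp: mvar_def mderiv_single lookup_single when_def)

lemma mpoly_vars_mderiv: "mpoly_vars (mderiv x p) \<subseteq> mpoly_vars p"
proof
  fix y assume "y \<in> mpoly_vars (mderiv x p)"
  then obtain s where s: "lookup (mderiv x p) s \<noteq> 0" "y \<in> keys s"
    by (auto simp: mpoly_vars_def in_keys_iff)
  then have "lookup p (single x 1 + s) \<noteq> 0"
    by (auto simp: lookup_mderiv)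
  then show "y \<in> mpoly_vars p"
    using s(2) unfolding mpoly_vars_def
    by (intro UN_I[of "single x 1 + s"]) (auto simp: keys_add_nat in_keys_iff)
qed

lemma mderiv_sum: "mderiv x (sum p A) = (\<Sum>i\<in>A. mderiv x (p i))"
proof (induction A rule: infinite_finite_induct)
  case (insert i A)
  then show ?case by (simp add: mderiv_add)
qed (use mderiv_const[of x 0] in auto)

definition lin_form :: "'x set \<Rightarrow> ('x \<Rightarrow> 'x \<Rightarrow> 'a) \<Rightarrow> 'x \<Rightarrow> ('x, 'a::comm_semiring_1) mpoly" where
  "lin_form V H x = (\<Sum>y\<in>V. single 0 (H x y) * mvar y)"

abbreviation lin_subst :: "'x set \<Rightarrow> ('x \<Rightarrow> 'x \<Rightarrow> 'a) \<Rightarrow> ('x, 'a::comm_semiring_1) mpoly \<Rightarrow> ('x, 'a) mpoly" where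
  "lin_subst V H \<equiv> mpoly_compose (lin_form V H)"

lemma mderiv_lin_form:
  assumes "finite V" "z \<in> V"
  shows "mderiv z (lin_form V H x) = single 0 (H x z)"
  using assms
  by (simp add: lin_form_def mderiv_sum mderiv_mult mderiv_mvar if_distrib cong: if_cong)

text \<open>The chain rule for a linear substitution.\<close>

lemma mderiv_lin_subst:
  assumes "finite V" "z \<in> V" "mpoly_vars q \<subseteq> V"
  shows "mderiv z (lin_subst V H q) = (\<Sum>y\<in>V. single 0 (H y z) * lin_subst V H (mderiv y q))"
  using assms(3)
proof (induction q rule: mpoly_vars_induct)
  case (const c)
  then show ?case by (simp add: mpoly_compose_simps(2))
next
  case (add p q)
  then show ?case
    by (simp add: mpoly_compose_simps(1) mderiv_add sum.distrib algebra_simps)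
next
  case (var x p)
  have "(\<Sum>y\<in>V. single 0 (H y z) * lin_subst V H (mderiv y (mvar x * p))) =
    (\<Sum>y\<in>V. (if y = x then single 0 (H y z) * lin_subst V H p else 0) +
       lin_form V H x * (single 0 (H y z) * lin_subst V H (mderiv y p)))"
    by (intro sum.cong)
       (auto simp: mderiv_mult mderiv_mvar mpoly_compose_simps(1,2,4,5) algebra_simps)
  also have "\<dots> = single 0 (H x z) * lin_subst V H p + lin_form V H x * mderiv z (lin_subst V H p)"
    using assms(1) var by (simp add: sum.distrib sum.delta sum_distrib_left)
  also have "\<dots> = mderiv z (lin_subst V H (mvar x * p))"
    using assms by (simp add: mpoly_compose_simps(5) mderiv_mult mderiv_lin_form)
  finally show ?case ..
qed

section \<open>The Fischer pairing\<close>

definition monomial_fact :: "'x monomial \<Rightarrow> nat" where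
  "monomial_fact t = (\<Prod>x\<in>keys t. fact (lookup t x))"

lemma monomial_fact_superset:
  assumes "finite S" "keys t \<subseteq> S"
  shows "monomial_fact t = (\<Prod>x\<in>S. fact (lookup t x))"
  unfolding monomial_fact_def
  by (rule prod.mono_neutral_left) (use assms in \<open>auto simp: in_keys_iff\<close>)

lemma monomial_fact_step: "monomial_fact (single x 1 + t) = Suc (lookup t x) * monomial_fact t"
proof -
  let ?S = "insert x (keys t)"
  have "monomial_fact (single x 1 + t) = (\<Prod>y\<in>?S. fact (lookup (single x 1 + t) y))"
    by (rule monomial_fact_superset) (auto simp: keys_add_nat)
  also have "\<dots> = (\<Prod>y\<in>?S. (if y = x then Suc (lookup t x) else 1) * fact (lookup t y))"
    by (intro prod.cong) (auto simp: lookup_add lookup_single when_def)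
  also have "\<dots> = Suc (lookup t x) * (\<Prod>y\<in>?S. fact (lookup t y))"
    unfolding prod.distrib by (subst prod.delta) auto
  also have "(\<Prod>y\<in>?S. fact (lookup t y)) = monomial_fact t"
    by (rule monomial_fact_superset[symmetric]) auto
  finally show ?thesis .
qed

text \<open>This is \<open>p(\<partial>) q\<close> evaluated at \<open>0\<close>. No complex conjugation is applied, so that the pairing is bilinear.\<close>

definition fischer :: "('x, 'a::comm_semiring_1) mpoly \<Rightarrow> ('x, 'a) mpoly \<Rightarrow> 'a" where
  "fischer p q = (\<Sum>t\<in>keys p. of_nat (monomial_fact t) * lookup p t * lookup q t)"

lemma fischer_superset:
  assumes "finite S" "keys p \<subseteq> S"
  shows "fischer p q = (\<Sum>t\<in>S. of_nat (monomial_fact t) * lookup p t * lookup q t)"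
  unfolding fischer_def
  by (rule sum.mono_neutral_left) (use assms in \<open>auto simp: in_keys_iff\<close>)

lemma fischer_commute: "fischer p q = fischer q p"
proof -
  have "fischer p q = (\<Sum>t\<in>keys p \<union> keys q. of_nat (monomial_fact t) * lookup p t * lookup q t)"
    by (rule fischer_superset) auto
  also have "\<dots> = (\<Sum>t\<in>keys p \<union> keys q. of_nat (monomial_fact t) * lookup q t * lookup p t)"
    by (simp add: mult_ac)
  also have "\<dots> = fischer q p"
    by (rule fischer_superset[symmetric]) auto
  finally show ?thesis .
qed

lemma fischer_add_right: "fischer p (q + r) = fischer p q + fischer p r"
  by (simp add: fischer_def lookup_add distrib_left sum.distrib)

lemma fischer_add_left: "fischer (p + q) r = fischer p r + fischer q r"
  using fischer_add_right[of r p q] by (simp add: fischer_commute)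

lemma fischer_zero [simp]: "fischer p 0 = 0" "fischer 0 p = 0"
  by (simp_all add: fischer_def)

lemma fischer_sum_right: "fischer p (sum q A) = (\<Sum>i\<in>A. fischer p (q i))"
  by (induction A rule: infinite_finite_induct) (simp_all add: fischer_add_right)

lemma fischer_sum_left: "fischer (sum q A) p = (\<Sum>i\<in>A. fischer (q i) p)"
  using fischer_sum_right[of p q A] by (simp add: fischer_commute)

lemma lookup_const_mult:
  fixes p :: "('x, 'a::comm_semiring_1) mpoly"
  shows "lookup (single 0 c * p) t = c * lookup p t"
  by (induction p rule: mpoly_induct)
     (auto simp: mult_single lookup_single when_def lookup_add algebra_simps)

lemma fischer_scale_right: "fischer p (single 0 c * q) = c * fischer p q"
  unfolding fischer_def lookup_const_mult sum_distrib_left by (simp add: mult_ac)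

lemma fischer_scale_left: "fischer (single 0 c * p) q = c * fischer p q"
  using fischer_scale_right[of q c p] by (simp add: fischer_commute)

lemma fischer_single_left: "fischer (single t c) q = of_nat (monomial_fact t) * c * lookup q t"
  by (cases "c = 0") (auto simp: fischer_def)

text \<open>Multiplication by a variable is adjoint to the derivative; this determines the pairing.\<close>

lemma fischer_mvar_mult: "fischer (mvar x * p) q = fischer p (mderiv x q)"
proof (induction p rule: mpoly_induct)
  case (single t c)
  have "mvar x * single t c = single (single x 1 + t) c"
    by (simp add: mvar_def mult_single)
  then have "fischer (mvar x * single t c) q =
      of_nat (Suc (lookup t x) * monomial_fact t) * c * lookup q (single x 1 + t)"
    by (simp only: fischer_single_left monomial_fact_step)
  also have "\<dots> = fischer (single t c) (mderiv x q)"
    by (simp only: fischer_single_left lookup_mderiv of_nat_mult mult_ac)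
  finally show ?case .
next
  case (add p q)
  then show ?case by (simp add: distrib_left fischer_add_left)
qed

lemma lookup_0_eval: "lookup p 0 = mpoly_eval (\<lambda>_. 0) (p :: ('x, 'a::comm_semiring_1) mpoly)"
proof (induction p rule: mpoly_induct)
  case (single t c)
  show ?case
  proof (cases "t = 0")
    case False
    then obtain x where "x \<in> keys t" by (metis ex_in_conv keys_empty_iff)
    then have "monom_eval (\<lambda>_. 0) t = (0::'a)"
      unfolding monom_eval_def by (intro prod_zero bexI[of _ x]) (auto simp: in_keys_iff zero_power)
    with False show ?thesis by (simp add: mpoly_eval_simps lookup_single)
  qed simp
qed (simp_all add: lookup_add mpoly_eval_simps)

text \<open>Both sides change in the same way when \<open>p\<close> is multiplied by a variable: on the left the variable becomes a
linear form, on the right the chain rule produces the transposed coefficients.\<close>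

lemma fischer_lin_subst:
  assumes "finite V" "mpoly_vars p \<subseteq> V" "mpoly_vars q \<subseteq> V"
  shows "fischer (lin_subst V H p) q = fischer p (lin_subst V (\<lambda>x y. H y x) q)"
  using assms(2,3)
proof (induction p arbitrary: q rule: mpoly_vars_induct)
  case (const c)
  have "lookup (lin_subst V (\<lambda>x y. H y x) q) 0 = lookup q 0"
    by (simp add: lookup_0_eval mpoly_eval_compose lin_form_def mpoly_eval_simps)
  then show ?case by (simp add: fischer_single_left)
next
  case (add p p')
  then show ?case by (simp add: mpoly_compose_simps fischer_add_left)
next
  case (var x p)
  have "fischer (lin_subst V H (mvar x * p)) q =
      (\<Sum>y\<in>V. H x y * fischer (lin_subst V H p) (mderiv y q))"
    by (simp add: mpoly_compose_simps(5) lin_form_def sum_distrib_right fischer_sum_left mult.assoc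
        fischer_scale_left fischer_mvar_mult)
  also have "\<dots> = (\<Sum>y\<in>V. H x y * fischer p (lin_subst V (\<lambda>x y. H y x) (mderiv y q)))"
    using var.prems
    by (intro sum.cong refl arg_cong2[where f = "(*)"] var.IH subset_trans[OF mpoly_vars_mderiv]) auto
  also have "\<dots> = fischer p (mderiv x (lin_subst V (\<lambda>x y. H y x) q))"
    using assms(1) var by (simp add: mderiv_lin_subst fischer_sum_right fischer_scale_right)
  also have "\<dots> = fischer (mvar x * p) (lin_subst V (\<lambda>x y. H y x) q)"
    by (simp add: fischer_mvar_mult)
  finally show ?case .
qed

lemma norm_fischer_le:
  fixes p q :: "('x, complex) mpoly"
  assumes "\<And>t. t \<in> keys p \<Longrightarrow> real (monomial_fact t) \<le> W"
  shows "cmod (fischer p q) \<le> W * coeff_norm p * coeff_norm q"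
proof -
  have le: "cmod (lookup q t) \<le> coeff_norm q" for t
  proof (cases "t \<in> keys q")
    case True
    then show ?thesis unfolding coeff_norm_def by (intro member_le_sum) auto
  qed (auto simp: in_keys_iff coeff_norm_nonneg)
  have "cmod (fischer p q) \<le> (\<Sum>t\<in>keys p. cmod (of_nat (monomial_fact t) * lookup p t * lookup q t))"
    unfolding fischer_def by (rule norm_sum)
  also have "\<dots> \<le> (\<Sum>t\<in>keys p. W * cmod (lookup p t) * coeff_norm q)"
    unfolding norm_mult norm_of_nat
    using assms le
    by (intro sum_mono mult_mono mult_nonneg_nonneg) (auto intro: order.trans[OF of_nat_0_le_iff])
  also have "\<dots> = W * coeff_norm p * coeff_norm q"
    by (simp add: coeff_norm_def sum_distrib_left sum_distrib_right mult_ac)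
  finally show ?thesis .
qed

declare Poly_Mapping.single_of_int [simp del] Poly_Mapping.single_of_nat [simp del]

lemma mpoly_eval_const_mult: "mpoly_eval a (single 0 c * p) = c * mpoly_eval a p"
  by (simp add: mpoly_eval_simps(5))

lemma mpoly_vars_const_mult: "mpoly_vars (single 0 c * p) \<subseteq> mpoly_vars (p :: ('x, 'a::comm_semiring_1) mpoly)"
  using mpoly_vars_mult[of "single 0 c" p] by simp

lemma coeff_norm_const_mult: "coeff_norm (single 0 c * p) \<le> cmod c * coeff_norm p"
  using coeff_norm_mult[of "single 0 c" p] by simp

section \<open>Weights of monomials\<close>

definition weight :: "('x \<Rightarrow> nat) \<Rightarrow> 'x monomial \<Rightarrow> nat" where
  "weight c t = (\<Sum>x\<in>keys t. c x * lookup t x)"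

lemma weight_superset:
  assumes "finite S" "keys t \<subseteq> S"
  shows "weight c t = (\<Sum>x\<in>S. c x * lookup t x)"
  unfolding weight_def
  by (rule sum.mono_neutral_left) (use assms in \<open>auto simp: in_keys_iff\<close>)

lemma weight_add: "weight c (s + t) = weight c s + weight c t"
proof -
  let ?S = "keys s \<union> keys t"
  have "weight c (s + t) = (\<Sum>x\<in>?S. c x * lookup (s + t) x)"
    by (rule weight_superset) (auto simp: keys_add_nat)
  also have "\<dots> = (\<Sum>x\<in>?S. c x * lookup s x) + (\<Sum>x\<in>?S. c x * lookup t x)"
    by (simp add: lookup_add distrib_left sum.distrib)
  also have "\<dots> = weight c s + weight c t"
    by (subst (1 2) weight_superset[of ?S]) auto
  finally show ?thesis .
qed

lemma weight_0 [simp]: "weight c 0 = 0"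
  by (simp add: weight_def)

lemma weight_single [simp]: "weight c (single x n) = c x * n"
  by (cases "n = 0") (auto simp: weight_def)

text \<open>A set of weights is allowed, because homogeneity (a singleton) and degree bounds (an initial segment) are
used in the same way.\<close>

definition wt_in :: "('x \<Rightarrow> nat) \<Rightarrow> nat set \<Rightarrow> ('x, 'a::zero) mpoly \<Rightarrow> bool" where
  "wt_in c W p \<longleftrightarrow> (\<forall>t\<in>keys p. weight c t \<in> W)"

lemma wt_in_0 [simp]: "wt_in c W 0"
  by (simp add: wt_in_def)

lemma wt_in_single: "weight c t \<in> W \<Longrightarrow> wt_in c W (single t a)"
  by (simp add: wt_in_def)

lemma wt_in_add: "wt_in c W p \<Longrightarrow> wt_in c W q \<Longrightarrow> wt_in c W (p + q)"
  using keys_add[of p q] by (auto simp: wt_in_def)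

lemma wt_in_sum: "(\<And>i. i \<in> A \<Longrightarrow> wt_in c W (p i)) \<Longrightarrow> wt_in c W (sum p A)"
  by (induction A rule: infinite_finite_induct) (auto intro: wt_in_add)

lemma wt_in_mult:
  fixes p q :: "('x, 'a::comm_semiring_1) mpoly"
  assumes "wt_in c W p" "wt_in c W' q" "\<And>a b. a \<in> W \<Longrightarrow> b \<in> W' \<Longrightarrow> a + b \<in> W''"
  shows "wt_in c W'' (p * q)"
  unfolding wt_in_def
proof
  fix t assume "t \<in> keys (p * q)"
  then obtain u v where "u \<in> keys p" "v \<in> keys q" "t = u + v"
    using keys_mult[of p q] by auto
  then show "weight c t \<in> W''"
    using assms by (auto simp: wt_in_def weight_add)
qed

lemma wt_in_prod_eq:
  fixes p :: "'i \<Rightarrow> ('x, 'a::comm_semiring_1) mpoly"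
  assumes "finite A" "\<And>i. i \<in> A \<Longrightarrow> wt_in c {r i} (p i)"
  shows "wt_in c {sum r A} (prod p A)"
  using assms
proof (induction A rule: finite_induct)
  case empty
  then show ?case by (auto simp: wt_in_def)
next
  case (insert x F)
  have "wt_in c {sum r (insert x F)} (p x * prod p F)"
    by (rule wt_in_mult[where W = "{r x}" and W' = "{sum r F}"]) (use insert in auto)
  with insert show ?case by simp
qed

lemma wt_in_prod_le:
  fixes p :: "'i \<Rightarrow> ('x, 'a::comm_semiring_1) mpoly"
  assumes "finite A" "\<And>i. i \<in> A \<Longrightarrow> wt_in c {..r i} (p i)"
  shows "wt_in c {..sum r A} (prod p A)"
  using assms
proof (induction A rule: finite_induct)
  case empty
  then show ?case by (auto simp: wt_in_def)
next
  case (insert x F)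
  have "wt_in c {..sum r (insert x F)} (p x * prod p F)"
    by (rule wt_in_mult[where W = "{..r x}" and W' = "{..sum r F}"]) (use insert in auto)
  with insert show ?case by simp
qed

lemma wt_in_power_eq:
  fixes p :: "('x, 'a::comm_semiring_1) mpoly"
  shows "wt_in c {r} p \<Longrightarrow> wt_in c {e * r} (p ^ e)"
  using wt_in_prod_eq[of "{..<e}" c "\<lambda>_. r" "\<lambda>_. p"] by simp

lemma wt_in_power_le:
  fixes p :: "('x, 'a::comm_semiring_1) mpoly"
  shows "wt_in c {..r} p \<Longrightarrow> wt_in c {..e * r} (p ^ e)"
  using wt_in_prod_le[of "{..<e}" c "\<lambda>_. r" "\<lambda>_. p"] by simp

section \<open>Determinants as polynomials\<close>

text \<open>The entry \<open>(i, j)\<close> is the variable \<open>f (i, j)\<close>; the renaming \<open>f\<close> places the determinant in one factor of a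
product of matrix groups.\<close>

definition det_mpoly :: "nat \<Rightarrow> (nat \<times> nat \<Rightarrow> 'x) \<Rightarrow> ('x, complex) mpoly" where
  "det_mpoly n f = (\<Sum>p | p permutes {0..<n}. single 0 (signof p) * (\<Prod>i = 0..<n. mvar (f (i, p i))))"

lemma eval_det_mpoly: "mpoly_eval X (det_mpoly n f) = det (mat n n (\<lambda>ij. X (f ij)))"
proof -
  have "p i < n" if "p permutes {0..<n}" "i < n" for p i
    using permutes_in_image[OF that(1), of i] that(2) by simp
  then show ?thesis
    by (subst det_def'[of _ n])
      (auto simp: det_mpoly_def mpoly_eval_const_mult mpoly_eval_simps(7,8) intro!: sum.cong prod.cong)
qed

lemma vars_det_mpoly: "mpoly_vars (det_mpoly n f) \<subseteq> f ` ({..<n} \<times> {..<n})"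
  unfolding det_mpoly_def
proof (rule mpoly_vars_sum)
  fix p assume "p \<in> {p. p permutes {0..<n}}"
  then have "p i < n" if "i < n" for i
    using permutes_in_image[of p "{0..<n}" i] that by simp
  then have "mpoly_vars (\<Prod>i = 0..<n. mvar (f (i, p i)) :: ('a, complex) mpoly) \<subseteq> f ` ({..<n} \<times> {..<n})"
    by (intro mpoly_vars_prod order.trans[OF mpoly_vars_mvar]) auto
  then show "mpoly_vars (single 0 (signof p) * (\<Prod>i = 0..<n. mvar (f (i, p i)) :: ('a, complex) mpoly)) \<subseteq> f ` ({..<n} \<times> {..<n})"
    by (rule order.trans[OF mpoly_vars_const_mult])
qed

lemma subsemiring_Ints: "subsemiring (\<int> :: 'a::comm_ring_1 set)"
  by (auto simp: subsemiring_def)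

lemma coeffs_in_mvar: "subsemiring K \<Longrightarrow> mvar x \<in> coeffs_in K"
  unfolding mvar_def by (rule coeffs_in_single) (auto dest: subsemiringD)

lemma det_mpoly_Ints: "det_mpoly n f \<in> coeffs_in \<int>"
proof -
  note K = subsemiring_coeffs_in[OF subsemiring_Ints]
  show ?thesis
    unfolding det_mpoly_def
    by (intro subsemiring_sum[OF K] subsemiringD(4)[OF K] subsemiring_prod[OF K] coeffs_in_mvar
        subsemiring_Ints coeffs_in_single) (auto simp: sign_def)
qed

lemma coeff_norm_det_mpoly: "coeff_norm (det_mpoly n f) \<le> fact n"
proof -
  have "coeff_norm (det_mpoly n f) \<le> (\<Sum>p | p permutes {0..<n}. 1)"
    unfolding det_mpoly_def
  proof (rule order.trans[OF coeff_norm_sum], rule sum_mono)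
    fix p assume "p \<in> {p. p permutes {0..<n}}"
    have "coeff_norm (\<Prod>i = 0..<n. mvar (f (i, p i)) :: ('a, complex) mpoly) \<le> 1"
      by (rule order.trans[OF coeff_norm_prod]) (simp add: mvar_def)
    then show "coeff_norm (single 0 (signof p) * (\<Prod>i = 0..<n. mvar (f (i, p i)) :: ('a, complex) mpoly)) \<le> 1"
      by (intro order.trans[OF coeff_norm_const_mult]) (auto simp: sign_def)
  qed
  also have "\<dots> = fact n"
    using card_permutations[of "{0..<n}" n] by simp
  finally show ?thesis .
qed

lemma det_mpoly_nonzero:
  assumes "inj_on f ({..<n} \<times> {..<n})"
  shows "det_mpoly n f \<noteq> 0"
proof -
  define X where "X x = (if \<exists>i<n. x = f (i, i) then 1 else 0 :: complex)" for x
  have "mat n n (\<lambda>ij. X (f ij)) = 1\<^sub>m n"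
    using assms by (intro eq_matI) (auto simp: X_def inj_on_def)
  then have "mpoly_eval X (det_mpoly n f) = 1"
    by (simp add: eval_det_mpoly)
  then show ?thesis
    by (auto simp: mpoly_eval_simps)
qed

lemma generic_point_finite:
  fixes P :: "('x, complex) mpoly set"
  assumes "finite V" "finite P" "\<And>p. p \<in> P \<Longrightarrow> p \<noteq> 0 \<and> mpoly_vars p \<subseteq> V"
  obtains X where "\<And>p. p \<in> P \<Longrightarrow> mpoly_eval X p \<noteq> 0"
proof -
  define K where "K = insert 0 (\<Union>p\<in>P. lookup p ` keys p)"
  have "countable K"
    unfolding K_def using assms(2) by (intro countable_finite) auto
  moreover have "p \<in> coeffs_in K" if "p \<in> P" for p
    unfolding coeffs_in_def K_def mem_Collect_eq
  proof
    fix t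
    show "lookup p t \<in> insert 0 (\<Union>p\<in>P. lookup p ` keys p)"
    proof (cases "t \<in> keys p")
      case True
      then show ?thesis using that by (intro insertI2 UN_I[of p] imageI)
    qed (simp add: in_keys_iff)
  qed
  moreover have "0 \<in> K" by (simp add: K_def)
  ultimately show thesis
    using generic_point[OF assms(1), of K] assms(3) that by blast
qed

section \<open>Products of general linear groups\<close>

text \<open>A variable \<open>(l, i, j)\<close> stands for the entry \<open>(i, j)\<close> of the \<open>l\<close>-th matrix.\<close>

definition Vars :: "nat \<Rightarrow> (nat \<Rightarrow> nat) \<Rightarrow> (nat \<times> nat \<times> nat) set" where
  "Vars k n = (SIGMA l:{..<k}. {..<n l} \<times> {..<n l})"

definition entries :: "(nat \<Rightarrow> complex mat) \<Rightarrow> nat \<times> nat \<times> nat \<Rightarrow> complex" where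
  "entries g = (\<lambda>(l, x). g l $$ x)"

definition mats_of :: "nat \<Rightarrow> (nat \<Rightarrow> nat) \<Rightarrow> (nat \<times> nat \<times> nat \<Rightarrow> complex) \<Rightarrow> nat \<Rightarrow> complex mat" where
  "mats_of k n X = (\<lambda>l\<in>{..<k}. mat (n l) (n l) (\<lambda>ij. X (l, ij)))"

lemma finite_Vars [simp]: "finite (Vars k n)"
  by (simp add: Vars_def)

lemma carrier_GL: "A \<in> carrier (GL n) \<longleftrightarrow> A \<in> carrier_mat n n \<and> det A \<noteq> 0"
  by (simp add: GL_def)

lemma GL_prodD:
  assumes "g \<in> carrier (GL_prod k n)" "l < k"
  shows "g l \<in> carrier_mat (n l) (n l)" "det (g l) \<noteq> 0"
  using assms by (auto simp: carrier_GL PiE_iff)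

lemma GL_prodI:
  assumes "\<And>l. l < k \<Longrightarrow> f l \<in> carrier_mat (n l) (n l)" "\<And>l. l < k \<Longrightarrow> det (f l) \<noteq> 0"
  shows "(\<lambda>l\<in>{..<k}. f l) \<in> carrier (GL_prod k n)"
  using assms by (auto simp: carrier_GL)

lemma SL_prod_subset: "g \<in> SL_prod k n \<Longrightarrow> g \<in> carrier (GL_prod k n)"
  by (auto simp: PiE_iff SL_def carrier_GL)

lemma entries_mats_of: "x \<in> Vars k n \<Longrightarrow> entries (mats_of k n X) x = X x"
  by (auto simp: entries_def mats_of_def Vars_def)

lemma eval_mats_of:
  "mpoly_vars p \<subseteq> Vars k n \<Longrightarrow> mpoly_eval (entries (mats_of k n X)) p = mpoly_eval X p"
  by (rule mpoly_eval_cong) (use entries_mats_of in blast)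

definition Delta :: "(nat \<Rightarrow> nat) \<Rightarrow> nat \<Rightarrow> (nat \<times> nat \<times> nat, complex) mpoly" where
  "Delta n l = det_mpoly (n l) (Pair l)"

lemma vars_Delta: "l < k \<Longrightarrow> mpoly_vars (Delta n l) \<subseteq> Vars k n"
  unfolding Delta_def using vars_det_mpoly by (fastforce simp: Vars_def)

lemma eval_Delta:
  assumes "g l \<in> carrier_mat (n l) (n l)"
  shows "mpoly_eval (entries g) (Delta n l) = det (g l)"
proof -
  have "mat (n l) (n l) (\<lambda>ij. entries g (l, ij)) = g l"
    using assms by (intro eq_matI) (auto simp: entries_def)
  then show ?thesis by (simp add: Delta_def eval_det_mpoly)
qed

lemma Delta_nonzero: "Delta n l \<noteq> 0"
  unfolding Delta_def by (rule det_mpoly_nonzero) (simp add: inj_on_def)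

lemma mats_of_GL:
  assumes "\<And>l. l < k \<Longrightarrow> mpoly_eval X (Delta n l) \<noteq> 0"
  shows "mats_of k n X \<in> carrier (GL_prod k n)"
  unfolding mats_of_def by (rule GL_prodI) (use assms in \<open>auto simp: Delta_def eval_det_mpoly\<close>)

text \<open>A point at which \<open>p\<close> and all determinants are non-zero lies in the group, so the invertible matrices
are dense enough to detect polynomials.\<close>

lemma zero_on_GL_prod:
  assumes "mpoly_vars p \<subseteq> Vars k n"
    and "\<And>g. g \<in> carrier (GL_prod k n) \<Longrightarrow> mpoly_eval (entries g) p = 0"
  shows "p = (0 :: (_, complex) mpoly)"
proof (rule ccontr)
  assume "p \<noteq> 0"
  have "q \<noteq> 0 \<and> mpoly_vars q \<subseteq> Vars k n" if "q \<in> insert p (Delta n ` {..<k})" for q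
    using that
  proof (elim insertE imageE)
    fix l assume "q = Delta n l" "l \<in> {..<k}"
    then show ?thesis using Delta_nonzero[of n l] vars_Delta[of l k n] by simp
  qed (use \<open>p \<noteq> 0\<close> assms(1) in simp)
  then obtain X where X: "\<And>q. q \<in> insert p (Delta n ` {..<k}) \<Longrightarrow> mpoly_eval X q \<noteq> 0"
    by (rule generic_point_finite[of "Vars k n" "insert p (Delta n ` {..<k})", rotated 2]) auto
  then have "mats_of k n X \<in> carrier (GL_prod k n)"
    by (intro mats_of_GL) auto
  from assms(2)[OF this] X show False
    using eval_mats_of[OF assms(1)] by simp
qed

lemma eq_on_GL_prod:
  assumes "mpoly_vars p \<subseteq> Vars k n" "mpoly_vars q \<subseteq> Vars k n"
    and "\<And>g. g \<in> carrier (GL_prod k n) \<Longrightarrow> mpoly_eval (entries g) p = mpoly_eval (entries g) q"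
  shows "p = (q :: (_, complex) mpoly)"
proof -
  have "mpoly_vars (- q) = mpoly_vars q"
    by (simp add: mpoly_vars_def in_keys_iff)
  then have "mpoly_vars (p - q) \<subseteq> Vars k n"
    using mpoly_vars_add[of p "- q"] assms(1,2) by auto
  then have "p - q = 0"
    by (rule zero_on_GL_prod) (simp add: mpoly_eval_diff assms(3))
  then show ?thesis by simp
qed

lemma eq_on_GL:
  fixes p q :: "(nat \<times> nat, complex) mpoly"
  assumes "mpoly_vars p \<subseteq> {..<n} \<times> {..<n}" "mpoly_vars q \<subseteq> {..<n} \<times> {..<n}"
    and eq: "\<And>g. g \<in> carrier (GL n) \<Longrightarrow> mpoly_eval (\<lambda>x. g $$ x) p = mpoly_eval (\<lambda>x. g $$ x) q"
  shows "p = q"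
proof (rule ccontr)
  assume "p \<noteq> q"
  have "mpoly_vars (- q) = mpoly_vars q"
    by (simp add: mpoly_vars_def in_keys_iff)
  then have v: "mpoly_vars (p - q) \<subseteq> {..<n} \<times> {..<n}"
    using mpoly_vars_add[of p "- q"] assms(1,2) by auto
  define D where "D = det_mpoly n (\<lambda>x. x)"
  have "D \<noteq> 0" "mpoly_vars D \<subseteq> {..<n} \<times> {..<n}"
    using det_mpoly_nonzero[of "\<lambda>x. x" n] vars_det_mpoly[of n "\<lambda>x. x"] by (auto simp: D_def)
  then have "\<And>r. r \<in> {p - q, D} \<Longrightarrow> r \<noteq> 0 \<and> mpoly_vars r \<subseteq> {..<n} \<times> {..<n}"
    using v \<open>p \<noteq> q\<close> by auto
  then obtain X where X: "\<And>r. r \<in> {p - q, D} \<Longrightarrow> mpoly_eval X r \<noteq> 0"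
    by (rule generic_point_finite[of "{..<n} \<times> {..<n}" "{p - q, D}", rotated 2]) auto
  define g where "g = mat n n X"
  have "g \<in> carrier (GL n)"
    using X[of D] by (simp add: carrier_GL g_def D_def eval_det_mpoly)
  moreover have "mpoly_eval (\<lambda>x. g $$ x) r = mpoly_eval X r" if "mpoly_vars r \<subseteq> {..<n} \<times> {..<n}" for r
    by (rule mpoly_eval_cong) (use that in \<open>auto simp: g_def\<close>)
  ultimately have "mpoly_eval X p = mpoly_eval X q"
    using eq[of g] assms(1,2) by simp
  then show False
    using X[of "p - q"] by (simp add: mpoly_eval_diff)
qed

section \<open>Semi-invariants of the Fischer pairing\<close>

definition Delta_pow :: "nat \<Rightarrow> (nat \<Rightarrow> nat) \<Rightarrow> (nat \<Rightarrow> nat) \<Rightarrow> (nat \<times> nat \<times> nat, complex) mpoly" where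
  "Delta_pow k n M = (\<Prod>l<k. Delta n l ^ M l)"

lemma vars_Delta_pow: "mpoly_vars (Delta_pow k n M) \<subseteq> Vars k n"
  unfolding Delta_pow_def
  by (intro mpoly_vars_prod order.trans[OF mpoly_vars_power] vars_Delta) auto

lemma eval_Delta_pow:
  assumes "g \<in> carrier (GL_prod k n)"
  shows "mpoly_eval (entries g) (Delta_pow k n M) = (\<Prod>l<k. det (g l) ^ M l)"
  unfolding Delta_pow_def mpoly_eval_simps
  by (intro prod.cong refl) (simp add: eval_Delta GL_prodD(1)[OF assms])

lemma Delta_pow_Ints: "Delta_pow k n M \<in> coeffs_in \<int>"
proof -
  note K = subsemiring_coeffs_in[OF subsemiring_Ints]
  show ?thesis
    unfolding Delta_pow_def Delta_def
    by (intro subsemiring_prod[OF K] subsemiring_power[OF K] det_mpoly_Ints)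
qed

text \<open>The coefficients of the linear substitution \<open>X \<mapsto> X h\<close> on the variables.\<close>

definition rmult :: "(nat \<Rightarrow> complex mat) \<Rightarrow> nat \<times> nat \<times> nat \<Rightarrow> nat \<times> nat \<times> nat \<Rightarrow> complex" where
  "rmult h = (\<lambda>(l, i, j) (l', i', b). if l = l' \<and> i = i' then h l $$ (b, j) else 0)"

abbreviation translate :: "nat \<Rightarrow> (nat \<Rightarrow> nat) \<Rightarrow> (nat \<Rightarrow> complex mat) \<Rightarrow>
    (nat \<times> nat \<times> nat, complex) mpoly \<Rightarrow> (nat \<times> nat \<times> nat, complex) mpoly" where
  "translate k n h \<equiv> lin_subst (Vars k n) (rmult h)"

lemma eval_translate:
  assumes g: "g \<in> carrier (GL_prod k n)" and h: "h \<in> carrier (GL_prod k n)" and p: "mpoly_vars p \<subseteq> Vars k n"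
  shows "mpoly_eval (entries g) (translate k n h p) = mpoly_eval (entries (\<lambda>l\<in>{..<k}. g l * h l)) p"
  unfolding mpoly_eval_compose
proof (rule mpoly_eval_cong)
  fix x assume "x \<in> mpoly_vars p"
  then obtain l i j where x: "x = (l, i, j)" "l < k" "i < n l" "j < n l"
    using p by (auto simp: Vars_def)
  have gl: "g l \<in> carrier_mat (n l) (n l)" "h l \<in> carrier_mat (n l) (n l)"
    by (rule GL_prodD(1)[OF g x(2)], rule GL_prodD(1)[OF h x(2)])
  have "mpoly_eval (entries g) (lin_form (Vars k n) (rmult h) x) =
      (\<Sum>y\<in>Vars k n. rmult h x y * entries g y)"
    by (simp add: lin_form_def mpoly_eval_const_mult mpoly_eval_simps(7))
  also have "\<dots> = (\<Sum>y\<in>(\<lambda>b. (l, i, b)) ` {..<n l}. rmult h x y * entries g y)"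
    by (rule sum.mono_neutral_right) (use x in \<open>auto simp: Vars_def rmult_def image_iff\<close>)
  also have "\<dots> = (\<Sum>b<n l. h l $$ (b, j) * g l $$ (i, b))"
    by (subst sum.reindex) (auto simp: inj_on_def rmult_def entries_def x)
  also have "\<dots> = (g l * h l) $$ (i, j)"
    using gl x by (simp add: scalar_prod_def lessThan_atLeast0 mult.commute)
  finally show "mpoly_eval (entries g) (lin_form (Vars k n) (rmult h) x) = entries (\<lambda>l\<in>{..<k}. g l * h l) x"
    using x by (simp add: entries_def)
qed

lemma vars_lin_subst: "mpoly_vars (lin_subst V H p) \<subseteq> V"
proof -
  have lf: "mpoly_vars (lin_form V H x) \<subseteq> V" for x
    unfolding lin_form_def
  proof (rule mpoly_vars_sum)
    fix y assume "y \<in> V"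
    then show "mpoly_vars (single 0 (H x y) * mvar y) \<subseteq> V"
      by (intro order.trans[OF mpoly_vars_const_mult] order.trans[OF mpoly_vars_mvar]) simp
  qed
  have "mpoly_vars (monom_eval (lin_form V H) t) \<subseteq> V" for t
    unfolding monom_eval_def
    by (intro mpoly_vars_prod order.trans[OF mpoly_vars_power] lf)
  then show ?thesis
    unfolding mpoly_subst_def
    by (intro mpoly_vars_sum order.trans[OF mpoly_vars_const_mult])
qed

lemma mult_GL_prod:
  assumes "g \<in> carrier (GL_prod k n)" "h \<in> carrier (GL_prod k n)"
  shows "(\<lambda>l\<in>{..<k}. g l * h l) \<in> carrier (GL_prod k n)"
proof (rule GL_prodI)
  fix l assume "l < k"
  note gh = GL_prodD[OF assms(1) this] GL_prodD[OF assms(2) this]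
  show "g l * h l \<in> carrier_mat (n l) (n l)" using gh by (intro mult_carrier_mat)
  show "det (g l * h l) \<noteq> 0" using gh det_mult[OF gh(1,3)] by simp
qed

definition transposes :: "nat \<Rightarrow> (nat \<Rightarrow> complex mat) \<Rightarrow> nat \<Rightarrow> complex mat" where
  "transposes k h = (\<lambda>l\<in>{..<k}. (h l)\<^sup>T)"

lemma transposes_GL: "h \<in> carrier (GL_prod k n) \<Longrightarrow> transposes k h \<in> carrier (GL_prod k n)"
  unfolding transposes_def
  by (rule GL_prodI) (simp_all add: GL_prodD det_transpose[OF GL_prodD(1)])

text \<open>Transposing the substitution \<open>X \<mapsto> X h\<close> gives the substitution for the transposed matrices.\<close>

lemma fischer_translate:
  assumes h: "h \<in> carrier (GL_prod k n)" and "mpoly_vars p \<subseteq> Vars k n" "mpoly_vars q \<subseteq> Vars k n"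
  shows "fischer p (translate k n h q) = fischer (translate k n (transposes k h) p) q"
proof -
  have "lin_form (Vars k n) (\<lambda>x y. rmult h y x) x = lin_form (Vars k n) (rmult (transposes k h)) x"
    if x: "x \<in> Vars k n" for x
    unfolding lin_form_def
  proof (intro sum.cong refl)
    fix y assume y: "y \<in> Vars k n"
    obtain l i j where x': "x = (l, i, j)" "l < k" "i < n l" "j < n l"
      using x by (auto simp: Vars_def)
    obtain l' i' j' where y': "y = (l', i', j')" "l' < k" "i' < n l'" "j' < n l'"
      using y by (auto simp: Vars_def)
    have "rmult h y x = rmult (transposes k h) x y"
      using x' y' GL_prodD(1)[OF h x'(2)] by (auto simp: rmult_def transposes_def)
    then show "single 0 (rmult h y x) * mvar y = single 0 (rmult (transposes k h) x y) * mvar y"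
      by simp
  qed
  then have "translate k n (transposes k h) p = lin_subst (Vars k n) (\<lambda>x y. rmult h y x) p"
    unfolding mpoly_subst_def using assms(2)
    by (intro sum.cong arg_cong2[where f = "(*)"] monom_eval_cong) (force simp: mpoly_vars_def)+
  then show ?thesis
    using fischer_lin_subst[OF finite_Vars assms(2,3), of "\<lambda>x y. rmult h y x"] by simp
qed

lemma translate_Delta_pow:
  assumes h: "h \<in> carrier (GL_prod k n)"
  shows "translate k n h (Delta_pow k n M) = single 0 (\<Prod>l<k. det (h l) ^ M l) * Delta_pow k n M"
proof (rule eq_on_GL_prod[OF vars_lin_subst])
  show "mpoly_vars (single 0 (\<Prod>l<k. det (h l) ^ M l) * Delta_pow k n M) \<subseteq> Vars k n"
    by (rule order.trans[OF mpoly_vars_const_mult vars_Delta_pow])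
  fix g assume g: "g \<in> carrier (GL_prod k n)"
  have "(\<Prod>l<k. det ((\<lambda>l\<in>{..<k}. g l * h l) l) ^ M l) = (\<Prod>l<k. det (h l) ^ M l * det (g l) ^ M l)"
    by (intro prod.cong)
      (simp_all add: det_mult[OF GL_prodD(1)[OF g] GL_prodD(1)[OF h]] power_mult_distrib mult.commute)
  then show "mpoly_eval (entries g) (translate k n h (Delta_pow k n M)) =
      mpoly_eval (entries g) (single 0 (\<Prod>l<k. det (h l) ^ M l) * Delta_pow k n M)"
    by (simp add: eval_translate[OF g h vars_Delta_pow] eval_Delta_pow[OF mult_GL_prod[OF g h]]
        eval_Delta_pow[OF g] mpoly_eval_const_mult prod.distrib)
qed

text \<open>The determinants are semi-invariant, and the pairing moves the translation onto them.\<close>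

lemma fischer_Delta_pow_translate:
  assumes h: "h \<in> carrier (GL_prod k n)" and "mpoly_vars f \<subseteq> Vars k n"
  shows "fischer (Delta_pow k n M) (translate k n h f) = (\<Prod>l<k. det (h l) ^ M l) * fischer (Delta_pow k n M) f"
proof -
  have "(\<Prod>l<k. det (transposes k h l) ^ M l) = (\<Prod>l<k. det (h l) ^ M l)"
    by (intro prod.cong) (simp_all add: transposes_def det_transpose[OF GL_prodD(1)[OF h]])
  then show ?thesis
    by (simp add: fischer_translate[OF h vars_Delta_pow assms(2)] translate_Delta_pow[OF transposes_GL[OF h]]
        fischer_scale_left)
qed

text \<open>The adjoint of multiplication by \<open>q\<close> is \<open>q(\<partial>)\<close>; it is composed of derivatives, the adjoints of the
variables.\<close>

lemma fischer_mult_adjoint: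
  assumes "mpoly_vars q \<subseteq> V" "mpoly_vars p \<subseteq> V"
  shows "\<exists>p'. mpoly_vars p' \<subseteq> V \<and> (\<forall>r. fischer p (q * r) = fischer p' r)"
  using assms
proof (induction q arbitrary: p rule: mpoly_vars_induct)
  case (const c)
  then show ?case
    using mpoly_vars_mult[of "single 0 c" p]
    by (intro exI[of _ "single 0 c * p"]) (auto simp: fischer_scale_left fischer_scale_right)
next
  case (add q q')
  obtain p1 where p1: "mpoly_vars p1 \<subseteq> V" "\<And>r. fischer p (q * r) = fischer p1 r"
    using add by meson
  obtain p2 where p2: "mpoly_vars p2 \<subseteq> V" "\<And>r. fischer p (q' * r) = fischer p2 r"
    using add by meson
  show ?case
    using p1 p2 mpoly_vars_add[of p1 p2]
    by (intro exI[of _ "p1 + p2"]) (auto simp: distrib_right fischer_add_right fischer_add_left)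
next
  case (var x q)
  have "mpoly_vars (mderiv x p) \<subseteq> V"
    using mpoly_vars_mderiv[of x p] var.prems by blast
  then obtain p1 where p1: "mpoly_vars p1 \<subseteq> V" "\<And>r. fischer (mderiv x p) (q * r) = fischer p1 r"
    using var.IH by blast
  have "fischer p (mvar x * q * r) = fischer p1 r" for r
    using p1(2)[of r] fischer_mvar_mult[of x "q * r" p] by (simp add: fischer_commute mult.assoc)
  then show ?case using p1(1) by blast
qed

lemma fischer_eqI:
  fixes p q :: "('x, complex) mpoly"
  assumes "mpoly_vars p \<subseteq> V" "mpoly_vars q \<subseteq> V"
    and "\<And>r. mpoly_vars r \<subseteq> V \<Longrightarrow> fischer p r = fischer q r"
  shows "p = q"
proof (rule poly_mapping_eqI)
  fix t
  show "lookup p t = lookup q t"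
  proof (cases "keys t \<subseteq> V")
    case True
    then have "fischer p (single t 1) = fischer q (single t 1)"
      using mpoly_vars_single[of t 1] by (intro assms(3)) blast
    moreover have "monomial_fact t \<noteq> 0"
      by (simp add: monomial_fact_def)
    ultimately show ?thesis
      by (simp add: fischer_commute[of _ "single t 1"] fischer_single_left)
  next
    case False
    then have "t \<notin> keys p" "t \<notin> keys q"
      using assms(1,2) by (auto simp: mpoly_vars_def)
    then show ?thesis by (simp add: in_keys_iff)
  qed
qed

text \<open>The functional \<open>f \<mapsto> \<langle>\<Delta>\<^sup>M, \<Delta>\<^sup>S f\<rangle>\<close> is represented by a polynomial \<open>p\<close> that transforms like
\<open>\<Delta>\<^bsup>M - S\<^esup>\<close>, and such a polynomial is determined by its value at the identity.\<close>

lemma fischer_Delta_pow_mult: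
  assumes le: "\<And>l. l < k \<Longrightarrow> S l \<le> M l"
  obtains c where "\<And>f. mpoly_vars f \<subseteq> Vars k n \<Longrightarrow>
    fischer (Delta_pow k n M) (Delta_pow k n S * f) = c * fischer (Delta_pow k n (\<lambda>l. M l - S l)) f"
proof -
  let ?V = "Vars k n"
  obtain p where p: "mpoly_vars p \<subseteq> ?V" "\<And>f. fischer (Delta_pow k n M) (Delta_pow k n S * f) = fischer p f"
    using fischer_mult_adjoint[OF vars_Delta_pow vars_Delta_pow] by blast
  define one where "one = (\<lambda>l\<in>{..<k}. 1\<^sub>m (n l) :: complex mat)"
  have one: "one \<in> carrier (GL_prod k n)"
    unfolding one_def by (rule GL_prodI) auto
  define c where "c = mpoly_eval (entries one) p"
  have semi: "translate k n (transposes k h) p = single 0 (\<Prod>l<k. det (h l) ^ (M l - S l)) * p"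
    if h: "h \<in> carrier (GL_prod k n)" for h
  proof (rule fischer_eqI[OF vars_lin_subst])
    show "mpoly_vars (single 0 (\<Prod>l<k. det (h l) ^ (M l - S l)) * p) \<subseteq> ?V"
      by (rule order.trans[OF mpoly_vars_const_mult p(1)])
    fix f :: "(nat \<times> nat \<times> nat, complex) mpoly"
    assume f: "mpoly_vars f \<subseteq> ?V"
    let ?D = "\<lambda>M. \<Prod>l<k. det (h l) ^ M l"
    have nz: "?D S \<noteq> 0"
      by (simp add: GL_prodD(2)[OF h])
    have "?D M = ?D S * ?D (\<lambda>l. M l - S l)"
      unfolding prod.distrib[symmetric]
      using le by (intro prod.cong) (auto simp flip: power_add)
    moreover have "?D S * fischer (Delta_pow k n M) (Delta_pow k n S * translate k n h f) = ?D M * fischer (Delta_pow k n M) (Delta_pow k n S * f)"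
    proof -
      have "mpoly_vars (Delta_pow k n S * f) \<subseteq> ?V"
        using mpoly_vars_mult[of "Delta_pow k n S" f] vars_Delta_pow[of k n S] f by blast
      from fischer_Delta_pow_translate[OF h this, of M] show ?thesis
        by (simp add: mpoly_compose_simps(5) translate_Delta_pow[OF h] mult.assoc fischer_scale_right)
    qed
    ultimately have "fischer p (translate k n h f) = ?D (\<lambda>l. M l - S l) * fischer p f"
      using nz by (simp add: p(2))
    then show "fischer (translate k n (transposes k h) p) f =
        fischer (single 0 (?D (\<lambda>l. M l - S l)) * p) f"
      by (simp add: fischer_translate[OF h p(1) f, symmetric] fischer_scale_left)
  qed
  have "p = single 0 c * Delta_pow k n (\<lambda>l. M l - S l)"
  proof (rule eq_on_GL_prod[OF p(1)])
    show "mpoly_vars (single 0 c * Delta_pow k n (\<lambda>l. M l - S l)) \<subseteq> ?V"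
      by (rule order.trans[OF mpoly_vars_const_mult vars_Delta_pow])
    fix g assume g: "g \<in> carrier (GL_prod k n)"
    note h = transposes_GL[OF g]
    have tt: "transposes k (transposes k g) = g"
      using g by (auto simp: transposes_def fun_eq_iff PiE_iff extensional_def)
    have dt: "(\<Prod>l<k. det (transposes k g l) ^ (M l - S l)) = (\<Prod>l<k. det (g l) ^ (M l - S l))"
      by (intro prod.cong) (simp_all add: transposes_def det_transpose[OF GL_prodD(1)[OF g]])
    have og: "(\<lambda>l\<in>{..<k}. one l * g l) = g"
    proof
      fix l
      show "(\<lambda>l\<in>{..<k}. one l * g l) l = g l"
        using GL_prodD(1)[OF g, of l] g
        by (cases "l < k") (auto simp: one_def PiE_iff extensional_def)
    qed
    have "mpoly_eval (entries g) p = mpoly_eval (entries one) (translate k n g p)"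
      by (simp add: eval_translate[OF one g p(1)] og)
    also have "\<dots> = c * (\<Prod>l<k. det (g l) ^ (M l - S l))"
      using semi[OF h] by (simp add: tt dt c_def mpoly_eval_const_mult)
    finally show "mpoly_eval (entries g) p = mpoly_eval (entries g) (single 0 c * Delta_pow k n (\<lambda>l. M l - S l))"
      by (simp add: mpoly_eval_const_mult eval_Delta_pow[OF g])
  qed
  then have "fischer p f = c * fischer (Delta_pow k n (\<lambda>l. M l - S l)) f" for f
    by (simp add: fischer_scale_left)
  then show thesis
    using that p(2) by metis
qed

lemma Delta_pow_nonzero: "Delta_pow k n M \<noteq> 0"
proof
  assume "Delta_pow k n M = 0"
  moreover have one: "(\<lambda>l\<in>{..<k}. 1\<^sub>m (n l) :: complex mat) \<in> carrier (GL_prod k n)"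
    by (rule GL_prodI) auto
  have "mpoly_eval (entries (\<lambda>l\<in>{..<k}. 1\<^sub>m (n l))) (Delta_pow k n M) = 1"
    unfolding eval_Delta_pow[OF one] by (intro prod.neutral) auto
  ultimately show False
    by (simp add: mpoly_eval_simps(2))
qed

lemma fischer_self_nonzero:
  fixes p :: "('x, complex) mpoly"
  assumes "p \<in> coeffs_in \<int>" "p \<noteq> 0"
  shows "fischer p p \<noteq> 0"
proof -
  have real: "lookup p t * lookup p t = complex_of_real ((cmod (lookup p t))\<^sup>2)" for t
  proof -
    obtain z where z: "lookup p t = of_int z"
      by (rule Ints_cases[OF coeffs_in_lookup[OF assms(1)]])
    have "(cmod (lookup p t))\<^sup>2 = real_of_int (z * z)"
      unfolding z norm_of_int by (simp add: power2_eq_square flip: of_int_mult)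
    then show ?thesis by (simp add: z)
  qed
  have "fischer p p = complex_of_real (\<Sum>t\<in>keys p. real (monomial_fact t) * (cmod (lookup p t))\<^sup>2)"
    unfolding fischer_def mult.assoc real by simp
  moreover have "0 < (\<Sum>t\<in>keys p. real (monomial_fact t) * (cmod (lookup p t))\<^sup>2)"
    using assms(2) keys_empty_iff[of p]
    by (intro sum_pos) (auto simp: in_keys_iff monomial_fact_def intro!: mult_pos_pos prod_pos)
  ultimately show ?thesis
    by (metis of_real_eq_0_iff less_irrefl)
qed

section \<open>Gordan's alternative over the integers\<close>

text \<open>Induction on the number of vectors. If \<open>\<mu>0\<close> is positive on all vectors but negative on the new one
\<open>a\<^sub>k\<close>, then every \<open>a\<^sub>i\<close> is moved along \<open>a\<^sub>k\<close> into the hyperplane orthogonal to \<open>\<mu>0\<close>, and the alternative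
for the projected family is lifted back. The family is indexed because the projections may coincide.\<close>

lemma gordan_alternative:
  fixes a :: "'i \<Rightarrow> 'j \<Rightarrow> int"
  assumes "finite I" "finite J"
  shows "(\<exists>\<mu>. \<forall>i\<in>I. 0 < (\<Sum>j\<in>J. a i j * \<mu> j)) \<or>
         (\<exists>c :: 'i \<Rightarrow> nat. (\<exists>i\<in>I. 0 < c i) \<and> (\<forall>j\<in>J. (\<Sum>i\<in>I. int (c i) * a i j) = 0))"
  using assms(1)
proof (induction I arbitrary: a rule: finite_induct)
  case empty
  then show ?case by auto
next
  case (insert k I)
  define ip where "ip x y = (\<Sum>j\<in>J. x j * y j)" for x y :: "'j \<Rightarrow> int"
  have ip_lin: "ip (\<lambda>j. r * x j + s * y j) z = r * ip x z + s * ip y z"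
    "ip z (\<lambda>j. r * x j + s * y j) = r * ip z x + s * ip z y" for r s x y z
    by (simp_all add: ip_def algebra_simps sum.distrib sum_distrib_left)
  have big: "f i < 1 + (\<Sum>i\<in>I. \<bar>f i\<bar>)" if "i \<in> I" for i and f :: "'i \<Rightarrow> int"
    using member_le_sum[of i I "\<lambda>i. \<bar>f i\<bar>"] that \<open>finite I\<close> by auto
  consider (comb) c where "\<exists>i\<in>I. 0 < c i" "\<forall>j\<in>J. (\<Sum>i\<in>I. int (c i) * a i j) = 0"
    | (pos) \<mu>0 where "\<And>i. i \<in> I \<Longrightarrow> 0 < ip (a i) \<mu>0"
    using insert.IH[of a] unfolding ip_def by blast
  then show ?case
  proof cases
    case comb
    have "(\<Sum>i\<in>I. int ((c(k := 0)) i) * a i j) = (\<Sum>i\<in>I. int (c i) * a i j)" for j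
      by (rule sum.cong) (use insert.hyps in auto)
    moreover have "\<exists>i\<in>insert k I. 0 < (c(k := 0)) i"
      using comb(1) insert.hyps by auto
    ultimately show ?thesis
      using comb(2) insert.hyps by (intro disjI2 exI[of _ "c(k := 0)"]) auto
  next
    case pos
    define \<alpha> where "\<alpha> = - ip (a k) \<mu>0"
    consider "\<alpha> < 0" | "\<alpha> = 0" | "\<alpha> > 0" by linarith
    then show ?thesis
    proof cases
      case 1
      then show ?thesis
        using pos unfolding \<alpha>_def by (intro disjI1 exI[of _ \<mu>0]) (auto simp: ip_def[symmetric])
    next
      case 2
      show ?thesis
      proof (cases "\<forall>j\<in>J. a k j = 0")
        case True
        then show ?thesis
          using insert.hyps
          by (intro disjI2 exI[of _ "\<lambda>i. if i = k then 1 else 0"]) (auto intro!: sum.neutral)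
      next
        case False
        obtain j where j: "j \<in> J" "a k j \<noteq> 0" using False by blast
        have "0 < ip (a k) (a k)"
          unfolding ip_def using j
          by (intro sum_pos2[OF assms(2) j(1)]) (auto simp: zero_less_mult_iff linorder_neq_iff)
          moreover define M where "M = 1 + (\<Sum>i\<in>I. \<bar>- ip (a i) (a k)\<bar>)"
          have "0 < M * ip (a i) \<mu>0 + ip (a i) (a k)" if "i \<in> I" for i
          proof -
            have "M > 0" unfolding M_def by (simp add: sum_nonneg add_pos_nonneg)
            then have "M * 1 \<le> M * ip (a i) \<mu>0"
              using pos[OF that] by (intro mult_left_mono) auto
            moreover have "- ip (a i) (a k) < M"
              unfolding M_def by (rule big[OF that])
            ultimately show ?thesis by linarith
          qed
          ultimately show ?thesis
            using 2 ip_lin(2)[of _ M \<mu>0 1 "a k"] unfolding \<alpha>_def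
            by (intro disjI1 exI[of _ "\<lambda>j. M * \<mu>0 j + 1 * a k j"]) (auto simp: ip_def[symmetric])
      qed
    next
      case 3
      define w where "w i = ip (a i) \<mu>0" for i
      \<comment> \<open>the vectors \<open>a' i\<close> are orthogonal to \<open>\<mu>0\<close>\<close>
      define a' where "a' i = (\<lambda>j. \<alpha> * a i j + w i * a k j)" for i
      consider (comb) c where "\<exists>i\<in>I. 0 < c i" "\<forall>j\<in>J. (\<Sum>i\<in>I. int (c i) * a' i j) = 0"
        | (pos') \<mu>1 where "\<And>i. i \<in> I \<Longrightarrow> 0 < ip (a' i) \<mu>1"
        using insert.IH[of a'] unfolding ip_def by blast
      then show ?thesis
      proof cases
        case comb
        define c' where "c' = (\<lambda>i. if i = k then nat (\<Sum>i\<in>I. int (c i) * w i) else nat \<alpha> * c i)"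
        have "0 \<le> (\<Sum>i\<in>I. int (c i) * w i)"
          using pos unfolding w_def by (intro sum_nonneg mult_nonneg_nonneg) (auto intro: less_imp_le)
        then have ck: "int (c' k) = (\<Sum>i\<in>I. int (c i) * w i)"
          by (simp add: c'_def)
        have "(\<Sum>i\<in>insert k I. int (c' i) * a i j) = 0" if "j \<in> J" for j
        proof -
          have "(\<Sum>i\<in>I. int (c' i) * a i j) = (\<Sum>i\<in>I. \<alpha> * (int (c i) * a i j))"
            using insert.hyps 3 by (intro sum.cong) (auto simp: c'_def)
          then have "(\<Sum>i\<in>insert k I. int (c' i) * a i j) = (\<Sum>i\<in>I. int (c i) * a' i j)"
            using insert.hyps
            by (simp add: ck a'_def sum_distrib_left sum.distrib algebra_simps)
          then show ?thesis using comb that by simp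
        qed
        moreover have "\<exists>i\<in>insert k I. 0 < c' i"
          using comb 3 insert.hyps by (auto simp: c'_def)
        ultimately show ?thesis by blast
      next
        case pos'
        define M where "M = 1 + (\<Sum>i\<in>I. \<bar>w i\<bar>)"
        \<comment> \<open>\<open>r\<close> makes the product of \<open>\<mu>\<close> with \<open>a k\<close> equal to \<open>\<alpha>\<close>; a large \<open>M\<close> takes care of the other vectors.\<close>
        define r where "r = M * ip (a k) \<mu>1 - 1"
        define \<mu> where "\<mu> = (\<lambda>j. (\<alpha> * M) * \<mu>1 j + r * \<mu>0 j)"
        have "ip (a k) \<mu> = \<alpha>"
          unfolding \<mu>_def ip_lin r_def using \<alpha>_def by (simp add: algebra_simps)
        moreover have "0 < ip (a i) \<mu>" if "i \<in> I" for i
        proof -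
          have "M > 0" unfolding M_def by (simp add: sum_nonneg add_pos_nonneg)
          then have "M * 1 \<le> M * ip (a' i) \<mu>1"
            using pos'[OF that] by (intro mult_left_mono) auto
          then have gt: "w i < M * ip (a' i) \<mu>1"
            using big[OF that, of w] by (simp add: M_def)
          have "ip (a' i) \<mu>0 = 0"
            unfolding a'_def ip_lin w_def using \<alpha>_def by (simp add: algebra_simps)
          then have "ip (a' i) \<mu> = \<alpha> * (M * ip (a' i) \<mu>1)"
            unfolding \<mu>_def ip_lin(2) by simp
          moreover have "ip (a' i) \<mu> = \<alpha> * ip (a i) \<mu> + w i * \<alpha>"
            unfolding a'_def ip_lin(1) \<open>ip (a k) \<mu> = \<alpha>\<close> ..
          ultimately have "\<alpha> * ip (a i) \<mu> = \<alpha> * (M * ip (a' i) \<mu>1 - w i)"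
            by (simp add: algebra_simps)
          then show ?thesis using 3 gt by simp
        qed
        ultimately show ?thesis
          using 3 by (intro disjI1 exI[of _ \<mu>]) (auto simp: ip_def[symmetric])
      qed
    qed
  qed
qed

section \<open>Multinomial coefficients and least common multiples\<close>

text \<open>The numbers \<open>1 / (a (r choose a))\<close> form Leibniz's triangle: each one is the difference of its neighbours in
the row above and in the same row, so by induction their denominators only involve \<open>1, \<dots>, r\<close>.\<close>

lemma leibniz_triangle_integral:
  assumes "1 \<le> a" "a \<le> r" "\<And>i. i \<in> {1..r} \<Longrightarrow> i dvd N"
  shows "real N / (real a * real (r choose a)) \<in> \<int>"
  using assms
proof (induction r arbitrary: a)
  case 0
  then show ?case by simp
next
  case (Suc r)
  have "real N / (real b * real (Suc r choose b)) \<in> \<int>" if "b = Suc r - j" "j \<le> r" for b j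
    using that
  proof (induction j arbitrary: b)
    case 0
    then have "b dvd N" using Suc.prems(3)[of b] by auto
    then obtain k where "N = b * k" ..
    then have "real N / (real b * real (Suc r choose b)) = real k"
      using 0 by (simp add: field_simps)
    then show ?case by simp
  next
    case (Suc j)
    then have b: "1 \<le> b" "b \<le> r" by auto
    have "real N / (real (Suc b) * real (Suc r choose Suc b)) \<in> \<int>"
      using Suc.prems by (intro Suc.IH) auto
    moreover have "real N / (real b * real (r choose b)) \<in> \<int>"
      using b Suc.prems \<open>\<And>i. i \<in> {1..Suc r} \<Longrightarrow> i dvd N\<close> by (intro \<open>\<And>a. \<lbrakk>1 \<le> a; a \<le> r; \<And>i. i \<in> {1..r} \<Longrightarrow> i dvd N\<rbrakk> \<Longrightarrow> real N / (real a * real (r choose a)) \<in> \<int>\<close>) auto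
    moreover have "1 / (real b * real (Suc r choose b)) = 1 / (real b * real (r choose b)) - 1 / (real (Suc b) * real (Suc r choose Suc b))"
    proof -
      define x where "x = real (r choose b)"
      have x: "x > 0" using b by (simp add: x_def)
      have 1: "real (Suc b) * real (Suc r choose Suc b) = real (Suc r) * x"
        using Suc_times_binomial[of b r] unfolding x_def by (metis of_nat_mult)
      have "(Suc r - b) * (Suc r choose b) = Suc r * (r choose b)"
        using binomial_absorb_comp[of "Suc r" b] by simp
      then have 2: "(real (Suc r) - real b) * real (Suc r choose b) = real (Suc r) * x"
        unfolding x_def using b by (metis of_nat_diff of_nat_mult le_SucI)
      have "real (Suc r) - real b > 0" using b by auto
      then have "real (Suc r choose b) = real (Suc r) * x / (real (Suc r) - real b)"
        using 2 by (simp add: field_simps)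
      then have "1 / (real b * real (Suc r choose b)) = (real (Suc r) - real b) / (real b * (real (Suc r) * x))"
        by simp
      moreover have "(s - t) / (t * (s * x)) = 1 / (t * x) - 1 / (s * x)" if "s > 0" "t > 0" for s t
        using x that by (simp add: field_simps)
      from this[of "real (Suc r)" "real b"]
      have "(real (Suc r) - real b) / (real b * (real (Suc r) * x)) = 1 / (real b * x) - 1 / (real (Suc r) * x)"
        using b by (simp del: of_nat_Suc)
      ultimately show ?thesis using 1 by (simp add: x_def)
    qed
    then have "real N / (real b * real (Suc r choose b)) = real N / (real b * real (r choose b)) - real N / (real (Suc b) * real (Suc r choose Suc b))"
      by (metis (no_types, opaque_lifting) right_diff_distrib times_divide_eq_right mult.right_neutral)
    ultimately show ?case by simp
  qed
  from this[of a "Suc r - a"] show ?case using Suc.prems by auto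
qed

definition lcm_upto :: "nat \<Rightarrow> nat" where
  "lcm_upto r = Lcm {1..r}"

lemma lcm_upto_pos: "0 < lcm_upto r"
  by (auto simp: lcm_upto_def Lcm_0_iff intro!: Nat.gr0I)

lemma dvd_lcm_upto: "1 \<le> i \<Longrightarrow> i \<le> r \<Longrightarrow> i dvd lcm_upto r"
  by (simp add: lcm_upto_def dvd_Lcm)

lemma lcm_upto_dvd_mono: "s \<le> r \<Longrightarrow> lcm_upto s dvd lcm_upto r"
  unfolding lcm_upto_def by (rule Lcm_least) (auto intro: dvd_Lcm)

lemma binomial_dvd_lcm_upto:
  assumes "a \<le> r"
  shows "(r choose a) dvd lcm_upto r"
proof (cases "a = 0")
  case False
  have "real (lcm_upto r) / (real a * real (r choose a)) \<in> \<int>"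
    using False assms by (intro leibniz_triangle_integral) (auto intro: dvd_lcm_upto)
  then obtain z where "real (lcm_upto r) / (real a * real (r choose a)) = of_int z"
    by (auto elim: Ints_cases)
  then have "real (lcm_upto r) = of_int z * (real a * real (r choose a))"
    using False assms by (simp add: field_simps)
  then have "real_of_int (int (lcm_upto r)) = real_of_int (z * int a * int (r choose a))"
    by simp
  then have "int (lcm_upto r) = z * int a * int (r choose a)"
    by (simp only: of_int_eq_iff)
  then have "int (r choose a) dvd int (lcm_upto r)" by simp
  then show ?thesis by simp
qed simp

text \<open>A multinomial coefficient with \<open>n + 1\<close> parts is a product of \<open>n\<close> binomial coefficients, each of which divides
\<open>lcm(1, \<dots>, r)\<close>.\<close>

lemma fact_dvd_lcm_upto_mult_facts:
  assumes "(\<Sum>j<Suc n. a j) = r"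
  shows "fact r dvd lcm_upto r ^ n * (\<Prod>j<Suc n. fact (a j))"
  using assms
proof (induction n arbitrary: r)
  case (Suc n)
  define s where "s = (\<Sum>j<Suc n. a j)"
  have r: "r = s + a (Suc n)" using Suc.prems by (simp add: s_def)
  have "fact s dvd lcm_upto s ^ n * (\<Prod>j<Suc n. fact (a j))"
    by (rule Suc.IH) (simp add: s_def)
  also have "\<dots> dvd lcm_upto r ^ n * (\<Prod>j<Suc n. fact (a j))"
    by (intro mult_dvd_mono dvd_power_same lcm_upto_dvd_mono) (auto simp: r)
  finally have "fact s dvd lcm_upto r ^ n * (\<Prod>j<Suc n. fact (a j))" .
  then have "fact s * fact (a (Suc n)) * (r choose s) dvd
      (lcm_upto r ^ n * (\<Prod>j<Suc n. fact (a j))) * fact (a (Suc n)) * lcm_upto r"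
    by (intro mult_dvd_mono binomial_dvd_lcm_upto) (auto simp: r)
  also have "fact s * fact (a (Suc n)) * (r choose s) = (fact r :: nat)"
    using binomial_fact_lemma[of s r] by (simp add: r)
  also have "(lcm_upto r ^ n * (\<Prod>j<Suc n. fact (a j))) * fact (a (Suc n)) * lcm_upto r =
      lcm_upto r ^ Suc n * (\<Prod>j<Suc (Suc n). fact (a j))"
    by (simp only: prod.lessThan_Suc[of _ "Suc n"] power_Suc mult_ac)
  finally show ?case .
qed simp

lemma prod_fact_le_fact_sum:
  fixes n :: nat
  shows "(\<Prod>j<n. fact (a j)) \<le> (fact (\<Sum>j<n. a j) :: nat)"
proof (induction n)
  case (Suc n)
  have "(\<Prod>j<Suc n. fact (a j)) \<le> (fact (\<Sum>j<n. a j) * fact (a n) :: nat)"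
    using Suc by simp
  also have "\<dots> \<le> fact (\<Sum>j<Suc n. a j)"
    using fact_fact_dvd_fact[of "\<Sum>j<n. a j" "a n", where 'a = nat] by (simp add: dvd_imp_le)
  finally show ?case .
qed simp

lemma prime_dvd_choose_prime_power:
  assumes "prime (p::nat)" "0 < i" "i < p ^ e"
  shows "p dvd (p ^ e choose i)"
proof (rule ccontr)
  assume "\<not> p dvd (p ^ e choose i)"
  then have "coprime (p ^ e) (p ^ e choose i)"
    using assms(1) by (simp add: prime_imp_coprime coprime_power_left_iff)
  moreover have "p ^ e dvd i * (p ^ e choose i)"
    using times_binomial_minus1_eq[of i "p ^ e"] assms by (metis dvd_triv_left)
  ultimately have "p ^ e dvd i"
    by (simp add: coprime_dvd_mult_left_iff)
  then show False using assms by (auto dest: dvd_imp_le)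
qed

text \<open>Modulo \<open>p\<close>, \<open>(1 + x)\<^sup>r\<close> is \<open>(1 + x\<^sup>q)(1 + x)\<^bsup>r - q\<^esup>\<close> with \<open>q = p\<^sup>e\<close>, and the assumptions place \<open>f\<close> strictly between
\<open>r - q\<close> and \<open>q\<close>, where this polynomial has no term.\<close>

lemma prime_dvd_choose_middle:
  assumes p: "prime (p::nat)" and "r - f < p ^ e" "p ^ e \<le> r" "f \<le> r - f" "f \<le> r"
  shows "p dvd (r choose f)"
proof -
  have "(r choose f) = (\<Sum>k\<le>f. (p ^ e choose k) * ((r - p ^ e) choose (f - k)))"
    using vandermonde[of "p ^ e" "r - p ^ e" f] assms by simp
  also have "p dvd \<dots>"
  proof (rule dvd_sum)
    fix k assume "k \<in> {..f}"
    show "p dvd (p ^ e choose k) * ((r - p ^ e) choose (f - k))"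
    proof (cases "k = 0")
      case True
      have "r - p ^ e < f" using assms by linarith
      then show ?thesis using True by (simp add: binomial_eq_0)
    next
      case False
      then show ?thesis
        using prime_dvd_choose_prime_power[OF p, of k e] assms \<open>k \<in> {..f}\<close> by simp
    qed
  qed
  finally show ?thesis .
qed

lemma prime_powers_dvd_imp_dvd:
  fixes k N :: nat
  assumes "\<And>p e. prime p \<Longrightarrow> p ^ e dvd k \<Longrightarrow> p ^ e dvd N" "k \<noteq> 0" "N \<noteq> 0"
  shows "k dvd N"
proof (rule multiplicity_le_imp_dvd[OF assms(2)])
  fix p :: nat assume p: "prime p"
  have "p ^ multiplicity p k dvd N"
    by (rule assms(1)[OF p]) (rule multiplicity_dvd)
  then show "multiplicity p k \<le> multiplicity p N"
    using p \<open>N \<noteq> 0\<close> by (intro multiplicity_geI) (auto simp: prime_gt_1_nat)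
qed

text \<open>Passing from \<open>\<lceil>r/2\<rceil>\<close> to \<open>r\<close> can raise the exponent of a prime in the least common multiple by at most one,
and it does so only if a power of the prime lies in between; then the prime divides the middle binomial
coefficient.\<close>

lemma lcm_upto_dvd_halve:
  assumes "0 < r"
  shows "lcm_upto r dvd lcm_upto (r - r div 2) * (r choose (r div 2))"
  unfolding lcm_upto_def[of r]
proof (rule Lcm_least)
  fix k assume k: "k \<in> {1..r}"
  define c where "c = r - r div 2"
  show "k dvd lcm_upto (r - r div 2) * (r choose (r div 2))"
    unfolding c_def[symmetric]
  proof (rule prime_powers_dvd_imp_dvd)
    fix p e assume p: "prime (p::nat)" and dvd: "p ^ e dvd k"
    have le: "p ^ e \<le> r" using dvd k by (auto dest: dvd_imp_le)
    show "p ^ e dvd lcm_upto c * (r choose (r div 2))"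
    proof (cases "p ^ e \<le> c")
      case True
      then show ?thesis using p by (intro dvd_mult2 dvd_lcm_upto) (auto simp: Suc_le_eq prime_gt_0_nat)
    next
      case False
      have "p dvd (r choose (r div 2))"
        by (rule prime_dvd_choose_middle[OF p, of _ _ e]) (use False le in \<open>auto simp: c_def\<close>)
      moreover obtain e' where e': "e = Suc e'"
        using False assms by (cases e) (auto simp: c_def)
      have "2 * p ^ e' \<le> p ^ e"
        using p by (simp add: e' prime_ge_2_nat)
      then have "p ^ e' dvd lcm_upto c"
        using le p by (intro dvd_lcm_upto) (auto simp: c_def Suc_le_eq prime_gt_0_nat)
      ultimately have "p ^ e' * p dvd lcm_upto c * (r choose (r div 2))"
        by (intro mult_dvd_mono)
      then show ?thesis by (simp add: e' mult.commute)
    qed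
  qed (use k lcm_upto_pos[of c] in auto)
qed

lemma choose_half_le: "(r choose (r div 2)) \<le> 4 ^ (r div 2)"
proof (cases "even r")
  case True
  then obtain m where r: "r = 2 * m" by auto
  have "(2 * m choose m) \<le> 2 ^ (2 * m)"
    by (rule binomial_le_pow2)
  then show ?thesis by (simp add: r power_mult)
next
  case False
  then obtain m where r: "r = 2 * m + 1" by (metis oddE)
  have "(\<Sum>k\<in>{m, Suc m}. 2 * m + 1 choose k) \<le> (\<Sum>k\<le>2 * m + 1. 2 * m + 1 choose k)"
    by (rule sum_mono2) auto
  also have "\<dots> = 2 ^ (2 * m + 1)"
    by (rule choose_row_sum)
  finally have "(2 * m + 1 choose m) + (2 * m + 1 choose Suc m) \<le> 2 * 4 ^ m"
    by (simp add: power_mult del: binomial_Suc_Suc)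
  then show ?thesis
    using binomial_symmetric[of m "2 * m + 1"] by (simp add: r del: binomial_Suc_Suc)
qed

lemma lcm_upto_le: "lcm_upto r \<le> 4 ^ r"
proof (induction r rule: less_induct)
  case (less r)
  show ?case
  proof (cases "r \<le> 1")
    case True
    then consider "r = 0" | "r = 1" by linarith
    then show ?thesis by cases (simp_all add: lcm_upto_def)
  next
    case False
    have "lcm_upto r \<le> lcm_upto (r - r div 2) * (r choose (r div 2))"
      using lcm_upto_dvd_halve[of r] lcm_upto_pos[of "r - r div 2"] False
      by (intro dvd_imp_le) auto
    also have "\<dots> \<le> 4 ^ (r - r div 2) * 4 ^ (r div 2)"
      using False by (intro mult_mono less.IH choose_half_le) auto
    also have "\<dots> = 4 ^ r"
      by (simp flip: power_add)
    finally show ?thesis .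
  qed
qed

section \<open>Extension of places\<close>

text \<open>The graph of a ring homomorphism from a subring of the complex numbers to the complex numbers. Graphs are
ordered by inclusion, which makes extension of homomorphisms a matter of Zorn's lemma.\<close>

definition ring_graph :: "(complex \<times> complex) set \<Rightarrow> bool" where
  "ring_graph G \<longleftrightarrow> (0, 0) \<in> G \<and> (1, 1) \<in> G \<and>
     (\<forall>a b a' b'. (a, b) \<in> G \<longrightarrow> (a', b') \<in> G \<longrightarrow> (a + a', b + b') \<in> G) \<and>
     (\<forall>a b a' b'. (a, b) \<in> G \<longrightarrow> (a', b') \<in> G \<longrightarrow> (a * a', b * b') \<in> G) \<and>
     (\<forall>a b. (a, b) \<in> G \<longrightarrow> (- a, - b) \<in> G) \<and>
     (\<forall>b. (0, b) \<in> G \<longrightarrow> b = 0)"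

lemma ring_graphD:
  assumes "ring_graph G"
  shows "(0, 0) \<in> G" "(1, 1) \<in> G"
    "(a, b) \<in> G \<Longrightarrow> (a', b') \<in> G \<Longrightarrow> (a + a', b + b') \<in> G"
    "(a, b) \<in> G \<Longrightarrow> (a', b') \<in> G \<Longrightarrow> (a * a', b * b') \<in> G"
    "(a, b) \<in> G \<Longrightarrow> (- a, - b) \<in> G"
    "(0, b) \<in> G \<Longrightarrow> b = 0"
  using assms unfolding ring_graph_def by blast+

lemma ring_graph_diff:
  assumes "ring_graph G" "(a, b) \<in> G" "(a', b') \<in> G"
  shows "(a - a', b - b') \<in> G"
  using ring_graphD(3)[OF assms(1,2) ring_graphD(5)[OF assms(1,3)]] by simp

lemma ring_graph_unique:
  assumes "ring_graph G" "(a, b) \<in> G" "(a, b') \<in> G"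
  shows "b = b'"
  using ring_graph_diff[OF assms] ring_graphD(6)[OF assms(1), of "b - b'"] by simp

lemma ring_graph_sum:
  assumes "ring_graph G" "\<And>i. i \<in> A \<Longrightarrow> (f i, g i) \<in> G"
  shows "(sum f A, sum g A) \<in> G"
  using assms(2) by (induction A rule: infinite_finite_induct) (auto intro: ring_graphD[OF assms(1)])

lemma ring_graph_power:
  assumes "ring_graph G" "(a, b) \<in> G"
  shows "(a ^ n, b ^ n) \<in> G"
  by (induction n) (auto intro: ring_graphD[OF assms(1)] assms(2))

text \<open>Pairs of polynomials whose coefficients correspond under the homomorphism; evaluation of such pairs at
\<open>x\<close> and \<open>z\<close> extends the homomorphism by \<open>x \<mapsto> z\<close>.\<close>

definition graph_polys :: "(complex \<times> complex) set \<Rightarrow> (complex poly \<times> complex poly) set" where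
  "graph_polys G = {(p, q). \<forall>i. (coeff p i, coeff q i) \<in> G}"

definition graph_adjoin :: "(complex \<times> complex) set \<Rightarrow> complex \<Rightarrow> complex \<Rightarrow> (complex \<times> complex) set" where
  "graph_adjoin G x z = (\<lambda>(p, q). (poly p x, poly q z)) ` graph_polys G"

lemma graph_adjoin_iff:
  "(a, b) \<in> graph_adjoin G x z \<longleftrightarrow> (\<exists>p q. (p, q) \<in> graph_polys G \<and> a = poly p x \<and> b = poly q z)"
  unfolding graph_adjoin_def by force

lemma graph_polys_closed:
  assumes G: "ring_graph G" and "(p, q) \<in> graph_polys G" "(p', q') \<in> graph_polys G"
  shows "(p + p', q + q') \<in> graph_polys G" "(p * p', q * q') \<in> graph_polys G"
    "(- p, - q) \<in> graph_polys G"
  using assms ring_graphD[OF G]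
  by (auto simp: graph_polys_def coeff_mult intro!: ring_graph_sum[OF G])

lemma graph_polys_const:
  assumes G: "ring_graph G" and "(a, b) \<in> G"
  shows "(monom a k, monom b k) \<in> graph_polys G"
  using assms ring_graphD(1)[OF G] by (auto simp: graph_polys_def)

lemma subset_graph_adjoin:
  assumes G: "ring_graph G"
  shows "G \<subseteq> graph_adjoin G x z" "(x, z) \<in> graph_adjoin G x z"
proof
  fix ab assume "ab \<in> G"
  then have "(monom (fst ab) 0, monom (snd ab) 0) \<in> graph_polys G"
    by (intro graph_polys_const[OF G]) simp
  then show "ab \<in> graph_adjoin G x z"
    unfolding graph_adjoin_def by (intro image_eqI) (auto simp: poly_monom)
next
  have "(monom 1 1, monom 1 1) \<in> graph_polys G"
    by (intro graph_polys_const[OF G] ring_graphD[OF G])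
  then show "(x, z) \<in> graph_adjoin G x z"
    unfolding graph_adjoin_def by (intro image_eqI) (auto simp: poly_monom)
qed

lemma ring_graph_adjoin:
  assumes G: "ring_graph G"
    and rel: "\<And>p q. (p, q) \<in> graph_polys G \<Longrightarrow> poly p x = 0 \<Longrightarrow> poly q z = 0"
  shows "ring_graph (graph_adjoin G x z)"
proof -
  have mem: "(poly p x, poly q z) \<in> graph_adjoin G x z" if "(p, q) \<in> graph_polys G" for p q
    using that unfolding graph_adjoin_def by force
  have "(0, 0) \<in> graph_adjoin G x z" "(1, 1) \<in> graph_adjoin G x z"
    using subset_graph_adjoin(1)[OF G] ring_graphD(1,2)[OF G] by auto
  moreover have "(a + a', b + b') \<in> graph_adjoin G x z \<and> (a * a', b * b') \<in> graph_adjoin G x z"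
    if ab: "(a, b) \<in> graph_adjoin G x z" "(a', b') \<in> graph_adjoin G x z" for a b a' b'
  proof -
    obtain p q p' q' where *: "(p, q) \<in> graph_polys G" "a = poly p x" "b = poly q z"
      "(p', q') \<in> graph_polys G" "a' = poly p' x" "b' = poly q' z"
      using ab unfolding graph_adjoin_iff by blast
    show ?thesis
      using mem[OF graph_polys_closed(1)[OF G *(1,4)]] mem[OF graph_polys_closed(2)[OF G *(1,4)]] *
      by simp
  qed
  moreover have "(- a, - b) \<in> graph_adjoin G x z" if ab: "(a, b) \<in> graph_adjoin G x z" for a b
  proof -
    obtain p q where *: "(p, q) \<in> graph_polys G" "a = poly p x" "b = poly q z"
      using ab unfolding graph_adjoin_iff by blast
    show ?thesis
      using mem[OF graph_polys_closed(3)[OF G *(1,1)]] * by simp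
  qed
  moreover have "b = 0" if "(0, b) \<in> graph_adjoin G x z" for b
    using that rel unfolding graph_adjoin_iff by metis
  ultimately show ?thesis
    unfolding ring_graph_def by blast
qed

lemma poly_eq_sum_le:
  fixes p :: "complex poly"
  assumes "degree p \<le> n"
  shows "poly p x = (\<Sum>i\<le>n. coeff p i * x ^ i)"
proof -
  have "(\<Sum>i\<le>degree p. coeff p i * x ^ i) = (\<Sum>i\<le>n. coeff p i * x ^ i)"
    using assms by (intro sum.mono_neutral_left) (auto simp: coeff_eq_0)
  then show ?thesis by (simp add: poly_altdef)
qed

text \<open>Chevalley's extension theorem. A maximal extension inverts everything outside the kernel. If \<open>x\<close> is not in
its domain, then no value \<open>z\<close> for \<open>x\<close> is compatible with all relations, so the images of the relations have
no common root and, being an ideal of polynomials over a subfield, contain a constant: \<open>x\<close> satisfies an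
equation \<open>1 = \<Sum>\<^sub>i m\<^sub>i x\<^sup>i\<close> with all \<open>m\<^sub>i\<close> in the kernel. Such equations of minimal degree for \<open>x\<close> and for
\<open>1/x\<close> would reduce each other.\<close>

theorem chevalley_extension:
  assumes "ring_graph G"
  obtains M where "G \<subseteq> M" "ring_graph M"
    "\<And>a b. (a, b) \<in> M \<Longrightarrow> b \<noteq> 0 \<Longrightarrow> (inverse a, inverse b) \<in> M"
    "\<And>x. x \<notin> Domain M \<Longrightarrow> (inverse x, 0) \<in> M"
proof -
  define \<A> where "\<A> = {M. G \<subseteq> M \<and> ring_graph M}"
  have "\<exists>M\<in>\<A>. \<forall>X\<in>\<A>. M \<subseteq> X \<longrightarrow> X = M"
  proof (rule subset_Zorn_nonempty)
    show "\<A> \<noteq> {}" using assms by (auto simp: \<A>_def)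
    fix \<C> assume ne: "\<C> \<noteq> {}" and ch: "subset.chain \<A> \<C>"
    have sub: "G \<subseteq> X" "ring_graph X" if "X \<in> \<C>" for X
      using ch that by (auto simp: subset.chain_def \<A>_def)
    have two: "\<exists>X\<in>\<C>. u \<in> X \<and> v \<in> X" if "u \<in> \<Union>\<C>" "v \<in> \<Union>\<C>" for u v
    proof -
      obtain X Y where "X \<in> \<C>" "u \<in> X" "Y \<in> \<C>" "v \<in> Y" using \<open>u \<in> \<Union>\<C>\<close> \<open>v \<in> \<Union>\<C>\<close> by blast
      moreover have "X \<subseteq> Y \<or> Y \<subseteq> X"
        using ch calculation unfolding subset.chain_def by blast
      ultimately show ?thesis by blast
    qed
    have "ring_graph (\<Union>\<C>)"
      unfolding ring_graph_def
    proof (intro conjI allI impI)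
      show "(0, 0) \<in> \<Union>\<C>" "(1, 1) \<in> \<Union>\<C>"
        using ne ring_graphD(1,2)[OF sub(2)] by blast+
      show "(a + a', b + b') \<in> \<Union>\<C>" "(a * a', b * b') \<in> \<Union>\<C>"
        if "(a, b) \<in> \<Union>\<C>" "(a', b') \<in> \<Union>\<C>" for a b a' b'
        using two[OF that] ring_graphD(3,4)[OF sub(2)] by blast+
      show "(- a, - b) \<in> \<Union>\<C>" if "(a, b) \<in> \<Union>\<C>" for a b
        using that ring_graphD(5)[OF sub(2)] by blast
      show "b = 0" if "(0, b) \<in> \<Union>\<C>" for b
        using that ring_graphD(6)[OF sub(2)] by blast
    qed
    moreover have "G \<subseteq> \<Union>\<C>"
      using ne sub(1) by blast
    ultimately show "\<Union>\<C> \<in> \<A>"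
      by (simp add: \<A>_def)
  qed
  then obtain M where "M \<in> \<A>" and maxA: "\<forall>X\<in>\<A>. M \<subseteq> X \<longrightarrow> X = M" ..
  then have GM: "G \<subseteq> M" and M: "ring_graph M"
    by (simp_all add: \<A>_def)
  have max: "X = M" if "ring_graph X" "M \<subseteq> X" for X
    using maxA that GM by (simp add: \<A>_def)
  note MD = ring_graphD[OF M]
  have adjoin: "(x, z) \<in> M" if "\<And>p q. (p, q) \<in> graph_polys M \<Longrightarrow> poly p x = 0 \<Longrightarrow> poly q z = 0" for x z
  proof -
    have "ring_graph (graph_adjoin M x z)"
      by (rule ring_graph_adjoin[OF M that])
    then have "graph_adjoin M x z = M"
      using subset_graph_adjoin(1)[OF M] by (rule max)
    then show ?thesis
      using subset_graph_adjoin(2)[OF M, of x z] by simp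
  qed
  have inv: "(inverse a, inverse b) \<in> M" if ab: "(a, b) \<in> M" "b \<noteq> 0" for a b
  proof (rule adjoin)
    fix p q assume pq: "(p, q) \<in> graph_polys M" and 0: "poly p (inverse a) = 0"
    have a: "a \<noteq> 0" using ab MD(6) by auto
    define n where "n = max (degree p) (degree q)"
    have clear: "poly p (inverse a) * a ^ n = (\<Sum>i\<le>n. coeff p i * a ^ (n - i))"
      if "degree p \<le> n" "a \<noteq> 0" for p and a :: complex
      unfolding poly_eq_sum_le[OF that(1)] sum_distrib_right
      using that(2) by (intro sum.cong) (simp_all add: power_diff power_inverse divide_inverse mult_ac)
    have "(\<Sum>i\<le>n. coeff p i * a ^ (n - i), \<Sum>i\<le>n. coeff q i * b ^ (n - i)) \<in> M"
      using pq ab by (intro ring_graph_sum[OF M] MD(4) ring_graph_power[OF M]) (auto simp: graph_polys_def)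
    then have "(0, poly q (inverse b) * b ^ n) \<in> M"
      using clear[of p a] clear[of q b] a ab 0 by (simp add: n_def)
    then have "poly q (inverse b) * b ^ n = 0"
      by (rule MD(6))
    then show "poly q (inverse b) = 0"
      using ab by simp
  qed
  \<comment> \<open>A term of index \<open>0\<close> is allowed, so that no division is needed when \<open>n\<close> is reduced.\<close>
  define rel where "rel x n \<longleftrightarrow> (\<exists>m. (\<forall>i. (m i, 0) \<in> M) \<and> 1 = (\<Sum>i\<le>n. m i * x ^ i))" for x :: complex and n :: nat
  have ideal: "(m * a, 0) \<in> M" if "(m, 0) \<in> M" "(a, b) \<in> M" for m a b
    using MD(4)[OF that] by simp
  have ex_rel: "\<exists>n. rel x n" if x: "x \<notin> Domain M" for x
  proof -
    define I where "I = {q. \<exists>p. (p, q) \<in> graph_polys M \<and> poly p x = 0}"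
    have I_diff: "q - monom c k * q' \<in> I" if "q \<in> I" "q' \<in> I" "(a, c) \<in> M" for q q' a c k
    proof -
      obtain p p' where *: "(p, q) \<in> graph_polys M" "poly p x = 0" "(p', q') \<in> graph_polys M" "poly p' x = 0"
        using \<open>q \<in> I\<close> \<open>q' \<in> I\<close> by (auto simp: I_def)
      have "(monom a k * p', monom c k * q') \<in> graph_polys M"
        by (rule graph_polys_closed(2)[OF M graph_polys_const[OF M that(3)] *(3)])
      from graph_polys_closed(1)[OF M *(1) graph_polys_closed(3)[OF M this this]]
      have "(p - monom a k * p', q - monom c k * q') \<in> graph_polys M"
        by simp
      moreover have "poly (p - monom a k * p') x = 0"
        using * by simp
      ultimately show ?thesis unfolding I_def by blast
    qed
    have no_root: "\<exists>q\<in>I. poly q z \<noteq> 0" for z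
      using adjoin[of x z] x unfolding I_def by blast
    then obtain q0 where "q0 \<in> I" "q0 \<noteq> 0"
      by (metis poly_0)
    then obtain g where g: "g \<in> I" "g \<noteq> 0" and min: "\<And>h. h \<in> I \<Longrightarrow> h \<noteq> 0 \<Longrightarrow> degree g \<le> degree h"
      using ex_has_least_nat[of "\<lambda>q. q \<in> I \<and> q \<noteq> 0" q0 degree] by blast
    \<comment> \<open>Division with remainder by \<open>g\<close> stays inside \<open>I\<close>, because quotients of leading coefficients are images.\<close>
    have root: "poly h z = 0" if "h \<in> I" "poly g z = 0" for h z
      using that
    proof (induction "degree h" arbitrary: h rule: less_induct)
      case less
      show ?case
      proof (cases "h = 0")
        case False
        have "\<exists>a. (a, coeff q i) \<in> M" if "q \<in> I" for q i
          using that by (auto simp: I_def graph_polys_def)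
        then obtain a b where ab: "(a, lead_coeff h) \<in> M" "(b, lead_coeff g) \<in> M"
          using less.prems g by metis
        define c where "c = lead_coeff h * inverse (lead_coeff g)"
        define k where "k = degree h - degree g"
        have "(a * inverse b, c) \<in> M"
          unfolding c_def using g by (intro MD(4) inv ab) auto
        then have I: "h - monom c k * g \<in> I"
          by (rule I_diff[OF less.prems(1) g(1)])
        have deg: "degree h = k + degree g"
          using min[OF less.prems(1) False] by (simp add: k_def)
        have c: "c \<noteq> 0" using False g by (simp add: c_def)
        have deg': "degree (monom c k * g) = degree h"
          using c g deg by (simp add: degree_mult_eq degree_monom_eq)
        show ?thesis
        proof (cases "h - monom c k * g = 0")
          case True
          then show ?thesis using less.prems(2) by (metis eq_iff_diff_eq_0 poly_mult mult_zero_right)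
        next
          case nz: False
          have "coeff (h - monom c k * g) (degree h) = 0"
            using g by (simp add: coeff_monom_mult deg c_def)
          then have "degree (h - monom c k * g) \<noteq> degree h"
            using nz by (metis leading_coeff_0_iff)
          moreover have "degree (h - monom c k * g) \<le> degree h"
            using degree_diff_le[of h "degree h" "monom c k * g"] deg' by simp
          ultimately have "degree (h - monom c k * g) < degree h"
            by linarith
          then have "poly (h - monom c k * g) z = 0"
            using I less.prems(2) by (rule less.hyps)
          then show ?thesis using less.prems(2) by simp
        qed
      qed simp
    qed
    have "degree g = 0"
    proof (rule ccontr)
      assume "degree g \<noteq> 0"
      then have "\<not> constant (poly g)"
        by (simp add: constant_degree)
      then obtain z where "poly g z = 0"
        using fundamental_theorem_of_algebra by blast
      then show False
        using root no_root[of z] by blast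
    qed
    then obtain b0 where g0: "g = [:b0:]"
      by (rule degree_eq_zeroE)
    with g have b0: "b0 \<noteq> 0" by simp
    obtain p where p: "(p, [:b0:]) \<in> graph_polys M" "poly p x = 0"
      using g(1) unfolding I_def g0 by blast
    define a where "a = coeff p 0"
    have coeffs: "(coeff p i, coeff [:b0:] i) \<in> M" for i
      using p(1) by (simp add: graph_polys_def)
    have a: "(a, b0) \<in> M"
      using coeffs[of 0] by (simp add: a_def)
    then have a0: "a \<noteq> 0"
      using b0 MD(6)[of b0] by auto
    have pi: "(coeff p i, 0) \<in> M" if "i \<noteq> 0" for i
      using coeffs[of i] that by (cases i) auto
    define m where "m i = (if i = 0 then 0 else coeff p i * (- inverse a))" for i
    have "(m i, 0) \<in> M" for i
      using MD(1) ideal[OF pi MD(5)[OF inv[OF a b0]], of i] by (auto simp: m_def)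
    moreover have "1 = (\<Sum>i\<le>degree p. m i * x ^ i)"
    proof -
      have "0 = (\<Sum>i\<le>degree p. coeff p i * x ^ i) * (- inverse a)"
        using p(2) by (simp add: poly_altdef)
      also have "\<dots> = (\<Sum>i\<le>degree p. (if i = 0 then - 1 else 0) + m i * x ^ i)"
        unfolding sum_distrib_right using a0 by (intro sum.cong) (auto simp: m_def a_def)
      also have "\<dots> = - 1 + (\<Sum>i\<le>degree p. m i * x ^ i)"
        by (simp add: sum.distrib)
      finally show ?thesis by simp
    qed
    ultimately show ?thesis unfolding rel_def by blast
  qed
  have reduce: "\<exists>n''<n. rel x n''" if "x \<noteq> 0" "rel x n" "rel (inverse x) n'" "n' \<le> n" for x n n'
  proof -
    obtain m where m: "\<And>i. (m i, 0) \<in> M" "1 = (\<Sum>i\<le>n. m i * x ^ i)"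
      using \<open>rel x n\<close> unfolding rel_def by blast
    obtain m' where m': "\<And>i. (m' i, 0) \<in> M" "1 = (\<Sum>i\<le>n'. m' i * inverse x ^ i)"
      using \<open>rel (inverse x) n'\<close> unfolding rel_def by blast
    have "n \<noteq> 0"
    proof
      assume "n = 0"
      then have "(1, 0) \<in> M" using m(1)[of 0] m(2) by simp
      then show False using ring_graph_unique[OF M MD(2)] by fastforce
    qed
    define e where "e = 1 - m' 0"
    have e: "(e, 1) \<in> M" unfolding e_def using ring_graph_diff[OF M MD(2) m'(1)[of 0]] by simp
    then have e0: "e \<noteq> 0" using MD(6)[of 1] by auto
    have ei: "(inverse e, 1) \<in> M" using inv[OF e] by simp
    have "e = (\<Sum>j\<in>{1..n'}. m' j * inverse x ^ j)"
    proof -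
      have "{..n'} = insert 0 {1..n'}" by auto
      then have "1 = m' 0 + (\<Sum>j\<in>{1..n'}. m' j * inverse x ^ j)"
        using m'(2) by simp
      then show ?thesis unfolding e_def by (metis add_diff_cancel_left')
    qed
    then have "x ^ n = inverse e * (\<Sum>j\<in>{1..n'}. m' j * inverse x ^ j) * x ^ n"
      using e0 by simp
    also have "\<dots> = (\<Sum>j\<in>{1..n'}. m' j * inverse e * x ^ (n - j))"
      unfolding sum_distrib_left sum_distrib_right
      using \<open>x \<noteq> 0\<close> \<open>n' \<le> n\<close> by (intro sum.cong) (simp_all add: power_diff power_inverse divide_inverse mult_ac)
    also have "\<dots> = (\<Sum>i\<in>{n - n'..<n}. m' (n - i) * inverse e * x ^ i)"
      by (rule sum.reindex_bij_witness[of _ "\<lambda>i. n - i" "\<lambda>j. n - j"]) (use \<open>n' \<le> n\<close> in auto)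
    also have "\<dots> = (\<Sum>i<n. (if n - n' \<le> i then m' (n - i) * inverse e else 0) * x ^ i)"
      by (rule sum.mono_neutral_cong_left) auto
    finally have xn: "x ^ n = \<dots>" .
    define m'' where "m'' i = m i + m n * (if n - n' \<le> i then m' (n - i) * inverse e else 0)" for i
    have "(m'' i, 0) \<in> M" for i
    proof -
      have "((if n - n' \<le> i then m' (n - i) * inverse e else 0), 0) \<in> M"
        using ideal[OF m'(1) ei] MD(1) by auto
      from MD(3)[OF m(1)[of i] ideal[OF m(1)[of n] this]] show ?thesis
        by (simp add: m''_def)
    qed
    moreover have "1 = (\<Sum>i\<le>n - 1. m'' i * x ^ i)"
    proof -
      have "1 = (\<Sum>i<n. m i * x ^ i) + m n * x ^ n"
        using m(2) by (simp flip: lessThan_Suc_atMost)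
      also have "m n * x ^ n = m n * (\<Sum>i<n. (if n - n' \<le> i then m' (n - i) * inverse e else 0) * x ^ i)"
        by (subst xn) (rule refl)
      also have "(\<Sum>i<n. m i * x ^ i) + \<dots> = (\<Sum>i<n. m'' i * x ^ i)"
        by (simp only: m''_def distrib_right sum.distrib sum_distrib_left mult.assoc)
      also have "{..<n} = {..n - 1}" using \<open>n \<noteq> 0\<close> by auto
      finally show ?thesis .
    qed
    ultimately have "rel x (n - 1)" unfolding rel_def by blast
    then show ?thesis using \<open>n \<noteq> 0\<close> by (intro exI[of _ "n - 1"]) auto
  qed
  \<comment> \<open>Of two minimal equations, the one of larger degree can be reduced by the other.\<close>
  have val: "inverse x \<in> Domain M" if x: "x \<notin> Domain M" for x
  proof (rule ccontr)
    assume x': "inverse x \<notin> Domain M"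
    have "x \<noteq> 0" using x MD(1) by auto
    define n where "n = (LEAST n. rel x n)"
    define n' where "n' = (LEAST n. rel (inverse x) n)"
    have "rel x n" "rel (inverse x) n'"
      unfolding n_def n'_def using ex_rel[OF x] ex_rel[OF x'] by (auto intro: LeastI_ex)
    moreover have "\<not> rel x i" if "i < n" for i
      using that unfolding n_def by (rule not_less_Least)
    moreover have "\<not> rel (inverse x) i" if "i < n'" for i
      using that unfolding n'_def by (rule not_less_Least)
    ultimately show False
      using reduce[of x n n'] reduce[of "inverse x" n' n] \<open>x \<noteq> 0\<close> by (cases "n' \<le> n") auto
  qed
  show ?thesis
  proof
    show "(inverse x, 0) \<in> M" if x: "x \<notin> Domain M" for x
    proof -
      obtain b where b: "(inverse x, b) \<in> M" using val[OF x] by blast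
      have "b = 0"
      proof (rule ccontr)
        assume "b \<noteq> 0"
        from inv[OF b this] show False using x by auto
      qed
      with b show ?thesis by simp
    qed
  qed (use GM M inv in auto)
qed

section \<open>Cartan decomposition over a valuation ring\<close>

definition valuation_subring :: "complex set \<Rightarrow> bool" where
  "valuation_subring K \<longleftrightarrow> subsemiring K \<and> (\<forall>a\<in>K. - a \<in> K) \<and> (\<forall>x. x \<in> K \<or> inverse x \<in> K)"

lemma valuation_subringD:
  assumes "valuation_subring K"
  shows "subsemiring K" "a \<in> K \<Longrightarrow> - a \<in> K" "x \<notin> K \<Longrightarrow> inverse x \<in> K"
  using assms by (auto simp: valuation_subring_def)

definition SL_over :: "nat \<Rightarrow> complex set \<Rightarrow> complex mat set" where
  "SL_over n K = {A \<in> carrier_mat n n. det A = 1 \<and> (\<forall>i<n. \<forall>j<n. A $$ (i, j) \<in> K)}"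

lemma one_SL_over: "subsemiring K \<Longrightarrow> 1\<^sub>m n \<in> SL_over n K"
  by (auto simp: SL_over_def dest: subsemiringD)

lemma mult_SL_over:
  assumes "subsemiring K" "A \<in> SL_over n K" "B \<in> SL_over n K"
  shows "A * B \<in> SL_over n K"
proof -
  have "(A * B) $$ (i, j) \<in> K" if "i < n" "j < n" for i j
    using assms that by (auto simp: SL_over_def scalar_prod_def intro!: subsemiring_sum subsemiringD(4))
  then show ?thesis
    using assms by (auto simp: SL_over_def det_mult)
qed

lemma transpose_SL_over: "A \<in> SL_over n K \<Longrightarrow> A\<^sup>T \<in> SL_over n K"
  by (auto simp: SL_over_def det_transpose)

lemma det_in_subring:
  assumes K: "subsemiring K" and "\<And>a. a \<in> K \<Longrightarrow> - a \<in> K" and "A \<in> carrier_mat n n"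
    and "\<And>i j. i < n \<Longrightarrow> j < n \<Longrightarrow> A $$ (i, j) \<in> K"
  shows "det A \<in> (K :: complex set)"
proof -
  have less: "p i < n" if "p permutes {0..<n}" "i < n" for p i
    using permutes_in_image[OF that(1), of i] that(2) by simp
  have "signof p \<in> K" for p :: "nat \<Rightarrow> nat"
    using subsemiringD(2)[OF K] assms(2) by (auto simp: sign_def)
  then show ?thesis
    unfolding det_def'[OF assms(3)]
    by (intro subsemiring_sum[OF K] subsemiringD(4)[OF K] subsemiring_prod[OF K] assms(4))
      (auto intro: less)
qed

text \<open>The inverse of a matrix of determinant \<open>1\<close> is its adjugate.\<close>

lemma inverse_SL_over:
  assumes K: "subsemiring K" "\<And>a. a \<in> K \<Longrightarrow> - a \<in> K" and A: "A \<in> SL_over n K"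
  obtains B where "B \<in> SL_over n K" "A * B = 1\<^sub>m n" "B * A = 1\<^sub>m n"
proof
  have Ac: "A \<in> carrier_mat n n" "det A = 1" using A by (auto simp: SL_over_def)
  note adj = adj_mat[OF Ac(1)]
  show "A * adj_mat A = 1\<^sub>m n" "adj_mat A * A = 1\<^sub>m n"
    using adj Ac by auto
  have "det A * det (adj_mat A) = det (1\<^sub>m n :: complex mat)"
    using det_mult[OF Ac(1) adj(1)] adj(2) Ac(2) by simp
  then have det: "det (adj_mat A) = 1" using Ac(2) by simp
  have "adj_mat A $$ (i, j) \<in> K" if "i < n" "j < n" for i j
  proof -
    have "mat_delete A j i \<in> carrier_mat (n - 1) (n - 1)"
      using mat_delete_carrier[OF Ac(1)] by simp
    moreover have "mat_delete A j i $$ (r, s) \<in> K" if "r < n - 1" "s < n - 1" for r s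
      using A that \<open>i < n\<close> \<open>j < n\<close> by (auto simp: mat_delete_def SL_over_def)
    ultimately have "det (mat_delete A j i) \<in> K"
      by (intro det_in_subring[OF K(1), where n = "n - 1"]) (use K(2) in auto)
    moreover have "(- 1) ^ (j + i) \<in> K"
      using subsemiring_power[OF K(1) K(2)[OF subsemiringD(2)[OF K(1)]]] .
    ultimately have "cofactor A j i \<in> K"
      by (simp add: cofactor_def subsemiringD(4)[OF K(1)])
    then show ?thesis using that Ac by (simp add: adj_mat_def)
  qed
  then show "adj_mat A \<in> SL_over n K"
    using adj(1) det by (auto simp: SL_over_def)
qed

definition SL_equiv :: "nat \<Rightarrow> complex set \<Rightarrow> complex mat \<Rightarrow> complex mat \<Rightarrow> bool" where
  "SL_equiv n K A B \<longleftrightarrow> (\<exists>P\<in>SL_over n K. \<exists>Q\<in>SL_over n K. P * A * Q = B)"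

lemma SL_equiv_refl: "subsemiring K \<Longrightarrow> A \<in> carrier_mat n n \<Longrightarrow> SL_equiv n K A A"
  unfolding SL_equiv_def by (intro bexI[of _ "1\<^sub>m n"]) (auto simp: one_SL_over)

lemma SL_equiv_trans:
  assumes K: "subsemiring K" and A: "A \<in> carrier_mat n n" and AB: "SL_equiv n K A B" and BC: "SL_equiv n K B C"
  shows "SL_equiv n K A C"
proof -
  obtain P Q P' Q' where PQ: "P \<in> SL_over n K" "Q \<in> SL_over n K" "P * A * Q = B"
    "P' \<in> SL_over n K" "Q' \<in> SL_over n K" "P' * B * Q' = C"
    using AB BC unfolding SL_equiv_def by blast
  have c: "P \<in> carrier_mat n n" "Q \<in> carrier_mat n n" "P' \<in> carrier_mat n n" "Q' \<in> carrier_mat n n"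
    using PQ by (auto simp: SL_over_def)
  have "(P' * P) * A * (Q * Q') = P' * (P * A * Q) * Q'"
    using c A by (simp add: assoc_mult_mat[of _ n n _ n _ n])
  then have "(P' * P) * A * (Q * Q') = C" using PQ by simp
  then show ?thesis
    unfolding SL_equiv_def using mult_SL_over[OF K] PQ by blast
qed

lemma SL_equiv_transpose:
  assumes A: "A \<in> carrier_mat n n" and AB: "SL_equiv n K A\<^sup>T B"
  shows "SL_equiv n K A B\<^sup>T"
proof -
  obtain P Q where PQ: "P \<in> SL_over n K" "Q \<in> SL_over n K" "P * A\<^sup>T * Q = B"
    using AB unfolding SL_equiv_def by blast
  have c: "P \<in> carrier_mat n n" "Q \<in> carrier_mat n n"
    using PQ by (auto simp: SL_over_def)
  have "B\<^sup>T = Q\<^sup>T * (P * A\<^sup>T)\<^sup>T"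
    unfolding PQ(3)[symmetric] using A c by (intro transpose_mult) auto
  also have "(P * A\<^sup>T)\<^sup>T = A * P\<^sup>T"
    using A c transpose_mult[of P n n "A\<^sup>T" n] by simp
  also have "Q\<^sup>T * (A * P\<^sup>T) = Q\<^sup>T * A * P\<^sup>T"
    using A c by (simp add: assoc_mult_mat[of _ n n _ n _ n])
  finally show ?thesis
    unfolding SL_equiv_def using transpose_SL_over PQ by metis
qed

text \<open>Adds \<open>u i\<close> times row \<open>s\<close> to row \<open>i\<close>, for all \<open>i \<noteq> s\<close>.\<close>

definition row_op :: "nat \<Rightarrow> nat \<Rightarrow> (nat \<Rightarrow> complex) \<Rightarrow> complex mat" where
  "row_op n s u = mat n n (\<lambda>(i, j). if i = j then 1 else if j = s then u i else 0)"

lemma row_op_carrier [simp]: "row_op n s u \<in> carrier_mat n n"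
  by (simp add: row_op_def)

lemma row_op_SL_over:
  assumes K: "subsemiring K" and s: "s < n" and u: "\<And>i. i < n \<Longrightarrow> u i \<in> K"
    and tri: "(\<forall>i<s. u i = 0) \<or> (\<forall>i. s < i \<longrightarrow> i < n \<longrightarrow> u i = 0)"
  shows "row_op n s u \<in> SL_over n K"
proof -
  have c: "row_op n s u \<in> carrier_mat n n" by (simp add: row_op_def)
  have diag: "prod_list (diag_mat (row_op n s u)) = 1"
    by (simp add: prod_list_diag_prod row_op_def)
  have "det (row_op n s u) = 1"
    using tri
  proof
    assume "\<forall>i<s. u i = 0"
    then have "det (row_op n s u) = prod_list (diag_mat (row_op n s u))"
      by (intro det_lower_triangular[OF _ c]) (auto simp: row_op_def)
    with diag show ?thesis by simp
  next
    assume "\<forall>i. s < i \<longrightarrow> i < n \<longrightarrow> u i = 0"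
    then have "det (row_op n s u) = prod_list (diag_mat (row_op n s u))"
      by (intro det_upper_triangular[OF _ c] upper_triangularI) (auto simp: row_op_def)
    with diag show ?thesis by simp
  qed
  then show ?thesis
    using c u subsemiringD[OF K] by (auto simp: SL_over_def row_op_def)
qed

lemma row_op_mult:
  assumes A: "A \<in> carrier_mat n n" and "s < n" "i < n" "j < n"
  shows "(row_op n s u * A) $$ (i, j) = A $$ (i, j) + (if i = s then 0 else u i * A $$ (s, j))"
proof -
  have "(row_op n s u * A) $$ (i, j) = (\<Sum>r<n. row_op n s u $$ (i, r) * A $$ (r, j))"
    using assms by (simp add: row_op_def scalar_prod_def lessThan_atLeast0)
  also have "\<dots> = (\<Sum>r<n. (if r = i then A $$ (r, j) else 0) + (if r = s then (if i = s then 0 else u i * A $$ (s, j)) else 0))"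
    using assms by (intro sum.cong) (auto simp: row_op_def)
  also have "\<dots> = A $$ (i, j) + (if i = s then 0 else u i * A $$ (s, j))"
    using assms by (simp add: sum.distrib)
  finally show ?thesis .
qed

lemma row_op_equiv:
  assumes K: "subsemiring K" and A: "A \<in> carrier_mat n n" and "row_op n s u \<in> SL_over n K"
  shows "SL_equiv n K A (row_op n s u * A)"
proof -
  have "row_op n s u * A \<in> carrier_mat n n"
    by (rule mult_carrier_mat[OF row_op_carrier A])
  then show ?thesis
    unfolding SL_equiv_def using assms(3) one_SL_over[OF K]
    by (intro bexI[of _ "row_op n s u"] bexI[of _ "1\<^sub>m n"]) auto
qed

definition cleared :: "nat \<Rightarrow> nat \<Rightarrow> complex mat \<Rightarrow> bool" where
  "cleared n s A \<longleftrightarrow> (\<forall>i<n. \<forall>j<n. i \<noteq> j \<longrightarrow> i < s \<or> j < s \<longrightarrow> A $$ (i, j) = 0)"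

text \<open>Integral quotients express that the entry at \<open>pq\<close> has minimal valuation among the rows and columns that
are still to be treated.\<close>

definition pivot :: "nat \<Rightarrow> complex set \<Rightarrow> nat \<Rightarrow> nat \<times> nat \<Rightarrow> complex mat \<Rightarrow> bool" where
  "pivot n K s pq A \<longleftrightarrow> A $$ pq \<noteq> 0 \<and>
     (\<forall>i\<in>{s..<n}. \<forall>j\<in>{s..<n}. A $$ (i, j) / A $$ pq \<in> K)"

lemma cleared_transpose: "A \<in> carrier_mat n n \<Longrightarrow> cleared n s A\<^sup>T = cleared n s A"
  unfolding cleared_def by auto

lemma pivot_transpose:
  "A \<in> carrier_mat n n \<Longrightarrow> p < n \<Longrightarrow> q < n \<Longrightarrow> pivot n K s (q, p) A\<^sup>T = pivot n K s (p, q) A"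
  unfolding pivot_def by auto

lemma exists_pivot:
  assumes K: "valuation_subring K" and "finite S" "x0 \<in> S" "x0 \<noteq> (0::complex)"
  shows "\<exists>b\<in>S. b \<noteq> 0 \<and> (\<forall>x\<in>S. x / b \<in> K)"
proof -
  note K1 = valuation_subringD(1)[OF K]
  note KD = subsemiringD[OF K1]
  have "T = {} \<or> (\<exists>b\<in>T. b \<noteq> 0 \<and> (\<forall>x\<in>T. x / b \<in> K))" if "finite T" "0 \<notin> T" for T
    using that
  proof (induction T rule: finite_induct)
    case (insert x T)
    show ?case
    proof (cases "T = {}")
      case True
      then show ?thesis using KD(2) insert.prems by auto
    next
      case False
      then obtain b where b: "b \<in> T" "b \<noteq> 0" "\<And>y. y \<in> T \<Longrightarrow> y / b \<in> K"
        using insert by auto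
      show ?thesis
      proof (cases "x / b \<in> K")
        case True
        then show ?thesis using b by auto
      next
        case False
        then have "b / x \<in> K"
          using valuation_subringD(3)[OF K, of "x / b"] by (simp add: inverse_eq_divide)
        have "x \<noteq> 0" using insert.prems by auto
        have "y / x \<in> K" if "y \<in> T" for y
          using KD(4)[OF b(3)[OF that] \<open>b / x \<in> K\<close>] b(2) by simp
        then show ?thesis using \<open>x \<noteq> 0\<close> KD(2) by (intro disjI2 bexI[of _ x]) auto
      qed
    qed
  qed simp
  from this[of "S - {0}"] obtain b where b: "b \<in> S" "b \<noteq> 0" "\<And>y. y \<in> S - {0} \<Longrightarrow> y / b \<in> K"
    using assms(2-4) by auto
  then have "y / b \<in> K" if "y \<in> S" for y
    using that KD(1) by (cases "y = 0") auto
  with b show ?thesis by blast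
qed

text \<open>Swapping rows would change the sign of the determinant. Adding row \<open>p\<close> to row \<open>s\<close> serves the same purpose:
if the entry of row \<open>s\<close> in the pivot column has larger valuation than the pivot, then their sum has the
valuation of the pivot; otherwise it is a pivot itself.\<close>

lemma move_pivot_row:
  assumes K: "valuation_subring K" and A: "A \<in> carrier_mat n n" and "cleared n s A"
    and piv: "pivot n K s (p, q) A" and pq: "s \<le> p" "p < n" "s \<le> q" "q < n"
  shows "\<exists>B. B \<in> carrier_mat n n \<and> SL_equiv n K A B \<and> cleared n s B \<and> pivot n K s (s, q) B"
proof -
  note K1 = valuation_subringD(1)[OF K]
  note KD = subsemiringD[OF K1]
  define b where "b = A $$ (p, q)"
  define r where "r = A $$ (s, q) / b"
  have b0: "b \<noteq> 0" and dom: "\<And>i j. s \<le> i \<Longrightarrow> i < n \<Longrightarrow> s \<le> j \<Longrightarrow> j < n \<Longrightarrow> A $$ (i, j) / b \<in> K"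
    using piv by (auto simp: pivot_def b_def)
  have r: "r \<in> K" using dom[of s q] pq by (simp add: r_def)
  have sn: "s < n" using pq by simp
  show ?thesis
  proof (cases "r \<noteq> 0 \<and> inverse r \<in> K")
    case True
    have "A $$ (i, j) / A $$ (s, q) \<in> K" if "s \<le> i" "i < n" "s \<le> j" "j < n" for i j
    proof -
      have "A $$ (i, j) / A $$ (s, q) = A $$ (i, j) / b * inverse r"
        using b0 True by (simp add: r_def)
      then show ?thesis using KD(4)[OF dom[OF that]] True by simp
    qed
    moreover have "A $$ (s, q) \<noteq> 0" using True by (auto simp: r_def)
    ultimately have "pivot n K s (s, q) A" by (simp add: pivot_def)
    then show ?thesis using A assms(3) SL_equiv_refl[OF K1 A] by blast
  next
    case False
    have sp: "s < p"
    proof (rule ccontr)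
      assume "\<not> s < p"
      then have "p = s" using pq by simp
      then have "r = 1" using b0 by (simp add: r_def b_def)
      then show False using False KD(2) by simp
    qed
    have r1: "1 + r \<noteq> 0"
    proof
      assume "1 + r = 0"
      then have "r = - 1" by (simp add: eq_neg_iff_add_eq_0 add.commute)
      then show False using False valuation_subringD(2)[OF K KD(2)] by simp
    qed
    \<comment> \<open>As \<open>1/r\<close> is not integral, neither is \<open>1 + 1/r\<close>, so its inverse is; and \<open>1 - 1/(1 + 1/r) = 1/(1 + r)\<close>.\<close>
    have r1i: "inverse (1 + r) \<in> K"
    proof (cases "r = 0")
      case False
      then have "inverse r \<notin> K" using \<open>\<not> (r \<noteq> 0 \<and> inverse r \<in> K)\<close> by simp
      have "1 + inverse r \<notin> K"
      proof
        assume "1 + inverse r \<in> K"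
        then have "1 + inverse r + - 1 \<in> K" using valuation_subringD(2)[OF K KD(2)] by (rule KD(3))
        then show False using \<open>inverse r \<notin> K\<close> by simp
      qed
      then have "inverse (1 + inverse r) \<in> K" by (rule valuation_subringD(3)[OF K])
      then have "1 + - inverse (1 + inverse r) \<in> K"
        using KD(2,3) valuation_subringD(2)[OF K] by blast
      moreover have "1 + - inverse (1 + inverse r) = inverse (1 + r)"
      proof -
        have "1 + inverse r = (1 + r) / r" using False by (simp add: field_simps)
        then show ?thesis using False r1 by (simp add: field_simps)
      qed
      ultimately show ?thesis by simp
    qed (use KD(2) in simp)
    define u where "u = (\<lambda>i. if i = s then 1 else 0 :: complex)"
    define B where "B = row_op n p u * A"
    have E: "row_op n p u \<in> SL_over n K"
      by (rule row_op_SL_over[OF K1]) (use KD sp pq in \<open>auto simp: u_def\<close>)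
    have B: "B $$ (i, j) = A $$ (i, j) + (if i = s then A $$ (p, j) else 0)" if "i < n" "j < n" for i j
      unfolding B_def using row_op_mult[OF A pq(2) that, of u] sp by (simp add: u_def)
    have Bc: "B \<in> carrier_mat n n" unfolding B_def by (rule mult_carrier_mat[OF row_op_carrier A])
    have "cleared n s B"
      using assms(3) B sp pq unfolding cleared_def by auto
    moreover have Bsq: "B $$ (s, q) = b * (1 + r)"
      using B[of s q] sn pq b0 by (simp add: r_def b_def field_simps)
    have "pivot n K s (s, q) B"
    proof -
      have "B $$ (i, j) / B $$ (s, q) \<in> K" if ij: "s \<le> i" "i < n" "s \<le> j" "j < n" for i j
      proof -
        have "B $$ (i, j) / b \<in> K"
          using dom[OF ij] KD(3)[OF dom[OF ij] dom[of p j]] ij pq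
          by (cases "i = s") (auto simp: B add_divide_distrib)
        from KD(4)[OF this r1i] show ?thesis
          by (simp add: Bsq divide_inverse mult.assoc)
      qed
      moreover have "B $$ (s, q) \<noteq> 0" using Bsq b0 r1 by simp
      ultimately show ?thesis by (simp add: pivot_def)
    qed
    ultimately show ?thesis
      using Bc row_op_equiv[OF K1 A E] unfolding B_def[symmetric] by blast
  qed
qed

lemma clear_column:
  assumes K: "valuation_subring K" and A: "A \<in> carrier_mat n n" and "cleared n s A"
    and piv: "pivot n K s (s, s) A" and s: "s < n"
  shows "\<exists>B. B \<in> carrier_mat n n \<and> SL_equiv n K A B \<and> cleared n s B \<and> pivot n K s (s, s) B \<and>
    (\<forall>i. s < i \<longrightarrow> i < n \<longrightarrow> B $$ (i, s) = 0) \<and> (\<forall>j<n. B $$ (s, j) = A $$ (s, j))"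
proof -
  note K1 = valuation_subringD(1)[OF K]
  note KD = subsemiringD[OF K1]
  define b where "b = A $$ (s, s)"
  have b0: "b \<noteq> 0" and dom: "\<And>i j. s \<le> i \<Longrightarrow> i < n \<Longrightarrow> s \<le> j \<Longrightarrow> j < n \<Longrightarrow> A $$ (i, j) / b \<in> K"
    using piv by (auto simp: pivot_def b_def)
  define u where "u = (\<lambda>i. if s < i then - (A $$ (i, s) / b) else 0)"
  have uK: "u i \<in> K" if "i < n" for i
    using dom[of i s] that s KD(1) valuation_subringD(2)[OF K] by (simp add: u_def)
  define B where "B = row_op n s u * A"
  have E: "row_op n s u \<in> SL_over n K"
    by (rule row_op_SL_over[OF K1 s uK]) (auto simp: u_def)
  have B: "B $$ (i, j) = A $$ (i, j) + u i * A $$ (s, j)" if "i < n" "j < n" for i j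
    unfolding B_def using row_op_mult[OF A s that, of u] by (simp add: u_def)
  have Bc: "B \<in> carrier_mat n n" unfolding B_def by (rule mult_carrier_mat[OF row_op_carrier A])
  have us: "u s = 0" by (simp add: u_def)
  have Bs: "B $$ (s, j) = A $$ (s, j)" if "j < n" for j
    using B[OF s that] us by simp
  have "cleared n s B"
    unfolding cleared_def
  proof (intro allI impI)
    fix i j assume ij: "i < n" "j < n" "i \<noteq> j" "i < s \<or> j < s"
    have "u i * A $$ (s, j) = 0"
      using assms(3) ij s unfolding cleared_def u_def by auto
    moreover have "A $$ (i, j) = 0" using assms(3) ij unfolding cleared_def by blast
    ultimately show "B $$ (i, j) = 0" using B[OF ij(1,2)] by simp
  qed
  moreover have "pivot n K s (s, s) B"
  proof -
    have "B $$ (i, j) / b \<in> K" if ij: "s \<le> i" "i < n" "s \<le> j" "j < n" for i j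
    proof -
      have "B $$ (i, j) / b = A $$ (i, j) / b + u i * (A $$ (s, j) / b)"
        using B[of i j] ij by (simp add: add_divide_distrib)
      then show ?thesis
        using KD(3)[OF dom[OF ij] KD(4)[OF uK dom[of s j]]] ij s by simp
    qed
    then show ?thesis using Bs[OF s] b0 by (simp add: pivot_def b_def)
  qed
  moreover have "B $$ (i, s) = 0" if "s < i" "i < n" for i
    using B[of i s] that s b0 by (simp add: u_def b_def)
  ultimately show ?thesis
    using Bc Bs row_op_equiv[OF K1 A E] unfolding B_def[symmetric] by blast
qed

text \<open>Gaussian elimination with a pivot of smallest valuation only uses integral row and column operations.
Columns are treated by transposition.\<close>

theorem cartan_decomposition:
  assumes K: "valuation_subring K" and A: "A \<in> carrier_mat n n"
  obtains P Q T where "P \<in> SL_over n K" "Q \<in> SL_over n K" "T \<in> carrier_mat n n"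
    "P * A = T * Q" "\<And>i j. i < n \<Longrightarrow> j < n \<Longrightarrow> i \<noteq> j \<Longrightarrow> T $$ (i, j) = 0"
proof -
  note K1 = valuation_subringD(1)[OF K]
  have "\<exists>B. B \<in> carrier_mat n n \<and> SL_equiv n K A B \<and> cleared n s B" if "s \<le> n" for s
    using that
  proof (induction s)
    case 0
    then show ?case using A SL_equiv_refl[OF K1 A] by (auto simp: cleared_def)
  next
    case (Suc s)
    then obtain B where B: "B \<in> carrier_mat n n" "SL_equiv n K A B" "cleared n s B" by auto
    have s: "s < n" using Suc.prems by simp
    show ?case
    proof (cases "\<forall>i\<in>{s..<n}. \<forall>j\<in>{s..<n}. B $$ (i, j) = 0")
      case True
      have "B $$ (i, j) = 0" if "i < n" "j < n" "i \<noteq> j" "i < Suc s \<or> j < Suc s" for i j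
      proof (cases "i < s \<or> j < s")
        case True
        then show ?thesis using B(3) that by (auto simp: cleared_def)
      next
        case False
        then show ?thesis using True that \<open>\<forall>i\<in>{s..<n}. \<forall>j\<in>{s..<n}. B $$ (i, j) = 0\<close> by auto
      qed
      then have "cleared n (Suc s) B" by (simp add: cleared_def)
      then show ?thesis using B by blast
    next
      case False
      define S where "S = (\<lambda>(i, j). B $$ (i, j)) ` ({s..<n} \<times> {s..<n})"
      obtain x0 where "x0 \<in> S" "x0 \<noteq> 0" using False unfolding S_def by force
      then obtain b where b: "b \<in> S" "b \<noteq> 0" "\<forall>x\<in>S. x / b \<in> K"
        using exists_pivot[OF K, of S x0] unfolding S_def by auto
      then obtain p q where pq: "p \<in> {s..<n}" "q \<in> {s..<n}" "b = B $$ (p, q)"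
        unfolding S_def by auto
      have "pivot n K s (p, q) B"
        using b pq unfolding pivot_def S_def by auto
      then obtain B1 where B1: "B1 \<in> carrier_mat n n" "SL_equiv n K B B1" "cleared n s B1" "pivot n K s (s, q) B1"
        using move_pivot_row[OF K B(1,3)] pq by auto
      have "pivot n K s (q, s) B1\<^sup>T" "cleared n s B1\<^sup>T"
        using B1 pq s by (auto simp: pivot_transpose cleared_transpose)
      then obtain B2 where B2: "B2 \<in> carrier_mat n n" "SL_equiv n K B1\<^sup>T B2" "cleared n s B2" "pivot n K s (s, s) B2"
        using move_pivot_row[OF K, of "B1\<^sup>T" n s q s] B1(1) pq s by auto
      obtain B3 where B3: "B3 \<in> carrier_mat n n" "SL_equiv n K B2 B3" "cleared n s B3" "pivot n K s (s, s) B3"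
        "\<And>i. s < i \<Longrightarrow> i < n \<Longrightarrow> B3 $$ (i, s) = 0"
        using clear_column[OF K B2(1,3,4) s] by blast
      have "pivot n K s (s, s) B3\<^sup>T" "cleared n s B3\<^sup>T"
        using B3 s by (auto simp: pivot_transpose cleared_transpose)
      then obtain B4 where B4: "B4 \<in> carrier_mat n n" "SL_equiv n K B3\<^sup>T B4" "cleared n s B4"
        "\<And>i. s < i \<Longrightarrow> i < n \<Longrightarrow> B4 $$ (i, s) = 0" "\<And>j. j < n \<Longrightarrow> B4 $$ (s, j) = B3\<^sup>T $$ (s, j)"
        using clear_column[OF K, of "B3\<^sup>T" n s] B3(1) s by auto
      have "SL_equiv n K B1 B2\<^sup>T" by (rule SL_equiv_transpose[OF B1(1) B2(2)])
      moreover have "SL_equiv n K B2\<^sup>T B3\<^sup>T"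
        using SL_equiv_transpose[of "B2\<^sup>T" n K B3] B2 B3 by simp
      ultimately have "SL_equiv n K A B4"
        using B B1 B2 B3 B4 A
        by (meson SL_equiv_trans[OF K1] transpose_carrier_mat)
      moreover have "cleared n (Suc s) B4"
        unfolding cleared_def
      proof (intro allI impI)
        fix i j assume ij: "i < n" "j < n" "i \<noteq> j" "i < Suc s \<or> j < Suc s"
        show "B4 $$ (i, j) = 0"
        proof (cases "i < s \<or> j < s")
          case True
          then show ?thesis using B4(3) ij unfolding cleared_def by blast
        next
          case False
          then consider "i = s" "s < j" | "j = s" "s < i" using ij by linarith
          then show ?thesis
          proof cases
            case 1
            then show ?thesis using B4(5)[of j] B3(1,5) ij s by simp
          next
            case 2
            then show ?thesis using B4(4) ij by simp
          qed
        qed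
      qed
      ultimately show ?thesis using B4 by blast
    qed
  qed
  from this[of n] obtain T where T: "T \<in> carrier_mat n n" "SL_equiv n K A T" "cleared n n T" by auto
  then obtain P Q where PQ: "P \<in> SL_over n K" "Q \<in> SL_over n K" "P * A * Q = T"
    unfolding SL_equiv_def by blast
  obtain Q' where Q': "Q' \<in> SL_over n K" "Q * Q' = 1\<^sub>m n"
    using inverse_SL_over[OF K1 valuation_subringD(2)[OF K] PQ(2)] by blast
  have c: "P \<in> carrier_mat n n" "Q \<in> carrier_mat n n" "Q' \<in> carrier_mat n n"
    using PQ Q' by (auto simp: SL_over_def)
  have "T * Q' = P * A * (Q * Q')"
    unfolding PQ(3)[symmetric] using c A by (simp add: assoc_mult_mat[of _ n n _ n _ n])
  then have "P * A = T * Q'" using Q'(2) c A by simp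
  then show ?thesis
    using that[OF PQ(1) Q'(1) T(1)] T(3) by (auto simp: cleared_def)
qed

section \<open>Representations by integral polynomials\<close>

definition embed :: "nat \<Rightarrow> (nat \<Rightarrow> nat) \<Rightarrow> nat \<Rightarrow> complex mat \<Rightarrow> nat \<Rightarrow> complex mat" where
  "embed k n l g = (\<lambda>i\<in>{..<k}. if i = l then g else 1\<^sub>m (n i))"

lemma factor_rep_embed: "factor_rep k n \<pi> l g = \<pi> (embed k n l g)"
  by (simp add: factor_rep_def embed_def)

lemma embed_GL: "g \<in> carrier (GL (n l)) \<Longrightarrow> embed k n l g \<in> carrier (GL_prod k n)"
  unfolding embed_def by (rule GL_prodI) (auto simp: carrier_GL)

lemma group_GL_prod: "Group.group (GL_prod k n)"
  by (rule product_group) (rule group_GL)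

lemma rep_carrier:
  "\<pi> \<in> hom (GL_prod k n) (GL m) \<Longrightarrow> g \<in> carrier (GL_prod k n) \<Longrightarrow> \<pi> g \<in> carrier_mat m m"
  using hom_in_carrier[of \<pi> "GL_prod k n" "GL m" g] by (simp add: carrier_GL)

lemma rep_mult:
  assumes "\<pi> \<in> hom (GL_prod k n) (GL m)" "g \<in> carrier (GL_prod k n)" "h \<in> carrier (GL_prod k n)"
  shows "\<pi> (\<lambda>l\<in>{..<k}. g l * h l) = \<pi> g * \<pi> h"
  using hom_mult[OF assms] by (simp add: GL_def)

lemma rep_one:
  assumes "\<pi> \<in> hom (GL_prod k n) (GL m)"
  shows "\<pi> (\<lambda>l\<in>{..<k}. 1\<^sub>m (n l)) = 1\<^sub>m m"
  using hom_one[OF assms group_GL_prod group_GL] by (simp add: GL_def)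

lemma mpoly_eval_homogeneous:
  fixes p :: "('x, 'a::comm_semiring_1) mpoly"
  assumes "\<And>t. t \<in> keys p \<Longrightarrow> monomial_degree t = e"
  shows "mpoly_eval (\<lambda>x. c * f x) p = c ^ e * mpoly_eval f p"
proof -
  have "monom_eval (\<lambda>x. c * f x) t = c ^ monomial_degree t * monom_eval f t" for t
    by (simp add: monom_eval_def power_mult_distrib prod.distrib monomial_degree_def power_sum)
  then show ?thesis
    unfolding mpoly_eval_monom_eval sum_distrib_left
    using assms by (intro sum.cong) (auto simp: mult_ac)
qed

text \<open>A monomial of degree \<open>e\<close> is a product of \<open>e\<close> variables.\<close>

lemma card_monomials_le:
  assumes "finite W"
  shows "finite {t :: 'x monomial. keys t \<subseteq> W \<and> monomial_degree t = e} \<and>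
    card {t :: 'x monomial. keys t \<subseteq> W \<and> monomial_degree t = e} \<le> card W ^ e"
proof (induction e)
  case 0
  have "{t :: 'x monomial. keys t \<subseteq> W \<and> monomial_degree t = 0} \<subseteq> {0}"
  proof
    fix t :: "'x monomial" assume "t \<in> {t. keys t \<subseteq> W \<and> monomial_degree t = 0}"
    then have "\<forall>x\<in>keys t. lookup t x = 0"
      by (simp add: monomial_degree_def)
    then have "keys t = {}"
      by (metis in_keys_iff ex_in_conv)
    then show "t \<in> {0}" by (simp add: keys_empty_iff)
  qed
  from finite_subset[OF this] card_mono[OF _ this] show ?case by simp
next
  case (Suc e)
  let ?M = "\<lambda>e. {t :: 'x monomial. keys t \<subseteq> W \<and> monomial_degree t = e}"
  have "?M (Suc e) \<subseteq> (\<lambda>(x, t). single x 1 + t) ` (W \<times> ?M e)"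
  proof
    fix t assume t: "t \<in> ?M (Suc e)"
    then have "keys t \<noteq> {}"
      by (auto simp: monomial_degree_def)
    then obtain x where x: "x \<in> keys t" by blast
    let ?s = "t - single x 1"
    have eq: "t = single x 1 + ?s"
      using x by (intro poly_mapping_eqI) (auto simp: lookup_add lookup_minus lookup_single when_def in_keys_iff)
    have "monomial_degree u = weight (\<lambda>_. 1) u" for u :: "'x monomial"
      by (simp add: monomial_degree_def weight_def)
    then have "monomial_degree t = Suc (monomial_degree ?s)"
      using weight_add[of "\<lambda>_. 1" "single x 1" ?s] eq by simp
    moreover have "keys ?s \<subseteq> keys t"
      by (auto simp: in_keys_iff lookup_minus)
    ultimately show "t \<in> (\<lambda>(x, t). single x 1 + t) ` (W \<times> ?M e)"
      using t x eq by (intro image_eqI[of _ _ "(x, ?s)"]) auto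
  qed
  note sub = this
  have fin: "finite (W \<times> ?M e)"
    using Suc assms by auto
  have "finite (?M (Suc e))"
    by (rule finite_subset[OF sub finite_imageI[OF fin]])
  moreover have "card (?M (Suc e)) \<le> card ((\<lambda>(x, t). single x 1 + t) ` (W \<times> ?M e))"
    by (rule card_mono[OF finite_imageI[OF fin] sub])
  moreover have "card ((\<lambda>(x, t). single x 1 + t) ` (W \<times> ?M e)) \<le> card (W \<times> ?M e)"
    by (rule card_image_le[OF fin])
  moreover have "card (W \<times> ?M e) \<le> card W * card W ^ e"
    using Suc by (simp add: card_cartesian_product)
  ultimately show ?case by simp
qed

text \<open>What is used of the representation: for each factor, \<open>N\<close> times every matrix entry is a homogeneous integer
polynomial \<open>q l i j\<close> with bounded coefficients and degree, and scalar matrices act diagonally, with exponent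
\<open>e l i\<close> on the \<open>i\<close>-th coordinate.\<close>

locale rep_polys =
  fixes k :: nat and n :: "nat \<Rightarrow> nat" and m d R :: nat
    and \<pi> :: "(nat \<Rightarrow> complex mat) \<Rightarrow> complex mat"
    and N :: nat and q :: "nat \<Rightarrow> nat \<Rightarrow> nat \<Rightarrow> (nat \<times> nat, complex) mpoly" and e :: "nat \<Rightarrow> nat \<Rightarrow> nat"
  assumes hom: "\<pi> \<in> hom (GL_prod k n) (GL m)"
    and N: "0 < N" "N \<le> R"
    and q_vars: "\<And>l i j. l < k \<Longrightarrow> i < m \<Longrightarrow> j < m \<Longrightarrow> mpoly_vars (q l i j) \<subseteq> {..<n l} \<times> {..<n l}"
    and q_Ints: "\<And>l i j. l < k \<Longrightarrow> i < m \<Longrightarrow> j < m \<Longrightarrow> q l i j \<in> coeffs_in \<int>"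
    and q_bound: "\<And>l i j t. l < k \<Longrightarrow> i < m \<Longrightarrow> j < m \<Longrightarrow> cmod (lookup (q l i j) t) \<le> real R"
    and q_degree: "\<And>l i j t. l < k \<Longrightarrow> i < m \<Longrightarrow> j < m \<Longrightarrow> t \<in> keys (q l i j) \<Longrightarrow> monomial_degree t \<le> d"
    and q_homogeneous: "\<And>l i j t u. l < k \<Longrightarrow> i < m \<Longrightarrow> j < m \<Longrightarrow>
      t \<in> keys (q l i j) \<Longrightarrow> u \<in> keys (q l i j) \<Longrightarrow> monomial_degree t = monomial_degree u"
    and q_eval: "\<And>l i j g. l < k \<Longrightarrow> i < m \<Longrightarrow> j < m \<Longrightarrow> g \<in> carrier (GL (n l)) \<Longrightarrow>
      of_nat N * factor_rep k n \<pi> l g $$ (i, j) = mpoly_eval (\<lambda>x. g $$ x) (q l i j)"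
    and scalar: "\<And>l i j c. l < k \<Longrightarrow> i < m \<Longrightarrow> j < m \<Longrightarrow> c \<noteq> 0 \<Longrightarrow>
      factor_rep k n \<pi> l (c \<cdot>\<^sub>m 1\<^sub>m (n l)) $$ (i, j) = (if i = j then c ^ e l i else 0)"

text \<open>Entries outside the diagonal blocks are zero. Inside a block, the integral, the homogeneous and the
degree-bounded polynomials describe the same function on the group, hence agree up to the factor \<open>N\<close>.\<close>

lemma admissible_rep_polys:
  assumes "admissible_rep k n m d R \<pi>"
  shows "\<exists>N q e. rep_polys k n m d R \<pi> N q e"
proof -
  let ?\<rho> = "factor_rep k n \<pi>"
  have hom: "\<pi> \<in> hom (GL_prod k n) (GL m)"
    using assms by (simp add: admissible_rep_def polynomial_rep_prod_def)
  obtain s S N where split: "\<And>l. l < k \<Longrightarrow> coordinate_splitting (n l) m (?\<rho> l) (s l) (S l)"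
    and homog: "\<And>l r. l < k \<Longrightarrow> r < s l \<Longrightarrow> homogeneous_polynomial_rep (n l) (card (S l r)) (block_rep (?\<rho> l) (S l r))"
    and N: "0 < N" "N \<le> R"
    and integral: "\<And>l r. l < k \<Longrightarrow> r < s l \<Longrightarrow> integral_entries (n l) (card (S l r)) N R (block_rep (?\<rho> l) (S l r))"
    using assms unfolding admissible_rep_def by blast
  have deg: "polynomial_rep_deg_le (n l) m d (?\<rho> l)" if "l < k" for l
    using assms that by (simp add: admissible_rep_def)
  have \<rho>_carrier: "?\<rho> l g \<in> carrier_mat m m" if "g \<in> carrier (GL (n l))" for l g
    unfolding factor_rep_embed by (rule rep_carrier[OF hom embed_GL]) (rule that)
  have one: "1\<^sub>m (n l) \<in> carrier (GL (n l))" for l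
    by (simp add: carrier_GL)
  have \<rho>_one: "?\<rho> l (1\<^sub>m (n l)) = 1\<^sub>m m" for l
  proof -
    have "embed k n l (1\<^sub>m (n l)) = (\<lambda>l\<in>{..<k}. 1\<^sub>m (n l))"
      by (auto simp: embed_def)
    then show ?thesis by (simp add: factor_rep_embed rep_one[OF hom])
  qed
  have block: "\<exists>r<s l. i \<in> S l r" if "l < k" "i < m" for l i
    using split[OF that(1)] that(2) unfolding coordinate_splitting_def by auto
  have off: "?\<rho> l g $$ (i, j) = 0"
    if "l < k" "r < s l" "r' < s l" "r \<noteq> r'" "i \<in> S l r" "j \<in> S l r'" "g \<in> carrier (GL (n l))" for l r r' i j g
    using split[OF that(1)] that unfolding coordinate_splitting_def by blast
  have sub: "S l r \<subseteq> {..<m}" if "l < k" "r < s l" for l r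
    using split[OF that(1)] that(2) unfolding coordinate_splitting_def by auto
  define pos where "pos T i = card {a \<in> T. a < i}" for T and i :: nat
  have pos: "pos (S l r) i < card (S l r)" if "l < k" "r < s l" "i \<in> S l r" for l r i
    unfolding pos_def using that finite_subset[OF sub[OF that(1,2)]] by (intro psubset_card_mono) auto
  have block_entry: "block_rep (?\<rho> l) (S l r) g $$ (pos (S l r) i, pos (S l r) j) = ?\<rho> l g $$ (i, j)"
    "dim_row (block_rep (?\<rho> l) (S l r) g) = card (S l r)" "dim_col (block_rep (?\<rho> l) (S l r) g) = card (S l r)"
    if "l < k" "r < s l" "i \<in> S l r" "j \<in> S l r" "g \<in> carrier (GL (n l))" for l r i j g
  proof -
    have "{i. i < m \<and> i \<in> S l r} = S l r" using sub[OF that(1,2)] by auto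
    then show "dim_row (block_rep (?\<rho> l) (S l r) g) = card (S l r)"
      "dim_col (block_rep (?\<rho> l) (S l r) g) = card (S l r)"
      using \<rho>_carrier[OF that(5)] by (auto simp: block_rep_def dim_submatrix)
    have "i < m" "j < m" using sub[OF that(1,2)] that(3,4) by auto
    then show "block_rep (?\<rho> l) (S l r) g $$ (pos (S l r) i, pos (S l r) j) = ?\<rho> l g $$ (i, j)"
      using \<rho>_carrier[OF that(5)] that(3,4) unfolding block_rep_def pos_def
      by (intro submatrix_index_card) auto
  qed
  have "\<exists>p. l < k \<longrightarrow> i < m \<longrightarrow> j < m \<longrightarrow>
      mpoly_vars p \<subseteq> {..<n l} \<times> {..<n l} \<and> p \<in> coeffs_in \<int> \<and> (\<forall>t. cmod (lookup p t) \<le> real R) \<and>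
      (\<forall>t\<in>keys p. monomial_degree t \<le> d) \<and>
      (\<forall>t\<in>keys p. \<forall>u\<in>keys p. monomial_degree t = monomial_degree u) \<and>
      (\<forall>g\<in>carrier (GL (n l)). of_nat N * ?\<rho> l g $$ (i, j) = mpoly_eval (\<lambda>x. g $$ x) p)" for l i j
  proof (cases "l < k \<and> i < m \<and> j < m")
    case True
    then have lij: "l < k" "i < m" "j < m" by auto
    obtain r r' where r: "r < s l" "i \<in> S l r" "r' < s l" "j \<in> S l r'"
      using block lij by blast
    have "\<exists>p. mpoly_vars p \<subseteq> {..<n l} \<times> {..<n l} \<and> p \<in> coeffs_in \<int> \<and> (\<forall>t. cmod (lookup p t) \<le> real R) \<and>
      (\<forall>t\<in>keys p. \<forall>u\<in>keys p. monomial_degree t = monomial_degree u) \<and>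
      (\<forall>g\<in>carrier (GL (n l)). of_nat N * ?\<rho> l g $$ (i, j) = mpoly_eval (\<lambda>x. g $$ x) p)"
    proof (cases "r = r'")
      case True
      have j: "j \<in> S l r" using r True by simp
      obtain p where p: "mpoly_vars p \<subseteq> {..<n l} \<times> {..<n l}"
        "\<And>t. lookup p t \<in> \<int> \<and> cmod (lookup p t) \<le> real R"
        "\<And>g. g \<in> carrier (GL (n l)) \<Longrightarrow> (of_nat N \<cdot>\<^sub>m block_rep (?\<rho> l) (S l r) g) $$ (pos (S l r) i, pos (S l r) j) =
            mpoly_eval (\<lambda>x. g $$ x) p"
        using integral[OF lij(1) r(1)] pos[OF lij(1) r(1,2)] pos[OF lij(1) r(1) j]
        unfolding integral_entries_def by blast
      have "of_nat N * ?\<rho> l g $$ (i, j) = mpoly_eval (\<lambda>x. g $$ x) p" if g: "g \<in> carrier (GL (n l))" for g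
        using p(3)[OF g] block_entry[OF lij(1) r(1,2) j g] pos[OF lij(1) r(1,2)] pos[OF lij(1) r(1) j]
        by simp
      moreover have "\<forall>t\<in>keys p. \<forall>u\<in>keys p. monomial_degree t = monomial_degree u"
      proof -
        from homog[OF lij(1) r(1)] obtain e where e: "\<forall>a<card (S l r). \<forall>b<card (S l r). \<exists>p.
            mpoly_vars p \<subseteq> {..<n l} \<times> {..<n l} \<and> (\<forall>t\<in>keys p. monomial_degree t = e) \<and>
            (\<forall>g\<in>carrier (GL (n l)). block_rep (?\<rho> l) (S l r) g $$ (a, b) = mpoly_eval (\<lambda>x. g $$ x) p)"
          unfolding homogeneous_polynomial_rep_def by (elim conjE exE)
        from e[rule_format, OF pos[OF lij(1) r(1,2)] pos[OF lij(1) r(1) j]]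
        obtain p' where p': "mpoly_vars p' \<subseteq> {..<n l} \<times> {..<n l}" "\<And>t. t \<in> keys p' \<Longrightarrow> monomial_degree t = e"
          "\<And>g. g \<in> carrier (GL (n l)) \<Longrightarrow> block_rep (?\<rho> l) (S l r) g $$ (pos (S l r) i, pos (S l r) j) = mpoly_eval (\<lambda>x. g $$ x) p'"
          by blast
        have "p = single 0 (of_nat N) * p'"
        proof (rule eq_on_GL[OF p(1) order.trans[OF mpoly_vars_const_mult p'(1)]])
          fix g assume g: "g \<in> carrier (GL (n l))"
          show "mpoly_eval (\<lambda>x. g $$ x) p = mpoly_eval (\<lambda>x. g $$ x) (single 0 (of_nat N) * p')"
            using calculation[OF g] p'(3)[OF g] block_entry(1)[OF lij(1) r(1,2) j g]
            by (simp add: mpoly_eval_const_mult)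
        qed
        then have "keys p \<subseteq> keys p'"
          by (auto simp: in_keys_iff lookup_const_mult)
        then show ?thesis using p'(2) by (metis subsetD)
      qed
      ultimately show ?thesis using p(1,2) by (auto simp: coeffs_in_def)
    next
      case False
      then show ?thesis
        using off[OF lij(1) r(1,3) False r(2,4)]
        by (intro exI[of _ 0]) (auto simp: coeffs_in_def mpoly_eval_simps(2))
    qed
    then obtain p where p: "mpoly_vars p \<subseteq> {..<n l} \<times> {..<n l}" "p \<in> coeffs_in \<int>" "\<forall>t. cmod (lookup p t) \<le> real R"
      "\<forall>t\<in>keys p. \<forall>u\<in>keys p. monomial_degree t = monomial_degree u"
      "\<And>g. g \<in> carrier (GL (n l)) \<Longrightarrow> of_nat N * ?\<rho> l g $$ (i, j) = mpoly_eval (\<lambda>x. g $$ x) p"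
      by blast
    from deg[OF lij(1)] have "\<forall>i<m. \<forall>j<m. \<exists>p. mpoly_vars p \<subseteq> {..<n l} \<times> {..<n l} \<and>
        (\<forall>t\<in>keys p. monomial_degree t \<le> d) \<and> (\<forall>g\<in>carrier (GL (n l)). ?\<rho> l g $$ (i, j) = mpoly_eval (\<lambda>x. g $$ x) p)"
      unfolding polynomial_rep_deg_le_def by (elim conjE)
    from this[rule_format, OF lij(2,3)]
    obtain p' where p': "mpoly_vars p' \<subseteq> {..<n l} \<times> {..<n l}" "\<forall>t\<in>keys p'. monomial_degree t \<le> d"
      "\<And>g. g \<in> carrier (GL (n l)) \<Longrightarrow> ?\<rho> l g $$ (i, j) = mpoly_eval (\<lambda>x. g $$ x) p'"
      by blast
    have "p = single 0 (of_nat N) * p'"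
      by (rule eq_on_GL[OF p(1) order.trans[OF mpoly_vars_const_mult p'(1)]])
        (simp add: mpoly_eval_const_mult p'(3)[symmetric] p(5)[symmetric])
    then have "keys p \<subseteq> keys p'"
      by (auto simp: in_keys_iff lookup_const_mult)
    then show ?thesis using p p'(2) by blast
  qed auto
  then obtain q where q: "\<And>l i j. l < k \<Longrightarrow> i < m \<Longrightarrow> j < m \<Longrightarrow>
      mpoly_vars (q l i j) \<subseteq> {..<n l} \<times> {..<n l} \<and> q l i j \<in> coeffs_in \<int> \<and> (\<forall>t. cmod (lookup (q l i j) t) \<le> real R) \<and>
      (\<forall>t\<in>keys (q l i j). monomial_degree t \<le> d) \<and>
      (\<forall>t\<in>keys (q l i j). \<forall>u\<in>keys (q l i j). monomial_degree t = monomial_degree u) \<and>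
      (\<forall>g\<in>carrier (GL (n l)). of_nat N * ?\<rho> l g $$ (i, j) = mpoly_eval (\<lambda>x. g $$ x) (q l i j))"
    by metis
  have "\<exists>e. l < k \<longrightarrow> i < m \<longrightarrow> (\<forall>c j. c \<noteq> 0 \<longrightarrow> j < m \<longrightarrow> ?\<rho> l (c \<cdot>\<^sub>m 1\<^sub>m (n l)) $$ (i, j) = (if i = j then c ^ e else 0))" for l i
  proof (cases "l < k \<and> i < m")
    case True
    then have li: "l < k" "i < m" by auto
    obtain r where r: "r < s l" "i \<in> S l r"
      using block li by blast
    from homog[OF li(1) r(1)] obtain e where e: "\<forall>a<card (S l r). \<forall>b<card (S l r). \<exists>p.
        mpoly_vars p \<subseteq> {..<n l} \<times> {..<n l} \<and> (\<forall>t\<in>keys p. monomial_degree t = e) \<and>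
        (\<forall>g\<in>carrier (GL (n l)). block_rep (?\<rho> l) (S l r) g $$ (a, b) = mpoly_eval (\<lambda>x. g $$ x) p)"
      unfolding homogeneous_polynomial_rep_def by (elim conjE exE)
    have "?\<rho> l (c \<cdot>\<^sub>m 1\<^sub>m (n l)) $$ (i, j) = (if i = j then c ^ e else 0)" if c0: "c \<noteq> 0" and jm: "j < m" for c j
    proof -
      have c: "c \<cdot>\<^sub>m 1\<^sub>m (n l) \<in> carrier (GL (n l))"
        using c0 by (simp add: carrier_GL)
      obtain r' where r': "r' < s l" "j \<in> S l r'"
        using block[OF li(1) jm] by blast
      show ?thesis
      proof (cases "r' = r")
        case True
        have j: "j \<in> S l r" using r' True by simp
        from e[rule_format, OF pos[OF li(1) r] pos[OF li(1) r(1) j]]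
        obtain p where p: "\<And>t. t \<in> keys p \<Longrightarrow> monomial_degree t = e"
          "\<And>g. g \<in> carrier (GL (n l)) \<Longrightarrow> block_rep (?\<rho> l) (S l r) g $$ (pos (S l r) i, pos (S l r) j) = mpoly_eval (\<lambda>x. g $$ x) p"
          "mpoly_vars p \<subseteq> {..<n l} \<times> {..<n l}"
          by blast
        have "?\<rho> l (c \<cdot>\<^sub>m 1\<^sub>m (n l)) $$ (i, j) = mpoly_eval (\<lambda>x. (c \<cdot>\<^sub>m 1\<^sub>m (n l)) $$ x) p"
          using p(2)[OF c] block_entry(1)[OF li(1) r j c] by simp
        also have "\<dots> = mpoly_eval (\<lambda>x. c * 1\<^sub>m (n l) $$ x) p"
          using p(3) by (intro mpoly_eval_cong) auto
        also have "\<dots> = c ^ e * mpoly_eval (\<lambda>x. 1\<^sub>m (n l) $$ x) p"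
          by (rule mpoly_eval_homogeneous) (rule p(1))
        also have "mpoly_eval (\<lambda>x. 1\<^sub>m (n l) $$ x) p = ?\<rho> l (1\<^sub>m (n l)) $$ (i, j)"
          using p(2)[OF one] block_entry(1)[OF li(1) r j one] by simp
        finally show ?thesis
          using li jm by (simp add: \<rho>_one)
      next
        case False
        then have "i \<noteq> j"
          using split[OF li(1)] r r' unfolding coordinate_splitting_def disjoint_family_on_def by blast
        then show ?thesis
          using off[OF li(1) r(1) r'(1) _ r(2) r'(2) c] False by simp
      qed
    qed
    then show ?thesis by blast
  qed auto
  then obtain e where e: "\<And>l i c j. l < k \<Longrightarrow> i < m \<Longrightarrow> c \<noteq> 0 \<Longrightarrow> j < m \<Longrightarrow>
      ?\<rho> l (c \<cdot>\<^sub>m 1\<^sub>m (n l)) $$ (i, j) = (if i = j then c ^ e l i else 0)"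
    by metis
  have "rep_polys k n m d R \<pi> N q e"
    using hom N q e by unfold_locales blast+
  then show ?thesis by blast
qed

lemma mpoly_compose_rename:
  fixes p :: "('x, 'a::comm_semiring_1) mpoly"
  shows "mpoly_compose (\<lambda>x. mvar (f x :: 'y)) p =
     (\<Sum>t\<in>keys p. single (\<Sum>x\<in>keys t. single (f x) (lookup t x)) (lookup p t))"
proof -
  have pow: "mvar x ^ r = single (single x r) (1::'a)" for x :: 'y and r
    by (induction r) (auto simp: mvar_def mult_single single_add[symmetric])
  have "monom_eval (\<lambda>x. mvar (f x)) t = single (\<Sum>x\<in>keys t. single (f x) (lookup t x)) (1::'a)" for t
  proof -
    have "finite S \<Longrightarrow> (\<Prod>x\<in>S. mvar (f x) ^ lookup t x) = single (\<Sum>x\<in>S. single (f x) (lookup t x)) (1::'a)" for S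
      by (induction S rule: finite_induct) (auto simp: pow mult_single)
    then show ?thesis by (simp add: monom_eval_def)
  qed
  then show ?thesis
    by (simp add: mpoly_subst_def mult_single)
qed

context rep_polys
begin

definition entry_poly :: "nat \<Rightarrow> nat \<Rightarrow> nat \<Rightarrow> (nat \<times> nat \<times> nat, complex) mpoly" where
  "entry_poly l i j = mpoly_compose (\<lambda>x. mvar (l, x)) (q l i j)"

text \<open>The polynomial matrix of \<open>N\<^sup>l\<close> times the product of the first \<open>l\<close> factor representations.\<close>

primrec partial_rep :: "nat \<Rightarrow> nat \<Rightarrow> nat \<Rightarrow> (nat \<times> nat \<times> nat, complex) mpoly" where
  "partial_rep 0 a b = (if a = b then 1 else 0)"
| "partial_rep (Suc l) a b = (\<Sum>c<m. partial_rep l a c * entry_poly l c b)"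

definition rep_poly :: "nat \<Rightarrow> nat \<Rightarrow> (nat \<times> nat \<times> nat, complex) mpoly" where
  "rep_poly = partial_rep k"

lemma eval_entry_poly: "mpoly_eval X (entry_poly l i j) = mpoly_eval (\<lambda>x. X (l, x)) (q l i j)"
  by (simp add: entry_poly_def mpoly_eval_compose)

lemma keys_entry_poly:
  assumes "t \<in> keys (entry_poly l i j)"
  obtains u where "u \<in> keys (q l i j)" "t = (\<Sum>x\<in>keys u. single (l, x) (lookup u x))"
  using assms keys_sum[of "\<lambda>t. single (\<Sum>x\<in>keys t. single (l, x) (lookup t x)) (lookup (q l i j) t)" "keys (q l i j)"]
  unfolding entry_poly_def mpoly_compose_rename by (auto split: if_splits)

lemma vars_entry_poly: "l < k \<Longrightarrow> i < m \<Longrightarrow> j < m \<Longrightarrow> mpoly_vars (entry_poly l i j) \<subseteq> Vars k n"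
proof
  fix x assume l: "l < k" "i < m" "j < m" and "x \<in> mpoly_vars (entry_poly l i j)"
  then obtain t where t: "t \<in> keys (entry_poly l i j)" "x \<in> keys t"
    by (auto simp: mpoly_vars_def)
  obtain u where u: "u \<in> keys (q l i j)" "t = (\<Sum>x\<in>keys u. single (l, x) (lookup u x))"
    by (rule keys_entry_poly[OF t(1)])
  have "x \<in> keys (\<Sum>x\<in>keys u. single (l, x) (lookup u x))"
    using t u by simp
  then obtain y where "y \<in> keys u" "x = (l, y)"
    using keys_sum[of "\<lambda>x. single (l, x) (lookup u x)" "keys u"] by (auto split: if_splits)
  then have "x \<in> (\<lambda>y. (l, y)) ` mpoly_vars (q l i j)"
    using u by (auto simp: mpoly_vars_def)
  then show "x \<in> Vars k n"
    using q_vars[OF l] l by (auto simp: Vars_def)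
qed

lemma entry_poly_Ints: "l < k \<Longrightarrow> i < m \<Longrightarrow> j < m \<Longrightarrow> entry_poly l i j \<in> coeffs_in \<int>"
  unfolding entry_poly_def mpoly_compose_rename
  using q_Ints[of l i j]
  by (intro subsemiring_sum subsemiring_coeffs_in subsemiring_Ints coeffs_in_single) (auto simp: coeffs_in_def)

lemma partial_rep_Ints: "l \<le> k \<Longrightarrow> a < m \<Longrightarrow> b < m \<Longrightarrow> partial_rep l a b \<in> coeffs_in \<int>"
proof (induction l arbitrary: b)
  case 0
  then show ?case
    using subsemiringD(1,2)[OF subsemiring_coeffs_in[OF subsemiring_Ints]] by auto
next
  case (Suc l)
  then show ?case
    using entry_poly_Ints
    by (auto intro!: subsemiring_sum subsemiringD(4) subsemiring_coeffs_in subsemiring_Ints)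
qed

lemma partial_rep_vars: "l \<le> k \<Longrightarrow> a < m \<Longrightarrow> b < m \<Longrightarrow> mpoly_vars (partial_rep l a b) \<subseteq> Vars k n"
proof (induction l arbitrary: b)
  case (Suc l)
  have "mpoly_vars (partial_rep l a c * entry_poly l c b) \<subseteq> Vars k n" if "c < m" for c
    using mpoly_vars_mult[of "partial_rep l a c" "entry_poly l c b"] Suc.IH[of c] vars_entry_poly[of l c b] Suc.prems that
    by auto
  then show ?case by (auto intro!: mpoly_vars_sum)
qed auto

lemma eval_partial_rep:
  assumes g: "g \<in> carrier (GL_prod k n)"
  shows "l \<le> k \<Longrightarrow> a < m \<Longrightarrow> b < m \<Longrightarrow>
    mpoly_eval (entries g) (partial_rep l a b) =
      of_nat N ^ l * \<pi> (\<lambda>i\<in>{..<k}. if i < l then g i else 1\<^sub>m (n i)) $$ (a, b)"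
proof (induction l arbitrary: b)
  case 0
  then show ?case
    using rep_one[OF hom] by (simp add: restrict_def mpoly_eval_simps(2,4))
next
  case (Suc l)
  let ?g = "\<lambda>l. \<lambda>i\<in>{..<k}. if i < l then g i else 1\<^sub>m (n i)"
  have gl: "g l \<in> carrier (GL (n l))"
    using GL_prodD[OF g, of l] Suc.prems by (simp add: carrier_GL)
  have c1: "?g l \<in> carrier (GL_prod k n)"
    by (rule GL_prodI) (auto simp: GL_prodD[OF g])
  have c2: "embed k n l (g l) \<in> carrier (GL_prod k n)"
    by (rule embed_GL) (rule gl)
  have "?g (Suc l) = (\<lambda>i\<in>{..<k}. ?g l i * embed k n l (g l) i)"
  proof
    fix i
    show "?g (Suc l) i = (\<lambda>i\<in>{..<k}. ?g l i * embed k n l (g l) i) i"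
      using GL_prodD(1)[OF g, of i] by (auto simp: embed_def less_Suc_eq)
  qed
  then have "\<pi> (?g (Suc l)) = \<pi> (?g l) * factor_rep k n \<pi> l (g l)"
    by (simp only: rep_mult[OF hom c1 c2] factor_rep_embed)
  moreover have "\<pi> (?g l) \<in> carrier_mat m m" "factor_rep k n \<pi> l (g l) \<in> carrier_mat m m"
    unfolding factor_rep_embed by (rule rep_carrier[OF hom c1], rule rep_carrier[OF hom c2])
  ultimately have "\<pi> (?g (Suc l)) $$ (a, b) = (\<Sum>c<m. \<pi> (?g l) $$ (a, c) * factor_rep k n \<pi> l (g l) $$ (c, b))"
    using Suc.prems by (simp add: scalar_prod_def lessThan_atLeast0)
  then have "of_nat N ^ Suc l * \<pi> (?g (Suc l)) $$ (a, b) =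
      (\<Sum>c<m. (of_nat N ^ l * \<pi> (?g l) $$ (a, c)) * (of_nat N * factor_rep k n \<pi> l (g l) $$ (c, b)))"
    by (simp add: sum_distrib_left mult_ac)
  also have "\<dots> = (\<Sum>c<m. mpoly_eval (entries g) (partial_rep l a c) * mpoly_eval (entries g) (entry_poly l c b))"
  proof (intro sum.cong refl)
    fix c assume c: "c \<in> {..<m}"
    have 1: "mpoly_eval (entries g) (partial_rep l a c) = of_nat N ^ l * \<pi> (?g l) $$ (a, c)"
      by (rule Suc.IH) (use Suc.prems c in auto)
    have 2: "mpoly_eval (entries g) (entry_poly l c b) = of_nat N * factor_rep k n \<pi> l (g l) $$ (c, b)"
      using q_eval[of l c b "g l"] Suc.prems c gl by (simp add: eval_entry_poly entries_def)
    show "(of_nat N ^ l * \<pi> (?g l) $$ (a, c)) * (of_nat N * factor_rep k n \<pi> l (g l) $$ (c, b)) =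
        mpoly_eval (entries g) (partial_rep l a c) * mpoly_eval (entries g) (entry_poly l c b)"
      by (simp only: 1 2)
  qed
  also have "\<dots> = mpoly_eval (entries g) (partial_rep (Suc l) a b)"
    by (simp add: mpoly_eval_simps(5,7))
  finally show ?case ..
qed

lemma eval_rep_poly:
  assumes g: "g \<in> carrier (GL_prod k n)" and "a < m" "b < m"
  shows "mpoly_eval (entries g) (rep_poly a b) = of_nat N ^ k * \<pi> g $$ (a, b)"
proof -
  have "(\<lambda>i\<in>{..<k}. if i < k then g i else 1\<^sub>m (n i)) = g"
    using g by (auto simp: PiE_iff extensional_def)
  then show ?thesis
    using eval_partial_rep[OF g order.refl assms(2,3)] by (simp add: rep_poly_def)
qed

lemma rep_poly_Ints: "a < m \<Longrightarrow> b < m \<Longrightarrow> rep_poly a b \<in> coeffs_in \<int>"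
  and rep_poly_vars: "a < m \<Longrightarrow> b < m \<Longrightarrow> mpoly_vars (rep_poly a b) \<subseteq> Vars k n"
  by (simp_all add: rep_poly_def partial_rep_Ints partial_rep_vars)

lemma coeff_norm_entry_poly:
  assumes "l < k" "i < m" "j < m" and n: "1 \<le> n l"
  shows "coeff_norm (entry_poly l i j) \<le> real R * real (n l) ^ (2 * d)"
proof -
  have "coeff_norm (entry_poly l i j) \<le> (\<Sum>t\<in>keys (q l i j). cmod (lookup (q l i j) t))"
    unfolding entry_poly_def mpoly_compose_rename
    by (rule order.trans[OF coeff_norm_sum]) simp
  also have "\<dots> \<le> of_nat (card (keys (q l i j))) * real R"
    using q_bound[OF assms(1-3)] by (intro sum_bounded_above)
  also have "\<dots> \<le> real (n l) ^ (2 * d) * real R"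
  proof (cases "keys (q l i j) = {}")
    case False
    then obtain u where u: "u \<in> keys (q l i j)" by blast
    let ?W = "{..<n l} \<times> {..<n l}"
    let ?M = "{t. keys t \<subseteq> ?W \<and> monomial_degree t = monomial_degree u}"
    have "keys (q l i j) \<subseteq> ?M"
      using q_homogeneous[OF assms(1-3) _ u] q_vars[OF assms(1-3)] by (auto simp: mpoly_vars_def)
    then have "card (keys (q l i j)) \<le> card ?W ^ monomial_degree u"
      using card_monomials_le[of ?W "monomial_degree u"] card_mono[of ?M "keys (q l i j)"] by force
    also have "\<dots> \<le> card ?W ^ d"
      using n q_degree[OF assms(1-3) u] by (intro power_increasing) auto
    also have "\<dots> = n l ^ (2 * d)"
      by (simp add: card_cartesian_product power_mult power2_eq_square)
    finally have "real (card (keys (q l i j))) \<le> real (n l) ^ (2 * d)"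
      by (metis of_nat_le_iff of_nat_power)
    then show ?thesis by (intro mult_right_mono) auto
  qed simp
  finally show ?thesis by (simp add: mult.commute)
qed

lemma weight_entry_poly:
  assumes "l' < k" "i < m" "j < m"
  shows "wt_in (\<lambda>x. if fst x = l then 1 else 0) {..if l = l' then d else 0} (entry_poly l' i j)"
  unfolding wt_in_def
proof
  fix t assume "t \<in> keys (entry_poly l' i j)"
  then obtain u where u: "u \<in> keys (q l' i j)" "t = (\<Sum>x\<in>keys u. single (l', x) (lookup u x))"
    by (rule keys_entry_poly)
  have "weight c (\<Sum>x\<in>A. f x) = (\<Sum>x\<in>A. weight c (f x))" for c and f :: "nat \<times> nat \<Rightarrow> (nat \<times> nat \<times> nat) monomial" and A
    by (induction A rule: infinite_finite_induct) (auto simp: weight_add)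
  then have "weight (\<lambda>x. if fst x = l then 1 else 0) t = (if l = l' then monomial_degree u else 0)"
    by (simp add: u(2) monomial_degree_def)
  then show "weight (\<lambda>x. if fst x = l then 1 else 0) t \<in> {..if l = l' then d else 0}"
    using q_degree[OF assms u(1)] by auto
qed

lemma weight_partial_rep:
  assumes "a < m"
  shows "l' \<le> k \<Longrightarrow> b < m \<Longrightarrow> wt_in (\<lambda>x. if fst x = l then 1 else 0) {..if l < l' then d else 0} (partial_rep l' a b)"
proof (induction l' arbitrary: b)
  case 0
  then show ?case by (auto simp: wt_in_def)
next
  case (Suc l')
  have "wt_in (\<lambda>x. if fst x = l then 1 else 0) {..if l < Suc l' then d else 0} (partial_rep l' a c * entry_poly l' c b)"
    if "c < m" for c
    by (rule wt_in_mult[OF Suc.IH weight_entry_poly]) (use Suc.prems that in \<open>auto split: if_splits\<close>)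
  then show ?case by (auto intro!: wt_in_sum)
qed

lemma coeff_norm_partial_rep:
  assumes "\<And>l. l < k \<Longrightarrow> 1 \<le> n l \<and> n l \<le> n0" "a < m"
  shows "l \<le> k \<Longrightarrow> (\<Sum>b<m. coeff_norm (partial_rep l a b)) \<le> (real m * real R * real n0 ^ (2 * d)) ^ l"
proof (induction l)
  case 0
  have "(\<Sum>b<m. coeff_norm (if a = b then 1 else 0 :: (nat \<times> nat \<times> nat, complex) mpoly)) = (\<Sum>b<m. if a = b then 1 else 0)"
    by (intro sum.cong) auto
  then show ?case using assms(2) by simp
next
  case (Suc l)
  let ?B = "real R * real n0 ^ (2 * d)"
  have q: "coeff_norm (entry_poly l c b) \<le> ?B" if "c < m" "b < m" for b c
  proof -
    have "real (n l) ^ (2 * d) \<le> real n0 ^ (2 * d)"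
      using assms(1)[of l] Suc.prems by (intro power_mono) auto
    then show ?thesis
      using coeff_norm_entry_poly[of l c b] assms(1)[of l] Suc.prems that
      by (meson Suc_le_lessD mult_left_mono of_nat_0_le_iff order.trans)
  qed
  have "(\<Sum>b<m. coeff_norm (partial_rep (Suc l) a b)) \<le> (\<Sum>b<m. \<Sum>c<m. coeff_norm (partial_rep l a c) * ?B)"
  proof (rule sum_mono)
    fix b assume b: "b \<in> {..<m}"
    show "coeff_norm (partial_rep (Suc l) a b) \<le> (\<Sum>c<m. coeff_norm (partial_rep l a c) * ?B)"
      unfolding partial_rep.simps
      by (rule order.trans[OF coeff_norm_sum], rule sum_mono, rule order.trans[OF coeff_norm_mult],
          rule mult_left_mono) (use q b in \<open>auto simp: coeff_norm_nonneg\<close>)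
  qed
  also have "\<dots> = real m * ?B * (\<Sum>c<m. coeff_norm (partial_rep l a c))"
    by (simp add: sum_distrib_left sum_distrib_right mult_ac)
  also have "\<dots> \<le> real m * ?B * (real m * real R * real n0 ^ (2 * d)) ^ l"
    using Suc by (intro mult_left_mono) auto
  finally show ?case by (simp add: mult_ac)
qed

end

section \<open>Invariants and the norm on an orbit\<close>

lemma norm2_sq: "x \<in> carrier_vec m \<Longrightarrow> Re (x \<bullet>c x) = (\<Sum>i<m. (cmod (x $ i))\<^sup>2)"
  by (simp add: scalar_prod_def lessThan_atLeast0 complex_mult_cnj cmod_power2)

lemma norm_component_le:
  assumes "x \<in> carrier_vec m" "i < m"
  shows "cmod (x $ i) \<le> norm2 x"
  unfolding ip_norm_def norm2_sq[OF assms(1)]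
  by (rule real_le_rsqrt) (use assms(2) in \<open>auto intro!: member_le_sum\<close>)

lemma norm2_nonneg: "x \<in> carrier_vec m \<Longrightarrow> 0 \<le> norm2 x"
  by (simp add: ip_norm_def norm2_sq sum_nonneg)

lemma subsemiring_gaussian: "subsemiring gaussian_integers"
  by (auto simp: subsemiring_def gaussian_integers_def)

lemma Ints_gaussian: "z \<in> \<int> \<Longrightarrow> z \<in> gaussian_integers"
  by (auto simp: gaussian_integers_def elim!: Ints_cases)

lemma gaussian_norm_ge_1:
  assumes "z \<in> gaussian_integers" "z \<noteq> 0"
  shows "1 \<le> cmod z"
proof -
  obtain a b where ab: "Re z = of_int a" "Im z = of_int b"
    using assms(1) by (auto simp: gaussian_integers_def elim!: Ints_cases)
  then have "a \<noteq> 0 \<or> b \<noteq> 0"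
    using assms(2) by (auto simp: complex_eq_iff)
  then have "1 \<le> \<bar>Re z\<bar> \<or> 1 \<le> \<bar>Im z\<bar>"
    unfolding ab by (auto simp flip: of_int_abs)
  then show ?thesis
    using abs_Re_le_cmod[of z] abs_Im_le_cmod[of z] by linarith
qed

lemma wt_in_det_mpoly:
  assumes "\<And>p. p permutes {0..<n} \<Longrightarrow> (\<Sum>i = 0..<n. c (f (i, p i))) = r"
  shows "wt_in c {r} (det_mpoly n f)"
  unfolding det_mpoly_def
proof (rule wt_in_sum)
  fix p assume p: "p \<in> {p. p permutes {0..<n}}"
  have "wt_in c {c x} (mvar x :: (_, complex) mpoly)" for x
    by (simp add: wt_in_def mvar_def)
  then have "wt_in c {\<Sum>i = 0..<n. c (f (i, p i))} (\<Prod>i = 0..<n. mvar (f (i, p i)) :: (_, complex) mpoly)"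
    by (intro wt_in_prod_eq) auto
  then have "wt_in c {r} (\<Prod>i = 0..<n. mvar (f (i, p i)) :: (_, complex) mpoly)"
    using assms p by simp
  moreover have "wt_in c {0} (single 0 (signof p) :: (_, complex) mpoly)"
    by (rule wt_in_single) simp
  ultimately show "wt_in c {r} (single 0 (signof p) * (\<Prod>i = 0..<n. mvar (f (i, p i)) :: (_, complex) mpoly))"
    by (intro wt_in_mult[of c "{0}" _ "{r}"]) auto
qed

lemma weight_Delta_pow:
  assumes "l < k" and "\<And>l'. l' < k \<Longrightarrow> wt_in c {if l' = l then r else 0} (Delta n l')" and "t \<in> keys (Delta_pow k n M)"
  shows "weight c t = M l * r"
proof -
  have "wt_in c {\<Sum>l'<k. M l' * (if l' = l then r else 0)} (Delta_pow k n M)"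
    unfolding Delta_pow_def using assms(2) by (intro wt_in_prod_eq wt_in_power_eq) auto
  moreover have "(\<Sum>l'<k. M l' * (if l' = l then r else 0)) = M l * r"
    using assms(1) by (simp add: if_distrib cong: if_cong)
  ultimately show ?thesis using assms(3) by (auto simp: wt_in_def)
qed

lemma row_sum_Delta_pow:
  assumes t: "t \<in> keys (Delta_pow k n M)" and l: "l < k" "i < n l"
  shows "(\<Sum>j<n l. lookup t (l, i, j)) = M l"
proof -
  define c where "c = (\<lambda>x :: nat \<times> nat \<times> nat. if fst x = l \<and> fst (snd x) = i then 1 else 0 :: nat)"
  have "wt_in c {if l' = l then 1 else 0} (Delta n l')" if "l' < k" for l'
    unfolding Delta_def using l(2) by (intro wt_in_det_mpoly) (auto simp: c_def)
  then have "weight c t = M l"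
    using weight_Delta_pow[OF l(1) _ t, of c 1] by simp
  moreover have "keys t \<subseteq> Vars k n"
    using vars_Delta_pow[of k n M] t by (auto simp: mpoly_vars_def)
  then have "weight c t = (\<Sum>x\<in>Vars k n. c x * lookup t x)"
    by (rule weight_superset[OF finite_Vars])
  also have "\<dots> = (\<Sum>x\<in>(\<lambda>j. (l, i, j)) ` {..<n l}. lookup t x)"
    by (rule sum.mono_neutral_cong_right) (use l in \<open>auto simp: c_def Vars_def\<close>)
  also have "\<dots> = (\<Sum>j<n l. lookup t (l, i, j))"
    by (subst sum.reindex) (auto simp: inj_on_def)
  finally show ?thesis by simp
qed

lemma degree_Delta_pow:
  assumes t: "t \<in> keys (Delta_pow k n M)" and l: "l < k"
  shows "weight (\<lambda>x. if fst x = l then 1 else 0) t = M l * n l"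
proof (rule weight_Delta_pow[OF l _ t])
  fix l' assume "l' < k"
  show "wt_in (\<lambda>x. if fst x = l then 1 else 0) {if l' = l then n l else 0} (Delta n l')"
    unfolding Delta_def by (rule wt_in_det_mpoly) auto
qed

lemma monomial_fact_Vars:
  assumes "keys t \<subseteq> Vars k n"
  shows "monomial_fact t = (\<Prod>l<k. \<Prod>i<n l. \<Prod>j<n l. fact (lookup t (l, i, j)))"
proof -
  have "monomial_fact t = (\<Prod>x\<in>Vars k n. fact (lookup t x))"
    by (rule monomial_fact_superset[OF finite_Vars assms])
  also have "\<dots> = (\<Prod>l<k. \<Prod>ij\<in>{..<n l} \<times> {..<n l}. fact (lookup t (l, ij)))"
    unfolding Vars_def by (subst prod.Sigma) auto
  also have "\<dots> = (\<Prod>l<k. \<Prod>i<n l. \<Prod>j<n l. fact (lookup t (l, i, j)))"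
    by (intro prod.cong refl) (subst prod.cartesian_product, auto intro!: prod.cong)
  finally show ?thesis .
qed

text \<open>The multifactorial of a monomial of \<open>\<Delta>\<^sup>M\<close> divides this product, and becomes a multiple of it after
multiplication by \<open>denom\<close>.\<close>

definition fact_bound :: "nat \<Rightarrow> (nat \<Rightarrow> nat) \<Rightarrow> (nat \<Rightarrow> nat) \<Rightarrow> nat" where
  "fact_bound k n M = (\<Prod>l<k. fact (M l) ^ n l)"

definition denom :: "nat \<Rightarrow> (nat \<Rightarrow> nat) \<Rightarrow> (nat \<Rightarrow> nat) \<Rightarrow> nat" where
  "denom k n M = (\<Prod>l<k. (lcm_upto (M l) ^ (n l - 1)) ^ n l)"

text \<open>All row sums of the exponent matrices are equal to \<open>M l\<close>.\<close>

lemma monomial_fact_Delta_pow: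
  assumes t: "t \<in> keys (Delta_pow k n M)" and n: "\<And>l. l < k \<Longrightarrow> 1 \<le> n l"
  shows "monomial_fact t \<le> fact_bound k n M" "fact_bound k n M dvd denom k n M * monomial_fact t"
proof -
  have sub: "keys t \<subseteq> Vars k n"
    using vars_Delta_pow[of k n M] t by (auto simp: mpoly_vars_def)
  note row = row_sum_Delta_pow[OF t]
  have "(\<Prod>i<n l. \<Prod>j<n l. fact (lookup t (l, i, j))) \<le> (fact (M l) :: nat) ^ n l" if "l < k" for l
  proof -
    have "(\<Prod>i<n l. \<Prod>j<n l. fact (lookup t (l, i, j))) \<le> (\<Prod>i<n l. fact (M l) :: nat)"
      using prod_fact_le_fact_sum row[OF that] by (intro prod_mono) (metis lessThan_iff zero_le)
    then show ?thesis by simp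
  qed
  then show "monomial_fact t \<le> fact_bound k n M"
    unfolding monomial_fact_Vars[OF sub] fact_bound_def by (intro prod_mono) auto
  have "(fact (M l) :: nat) ^ n l dvd (lcm_upto (M l) ^ (n l - 1)) ^ n l * (\<Prod>i<n l. \<Prod>j<n l. fact (lookup t (l, i, j)))"
    if l: "l < k" for l
  proof -
    have "(fact (M l) :: nat) dvd lcm_upto (M l) ^ (n l - 1) * (\<Prod>j<n l. fact (lookup t (l, i, j)))" if "i < n l" for i
      using fact_dvd_lcm_upto_mult_facts[of "\<lambda>j. lookup t (l, i, j)" "n l - 1" "M l"] row[OF l that] n[OF l] by simp
    then have "(\<Prod>i<n l. fact (M l) :: nat) dvd (\<Prod>i<n l. lcm_upto (M l) ^ (n l - 1) * (\<Prod>j<n l. fact (lookup t (l, i, j))))"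
      by (intro prod_dvd_prod) auto
    then show ?thesis by (simp add: prod.distrib)
  qed
  then have "fact_bound k n M dvd (\<Prod>l<k. (lcm_upto (M l) ^ (n l - 1)) ^ n l * (\<Prod>i<n l. \<Prod>j<n l. fact (lookup t (l, i, j))))"
    unfolding fact_bound_def by (intro prod_dvd_prod) auto
  then show "fact_bound k n M dvd denom k n M * monomial_fact t"
    by (simp add: monomial_fact_Vars[OF sub] denom_def prod.distrib)
qed

context rep_polys
begin

text \<open>The \<open>i\<close>-th coordinate of \<open>N\<^sup>k \<pi>(X) x\<close> as a polynomial in the entries of \<open>X\<close>.\<close>

definition coord :: "complex vec \<Rightarrow> nat \<Rightarrow> (nat \<times> nat \<times> nat, complex) mpoly" where
  "coord x i = (\<Sum>j<m. single 0 (x $ j) * rep_poly i j)"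

definition coord_monom :: "complex vec \<Rightarrow> (nat \<Rightarrow> nat) \<Rightarrow> (nat \<times> nat \<times> nat, complex) mpoly" where
  "coord_monom x \<beta> = (\<Prod>i<m. coord x i ^ \<beta> i)"

text \<open>Cayley's Omega process applied to a monomial in the coordinates.\<close>

definition invariant :: "(nat \<Rightarrow> nat) \<Rightarrow> (nat \<Rightarrow> nat) \<Rightarrow> complex vec \<Rightarrow> complex" where
  "invariant M \<beta> x = fischer (Delta_pow k n M) (coord_monom x \<beta>)"

lemma coord_vars: "i < m \<Longrightarrow> mpoly_vars (coord x i) \<subseteq> Vars k n"
  unfolding coord_def
  by (intro mpoly_vars_sum order.trans[OF mpoly_vars_const_mult] rep_poly_vars) auto

lemma coord_monom_vars: "mpoly_vars (coord_monom x \<beta>) \<subseteq> Vars k n"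
  unfolding coord_monom_def
  by (intro mpoly_vars_prod order.trans[OF mpoly_vars_power] coord_vars) auto

lemma coord_in:
  assumes K: "subsemiring K" "\<int> \<subseteq> K" and "\<And>j. j < m \<Longrightarrow> x $ j \<in> K" "i < m"
  shows "coord x i \<in> coeffs_in K"
proof -
  have "rep_poly i j \<in> coeffs_in K" if "j < m" for j
    using rep_poly_Ints[OF assms(4) that] K(2) by (auto simp: coeffs_in_def)
  then show ?thesis
    unfolding coord_def using assms subsemiringD(1)[OF K(1)]
    by (intro subsemiring_sum subsemiringD(4) subsemiring_coeffs_in coeffs_in_single) auto
qed

lemma coord_monom_in:
  assumes K: "subsemiring K" "\<int> \<subseteq> K" and "\<And>j. j < m \<Longrightarrow> x $ j \<in> K"
  shows "coord_monom x \<beta> \<in> coeffs_in K"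
  unfolding coord_monom_def using assms
  by (intro subsemiring_prod subsemiring_power subsemiring_coeffs_in coord_in) auto

lemma eval_coord:
  assumes g: "g \<in> carrier (GL_prod k n)" and x: "x \<in> carrier_vec m" and i: "i < m"
  shows "mpoly_eval (entries g) (coord x i) = of_nat N ^ k * (\<pi> g *\<^sub>v x) $ i"
proof -
  have "(\<pi> g *\<^sub>v x) $ i = (\<Sum>j<m. \<pi> g $$ (i, j) * x $ j)"
    using rep_carrier[OF hom g] x i by (simp add: scalar_prod_def lessThan_atLeast0)
  then show ?thesis
    unfolding coord_def mpoly_eval_simps(7) mpoly_eval_const_mult
    using i by (simp add: eval_rep_poly[OF g] sum_distrib_left mult_ac)
qed

lemma translate_coord:
  assumes h: "h \<in> carrier (GL_prod k n)" and x: "x \<in> carrier_vec m" and i: "i < m"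
  shows "translate k n h (coord x i) = coord (\<pi> h *\<^sub>v x) i"
proof (rule eq_on_GL_prod[OF vars_lin_subst coord_vars[OF i]])
  fix g assume g: "g \<in> carrier (GL_prod k n)"
  have "\<pi> (\<lambda>l\<in>{..<k}. g l * h l) *\<^sub>v x = \<pi> g *\<^sub>v (\<pi> h *\<^sub>v x)"
    unfolding rep_mult[OF hom g h]
    by (rule assoc_mult_mat_vec[OF rep_carrier[OF hom g] rep_carrier[OF hom h] x])
  moreover have "\<pi> h *\<^sub>v x \<in> carrier_vec m"
    using rep_carrier[OF hom h] x by auto
  ultimately show "mpoly_eval (entries g) (translate k n h (coord x i)) = mpoly_eval (entries g) (coord (\<pi> h *\<^sub>v x) i)"
    unfolding eval_translate[OF g h coord_vars[OF i]]
    by (simp only: eval_coord[OF mult_GL_prod[OF g h] x i] eval_coord[OF g _ i])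
qed

text \<open>Replacing \<open>x\<close> by \<open>\<pi>(h)x\<close> is the translation \<open>X \<mapsto> X h\<close>, under which the pairing with \<open>\<Delta>\<^sup>M\<close> is invariant.\<close>

lemma invariant_SL:
  assumes h: "h \<in> SL_prod k n" and x: "x \<in> carrier_vec m"
  shows "invariant M \<beta> (\<pi> h *\<^sub>v x) = invariant M \<beta> x"
proof -
  note h' = SL_prod_subset[OF h]
  have "coord_monom (\<pi> h *\<^sub>v x) \<beta> = translate k n h (coord_monom x \<beta>)"
    unfolding coord_monom_def mpoly_compose_simps
    by (intro prod.cong refl) (simp add: translate_coord[OF h' x])
  moreover have "(\<Prod>l<k. det (h l) ^ M l) = 1"
    using h by (intro prod.neutral) (auto simp: PiE_iff SL_def)
  ultimately show ?thesis
    by (simp add: invariant_def fischer_Delta_pow_translate[OF h' coord_monom_vars])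
qed

text \<open>A non-zero pairing needs a common monomial; compare its degrees in the variables of the \<open>l\<close>-th factor.\<close>

lemma invariant_degree:
  assumes "invariant M \<beta> x \<noteq> 0" "l < k"
  shows "M l * n l \<le> d * sum \<beta> {..<m}"
proof -
  let ?c = "\<lambda>x :: nat \<times> nat \<times> nat. if fst x = l then 1 else 0 :: nat"
  obtain t where t: "t \<in> keys (Delta_pow k n M)" "lookup (coord_monom x \<beta>) t \<noteq> 0"
    using assms(1) unfolding invariant_def fischer_def
    by (metis (no_types, lifting) mult_zero_right sum.neutral)
  have "wt_in ?c {..d} (single 0 (x $ j) * rep_poly i j)" if "i < m" "j < m" for i j
  proof (rule wt_in_mult)
    show "wt_in ?c {0} (single 0 (x $ j) :: (nat \<times> nat \<times> nat, complex) mpoly)"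
      by (rule wt_in_single) simp
    show "wt_in ?c {..d} (rep_poly i j)"
      using weight_partial_rep[OF that(1) order.refl that(2), of l] assms(2) by (simp add: rep_poly_def)
  qed auto
  then have "wt_in ?c {..d} (coord x i)" if "i < m" for i
    unfolding coord_def using that by (intro wt_in_sum) auto
  then have "wt_in ?c {..\<Sum>i<m. \<beta> i * d} (coord_monom x \<beta>)"
    unfolding coord_monom_def by (intro wt_in_prod_le wt_in_power_le) auto
  then have "weight ?c t \<le> (\<Sum>i<m. \<beta> i * d)"
    using t(2) by (auto simp: wt_in_def in_keys_iff)
  then show ?thesis
    using degree_Delta_pow[OF t(1) assms(2)] by (simp add: sum_distrib_left mult.commute)
qed

lemma coeff_norm_coord_monom:
  assumes n: "\<And>l. l < k \<Longrightarrow> 1 \<le> n l \<and> n l \<le> n0" and x: "x \<in> carrier_vec m"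
  shows "coeff_norm (coord_monom x \<beta>) \<le> ((real m * real R * real n0 ^ (2 * d)) ^ k * norm2 x) ^ sum \<beta> {..<m}"
proof -
  let ?B = "(real m * real R * real n0 ^ (2 * d)) ^ k * norm2 x"
  have "coeff_norm (coord x i) \<le> ?B" if i: "i < m" for i
  proof -
    have "coeff_norm (coord x i) \<le> (\<Sum>j<m. norm2 x * coeff_norm (rep_poly i j))"
      unfolding coord_def
      by (rule order.trans[OF coeff_norm_sum], rule sum_mono, rule order.trans[OF coeff_norm_const_mult],
          rule mult_right_mono) (auto simp: coeff_norm_nonneg norm_component_le[OF x])
    also have "\<dots> = norm2 x * (\<Sum>j<m. coeff_norm (rep_poly i j))"
      by (simp add: sum_distrib_left)
    also have "\<dots> \<le> norm2 x * (real m * real R * real n0 ^ (2 * d)) ^ k"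
      unfolding rep_poly_def using coeff_norm_partial_rep[OF n i order.refl] norm2_nonneg[OF x]
      by (intro mult_left_mono) auto
    finally show ?thesis by (simp add: mult.commute)
  qed
  then have "coeff_norm (coord_monom x \<beta>) \<le> (\<Prod>i<m. ?B ^ \<beta> i)"
    unfolding coord_monom_def
    by (intro order.trans[OF coeff_norm_prod] prod_mono conjI coeff_norm_nonneg
        order.trans[OF coeff_norm_power] power_mono) auto
  then show ?thesis by (simp add: power_sum)
qed

text \<open>After multiplication by \<open>denom\<close>, every factorial in the pairing is a multiple of \<open>fact_bound\<close>, so the
quotient by \<open>fact_bound\<close> is a non-zero Gaussian integer.\<close>

lemma invariant_ge:
  assumes n: "\<And>l. l < k \<Longrightarrow> 1 \<le> n l" and v: "\<And>i. i < m \<Longrightarrow> v $ i \<in> gaussian_integers"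
    and nz: "invariant M \<beta> v \<noteq> 0"
  shows "real (fact_bound k n M) \<le> real (denom k n M) * cmod (invariant M \<beta> v)"
proof -
  let ?D = "Delta_pow k n M"
  let ?W = "fact_bound k n M"
  have "\<exists>z. denom k n M * monomial_fact t = ?W * z" if "t \<in> keys ?D" for t
    using monomial_fact_Delta_pow(2)[OF that n] by (auto elim: dvdE)
  then obtain z where z: "\<And>t. t \<in> keys ?D \<Longrightarrow> denom k n M * monomial_fact t = ?W * z t"
    by metis
  define s where "s = (\<Sum>t\<in>keys ?D. of_nat (z t) * lookup ?D t * lookup (coord_monom v \<beta>) t)"
  have "of_nat (denom k n M) * invariant M \<beta> v = of_nat ?W * s"
    unfolding invariant_def fischer_def s_def sum_distrib_left
  proof (intro sum.cong refl)
    fix t assume "t \<in> keys ?D"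
    then have "of_nat (denom k n M) * of_nat (monomial_fact t) = (of_nat ?W * of_nat (z t) :: complex)"
      using z by (metis of_nat_mult)
    then show "of_nat (denom k n M) * (of_nat (monomial_fact t) * lookup ?D t * lookup (coord_monom v \<beta>) t) =
        of_nat ?W * (of_nat (z t) * lookup ?D t * lookup (coord_monom v \<beta>) t)"
      by (simp add: mult.assoc[symmetric])
  qed
  then have eq: "real (denom k n M) * cmod (invariant M \<beta> v) = real ?W * cmod s"
    by (metis norm_mult norm_of_nat)
  have "denom k n M \<noteq> 0"
    unfolding denom_def using lcm_upto_pos by (auto simp: gr0_conv_Suc)
  then have "s \<noteq> 0"
    using eq nz by auto
  moreover have "s \<in> gaussian_integers"
    unfolding s_def
    using coeffs_in_lookup[OF Delta_pow_Ints]
      coeffs_in_lookup[OF coord_monom_in[OF subsemiring_gaussian subsetI[OF Ints_gaussian] v]]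
    by (intro subsemiring_sum subsemiringD(4) subsemiring_gaussian subsemiring_of_nat)
      (auto intro: Ints_gaussian)
  ultimately have "1 \<le> cmod s"
    by (intro gaussian_norm_ge_1)
  then show ?thesis
    unfolding eq by (simp add: mult_le_cancel_left1)
qed

text \<open>The factor \<open>fact_bound\<close> cancels between the lower bound at \<open>v\<close> and the upper bound at \<open>\<pi>(g)v\<close>; everything
else is bounded by a \<open>D\<close>-th power, because \<open>n\<^sub>l M\<^sub>l \<le> d D\<close>. The summand \<open>n l - 1\<close> instead of \<open>n l\<close> makes the
first factor trivial when all groups are trivial.\<close>

theorem orbit_norm_ge:
  assumes n: "\<And>l. l < k \<Longrightarrow> 1 \<le> n l \<and> n l \<le> n0"
    and v: "v \<in> carrier_vec m" "\<And>i. i < m \<Longrightarrow> v $ i \<in> gaussian_integers"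
    and nz: "invariant M \<beta> v \<noteq> 0" and \<beta>: "0 < sum \<beta> {..<m}" and g: "g \<in> SL_prod k n"
  shows "1 \<le> 4 ^ (d * (\<Sum>l<k. n l - 1)) * (\<Prod>l<k. real (n l) ^ d) *
    (real m * real R * real n0 ^ (2 * d)) ^ k * norm2 (\<pi> g *\<^sub>v v)"
proof -
  let ?x = "\<pi> g *\<^sub>v v" and ?D = "sum \<beta> {..<m}" and ?W = "real (fact_bound k n M)"
  let ?A = "4 ^ (d * (\<Sum>l<k. n l - 1)) :: real" and ?P = "\<Prod>l<k. real (n l) ^ d"
  let ?B = "(real m * real R * real n0 ^ (2 * d)) ^ k * norm2 ?x"
  have n1: "\<And>l. l < k \<Longrightarrow> 1 \<le> n l" using n by blast
  have x: "?x \<in> carrier_vec m"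
    using rep_carrier[OF hom SL_prod_subset[OF g]] v(1) by auto
  have deg: "M l * n l \<le> d * ?D" if "l < k" for l
    by (rule invariant_degree[OF nz that])
  have W: "0 < ?W"
    by (simp add: fact_bound_def prod_pos)
  have "?W \<le> real (denom k n M) * cmod (invariant M \<beta> ?x)"
    using invariant_ge[OF n1 v(2) nz] by (simp add: invariant_SL[OF g v(1)])
  moreover have "cmod (invariant M \<beta> ?x) \<le> ?W * coeff_norm (Delta_pow k n M) * coeff_norm (coord_monom ?x \<beta>)"
    unfolding invariant_def using monomial_fact_Delta_pow(1)[OF _ n1] by (intro norm_fischer_le) simp
  then have "real (denom k n M) * cmod (invariant M \<beta> ?x) \<le>
      real (denom k n M) * (?W * coeff_norm (Delta_pow k n M) * coeff_norm (coord_monom ?x \<beta>))"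
    by (intro mult_left_mono) auto
  ultimately have "?W * 1 \<le> ?W * (real (denom k n M) * coeff_norm (Delta_pow k n M) * coeff_norm (coord_monom ?x \<beta>))"
    by (simp add: mult_ac)
  then have "1 \<le> real (denom k n M) * coeff_norm (Delta_pow k n M) * coeff_norm (coord_monom ?x \<beta>)"
    using W by (simp only: mult_le_cancel_left_pos)
  also have "\<dots> \<le> ?A ^ ?D * ?P ^ ?D * ?B ^ ?D"
  proof (intro mult_mono mult_nonneg_nonneg coeff_norm_nonneg)
    have "denom k n M \<le> (\<Prod>l<k. 4 ^ (d * ?D * (n l - 1)))"
      unfolding denom_def
    proof (rule prod_mono, rule conjI)
      fix l assume l: "l \<in> {..<k}"
      have "(lcm_upto (M l) ^ (n l - 1)) ^ n l \<le> ((4 ^ M l) ^ (n l - 1)) ^ n l"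
        by (intro power_mono lcm_upto_le) auto
      also have "\<dots> = 4 ^ ((M l * n l) * (n l - 1))"
        by (simp add: power_mult[symmetric] mult_ac)
      also have "\<dots> \<le> 4 ^ (d * ?D * (n l - 1))"
        using deg[of l] l by (intro power_increasing mult_right_mono) auto
      finally show "(lcm_upto (M l) ^ (n l - 1)) ^ n l \<le> 4 ^ (d * ?D * (n l - 1))" .
    qed simp
    also have "\<dots> = 4 ^ (d * ?D * (\<Sum>l<k. n l - 1))"
      by (simp add: power_sum sum_distrib_left)
    finally have "real (denom k n M) \<le> real (4 ^ (d * ?D * (\<Sum>l<k. n l - 1)))"
      by (simp only: of_nat_le_iff)
    then show "real (denom k n M) \<le> ?A ^ ?D"
      by (simp add: power_mult[symmetric] mult_ac)
    have "coeff_norm (Delta_pow k n M) \<le> (\<Prod>l<k. real (n l) ^ (d * ?D))"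
      unfolding Delta_pow_def
    proof (rule order.trans[OF coeff_norm_prod], rule prod_mono, rule conjI[OF coeff_norm_nonneg])
      fix l assume l: "l \<in> {..<k}"
      have "coeff_norm (Delta n l ^ M l) \<le> coeff_norm (Delta n l) ^ M l"
        by (rule coeff_norm_power)
      also have "coeff_norm (Delta n l) \<le> real (n l) ^ n l"
        unfolding Delta_def using coeff_norm_det_mpoly[of "n l" "Pair l"] fact_le_power[of "n l", where 'a = real] by simp
      then have "coeff_norm (Delta n l) ^ M l \<le> (real (n l) ^ n l) ^ M l"
        by (intro power_mono coeff_norm_nonneg)
      also have "\<dots> = real (n l) ^ (M l * n l)"
        by (simp add: power_mult[symmetric] mult.commute)
      also have "\<dots> \<le> real (n l) ^ (d * ?D)"
        using deg[of l] n1[of l] l by (intro power_increasing) auto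
      finally show "coeff_norm (Delta n l ^ M l) \<le> real (n l) ^ (d * ?D)" .
    qed
    then show "coeff_norm (Delta_pow k n M) \<le> ?P ^ ?D"
      by (simp add: prod_power_distrib power_mult)
    show "coeff_norm (coord_monom ?x \<beta>) \<le> ?B ^ ?D"
      by (rule coeff_norm_coord_monom[OF n x])
  qed (auto intro!: prod_nonneg zero_le_power)
  also have "\<dots> = (?A * ?P * ?B) ^ ?D"
    by (simp add: power_mult_distrib)
  finally have "1 \<le> (?A * ?P * ?B) ^ ?D" .
  moreover have "0 \<le> ?A * ?P * ?B"
    using norm2_nonneg[OF x] by (intro mult_nonneg_nonneg prod_nonneg) auto
  ultimately have "1 \<le> ?A * ?P * ?B"
    using \<beta> by (meson linorder_not_le power_less_one_iff)
  then show ?thesis by (simp add: mult.assoc)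
qed

end

section \<open>Vanishing invariants give a place\<close>

definition gaussian_rationals :: "complex set" where
  "gaussian_rationals = {z. Re z \<in> \<rat> \<and> Im z \<in> \<rat>}"

lemma subsemiring_gaussian_rationals: "subsemiring gaussian_rationals"
  by (auto simp: subsemiring_def gaussian_rationals_def)

lemma countable_gaussian_rationals: "countable gaussian_rationals"
proof -
  have "gaussian_rationals \<subseteq> (\<lambda>(a, b). Complex a b) ` (\<rat> \<times> \<rat>)"
    by (auto simp: gaussian_rationals_def image_iff) (metis complex_surj)
  moreover have "countable ((\<lambda>(a, b). Complex a b) ` (\<rat> \<times> \<rat>))"
    by (intro countable_image countable_SIGMA countable_rat)
  ultimately show ?thesis by (rule countable_subset)
qed

lemma Ints_gaussian_rationals: "\<int> \<subseteq> gaussian_rationals"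
  by (auto simp: gaussian_rationals_def elim!: Ints_cases)

lemma gaussian_rationals_uminus: "z \<in> gaussian_rationals \<Longrightarrow> - z \<in> gaussian_rationals"
  by (auto simp: gaussian_rationals_def)

lemma inverse_of_int_gaussian_rationals: "inverse (of_int a) \<in> gaussian_rationals"
proof -
  have "inverse (of_int a :: complex) = of_real (inverse (of_int a))" by simp
  then show ?thesis by (simp only: gaussian_rationals_def mem_Collect_eq Re_complex_of_real Im_complex_of_real) auto
qed

lemma complex_nth_root_exists:
  assumes "0 < n"
  shows "\<exists>w. w ^ n = (z :: complex)"
proof -
  have "degree (monom 1 n + [:- z:]) = n"
    using assms by (subst degree_add_eq_left) (auto simp: degree_monom_eq)
  then have "\<not> constant (poly (monom 1 n + [:- z:]))"
    using assms by (simp add: constant_degree)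
  then obtain w where "poly (monom 1 n + [:- z:]) w = 0"
    using fundamental_theorem_of_algebra by blast
  then show ?thesis by (auto simp: poly_monom)
qed

lemma ring_graph_prod:
  assumes "ring_graph G" "\<And>i. i \<in> A \<Longrightarrow> (f i, g i) \<in> G"
  shows "(prod f A, prod g A) \<in> G"
  using assms(2) by (induction A rule: infinite_finite_induct) (auto intro: ring_graphD[OF assms(1)])

lemma ring_graph_eval:
  assumes G: "ring_graph G" and "\<And>t. (lookup p t, lookup p t) \<in> G"
    and "\<And>x. x \<in> mpoly_vars p \<Longrightarrow> (f x, g x) \<in> G"
  shows "(mpoly_eval f p, mpoly_eval g p) \<in> G"
  unfolding mpoly_eval_monom_eval monom_eval_def
  using assms(2,3)
  by (intro ring_graph_sum[OF G] ring_graph_prod[OF G] ring_graphD(4)[OF G] ring_graph_power[OF G])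
    (auto simp: mpoly_vars_def)

context rep_polys
begin

text \<open>Multiplying the relation by \<open>\<Delta>\<^sup>M\<close> clears the denominators and gives a polynomial \<open>W\<close> that vanishes at
the generic point \<open>X\<close>, so \<open>W = 0\<close>. In the pairing of \<open>\<Delta>\<^sup>M\<close> with \<open>W\<close>, the term of a monomial \<open>\<beta> \<noteq> 0\<close> is a
multiple of an invariant of \<open>v\<close>, and the constant term contributes \<open>\<langle>\<Delta>\<^sup>M, \<Delta>\<^sup>M\<rangle> \<noteq> 0\<close>.\<close>

lemma relation_constant_term:
  assumes generic: "\<And>p. p \<noteq> 0 \<Longrightarrow> mpoly_vars p \<subseteq> Vars k n \<Longrightarrow> p \<in> coeffs_in gaussian_rationals \<Longrightarrow> mpoly_eval X p \<noteq> 0"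
    and vanish: "\<And>M \<beta>. 0 < sum \<beta> {..<m} \<Longrightarrow> invariant M \<beta> v = 0"
    and v: "\<And>j. j < m \<Longrightarrow> v $ j \<in> gaussian_rationals"
    and r: "0 < r" and \<psi>: "\<And>i. i < m \<Longrightarrow> \<psi> i * (\<Prod>l<k. mpoly_eval X (Delta n l) ^ w l i) = mpoly_eval X (coord v i) ^ r"
    and Q: "Q \<in> coeffs_in gaussian_rationals" "mpoly_vars Q \<subseteq> {..<m}" "mpoly_eval \<psi> Q = 0"
  shows "lookup Q 0 = 0"
proof (rule ccontr)
  assume q0: "lookup Q 0 \<noteq> 0"
  let ?K = "gaussian_rationals"
  define s where "s \<beta> l = (\<Sum>i<m. lookup \<beta> i * w l i)" for \<beta> :: "nat monomial" and l
  \<comment> \<open>any common upper bound of the exponents \<open>s \<beta> l\<close>\<close>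
  define M where "M l = (\<Sum>\<beta>\<in>keys Q. s \<beta> l)" for l
  have s_le: "s \<beta> l \<le> M l" if "\<beta> \<in> keys Q" for \<beta> l
    unfolding M_def using that by (intro member_le_sum) auto
  define C where "C \<beta> = coord_monom v (\<lambda>i. r * lookup \<beta> i)" for \<beta> :: "nat monomial"
  define T where "T \<beta> = Delta_pow k n (\<lambda>l. M l - s \<beta> l) * C \<beta>" for \<beta>
  define W where "W = (\<Sum>\<beta>\<in>keys Q. single 0 (lookup Q \<beta>) * T \<beta>)"
  have evalD: "mpoly_eval X (Delta_pow k n M) = (\<Prod>l<k. mpoly_eval X (Delta n l) ^ M l)" for M
    by (simp add: Delta_pow_def mpoly_eval_simps)
  have "mpoly_eval X (T \<beta>) = mpoly_eval X (Delta_pow k n M) * monom_eval \<psi> \<beta>" if \<beta>: "\<beta> \<in> keys Q" for \<beta>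
  proof -
    have "mpoly_eval X (C \<beta>) = (\<Prod>i<m. (mpoly_eval X (coord v i) ^ r) ^ lookup \<beta> i)"
      by (simp add: C_def coord_monom_def mpoly_eval_simps power_mult)
    also have "\<dots> = (\<Prod>i<m. \<psi> i ^ lookup \<beta> i * (\<Prod>l<k. mpoly_eval X (Delta n l) ^ (lookup \<beta> i * w l i)))"
      by (intro prod.cong refl)
        (simp add: \<psi>[symmetric] power_mult_distrib prod_power_distrib power_mult[symmetric] mult.commute)
    also have "\<dots> = (\<Prod>i<m. \<psi> i ^ lookup \<beta> i) * (\<Prod>l<k. mpoly_eval X (Delta n l) ^ s \<beta> l)"
      unfolding prod.distrib s_def power_sum by (subst prod.swap) simp
    also have "(\<Prod>i<m. \<psi> i ^ lookup \<beta> i) = monom_eval \<psi> \<beta>"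
      using Q(2) \<beta> by (intro monom_eval_superset[symmetric]) (auto simp: mpoly_vars_def)
    finally have "mpoly_eval X (T \<beta>) = monom_eval \<psi> \<beta> *
        ((\<Prod>l<k. mpoly_eval X (Delta n l) ^ (M l - s \<beta> l)) * (\<Prod>l<k. mpoly_eval X (Delta n l) ^ s \<beta> l))"
      by (simp add: T_def mpoly_eval_simps(5) evalD mult_ac)
    also have "(\<Prod>l<k. mpoly_eval X (Delta n l) ^ (M l - s \<beta> l)) * (\<Prod>l<k. mpoly_eval X (Delta n l) ^ s \<beta> l) =
        (\<Prod>l<k. mpoly_eval X (Delta n l) ^ M l)"
      unfolding prod.distrib[symmetric] power_add[symmetric] using s_le[OF \<beta>] by simp
    finally show ?thesis by (simp add: evalD mult.commute)
  qed
  then have "mpoly_eval X W = mpoly_eval X (Delta_pow k n M) * mpoly_eval \<psi> Q"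
    unfolding W_def mpoly_eval_simps(7) mpoly_eval_const_mult mpoly_eval_monom_eval[of \<psi>] sum_distrib_left
    by (intro sum.cong) (auto simp: mult_ac)
  then have "mpoly_eval X W = 0"
    using Q(3) by simp
  moreover have Tvars: "mpoly_vars (T \<beta>) \<subseteq> Vars k n" for \<beta>
    unfolding T_def C_def using mpoly_vars_mult vars_Delta_pow coord_monom_vars by (meson Un_least order.trans)
  then have "mpoly_vars W \<subseteq> Vars k n"
    unfolding W_def by (intro mpoly_vars_sum order.trans[OF mpoly_vars_const_mult])
  moreover have "Delta_pow k n M' \<in> coeffs_in ?K" for M'
    using Delta_pow_Ints[of k n M'] Ints_gaussian_rationals by (auto simp: coeffs_in_def)
  then have "W \<in> coeffs_in ?K"
    unfolding W_def T_def C_def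
    using Q(1) subsemiringD(1)[OF subsemiring_gaussian_rationals]
    by (intro subsemiring_sum subsemiringD(4) subsemiring_coeffs_in subsemiring_gaussian_rationals coeffs_in_single
        coord_monom_in Ints_gaussian_rationals v) (auto simp: coeffs_in_def)
  ultimately have "W = 0"
    using generic by blast
  \<comment> \<open>Here the factor \<open>\<Delta>\<^bsup>M - s\<^esup>\<close> is removed at the price of a constant, which leaves an invariant of \<open>v\<close>.\<close>
  have zero: "fischer (Delta_pow k n M) (T \<beta>) = 0" if \<beta>: "\<beta> \<in> keys Q" "\<beta> \<noteq> 0" for \<beta>
  proof -
    obtain c where c: "\<And>f. mpoly_vars f \<subseteq> Vars k n \<Longrightarrow>
        fischer (Delta_pow k n M) (Delta_pow k n (\<lambda>l. M l - s \<beta> l) * f) =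
        c * fischer (Delta_pow k n (\<lambda>l. M l - (M l - s \<beta> l))) f"
      using fischer_Delta_pow_mult[of k "\<lambda>l. M l - s \<beta> l" M n] by (metis diff_le_self)
    obtain i where "i \<in> keys \<beta>"
      using \<beta>(2) keys_empty_iff[of \<beta>] by blast
    moreover from this have "i \<in> mpoly_vars Q"
      using \<beta>(1) unfolding mpoly_vars_def by blast
    ultimately have "i < m" "0 < r * lookup \<beta> i"
      using Q(2) r by (auto simp: in_keys_iff)
    then have "0 < (\<Sum>i<m. r * lookup \<beta> i)"
      by (intro sum_pos2[of _ i]) auto
    from vanish[OF this] show ?thesis
      using c[OF coord_monom_vars, of v "\<lambda>i. r * lookup \<beta> i"] by (simp add: T_def C_def invariant_def)
  qed
  have T0: "T 0 = Delta_pow k n M"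
    by (simp add: T_def C_def s_def coord_monom_def)
  have "0 \<in> keys Q"
    using q0 by (simp add: in_keys_iff)
  have "0 = fischer (Delta_pow k n M) W"
    using \<open>W = 0\<close> by simp
  also have "\<dots> = (\<Sum>\<beta>\<in>keys Q. lookup Q \<beta> * fischer (Delta_pow k n M) (T \<beta>))"
    by (simp add: W_def fischer_sum_right fischer_scale_right)
  also have "\<dots> = (\<Sum>\<beta>\<in>{0}. lookup Q \<beta> * fischer (Delta_pow k n M) (T \<beta>))"
    by (rule sum.mono_neutral_right) (use \<open>0 \<in> keys Q\<close> zero in auto)
  also have "\<dots> = lookup Q 0 * fischer (Delta_pow k n M) (Delta_pow k n M)"
    by (simp add: T0)
  finally show False
    using q0 fischer_self_nonzero[OF Delta_pow_Ints Delta_pow_nonzero] by simp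
qed

lemma rep_scalars:
  assumes c: "\<And>l. l < k \<Longrightarrow> c l \<noteq> 0" and ab: "a < m" "b < m"
  shows "\<pi> (\<lambda>l\<in>{..<k}. c l \<cdot>\<^sub>m 1\<^sub>m (n l)) $$ (a, b) = (if a = b then \<Prod>l<k. c l ^ e l a else 0)"
proof -
  let ?c = "\<lambda>j. \<lambda>l\<in>{..<k}. if l < j then c l \<cdot>\<^sub>m 1\<^sub>m (n l) else 1\<^sub>m (n l)"
  have diag: "\<pi> (?c j) $$ (a, b) = (if a = b then \<Prod>l<j. c l ^ e l a else 0)" if "j \<le> k" "b < m" for j b
    using that
  proof (induction j arbitrary: b)
    case 0
    have "?c 0 = (\<lambda>l\<in>{..<k}. 1\<^sub>m (n l))" by auto
    then have 1: "\<pi> (?c 0) = 1\<^sub>m m" by (simp only: rep_one[OF hom])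
    show ?case unfolding 1 using ab 0 by simp
  next
    case (Suc j)
    have cj: "c j \<cdot>\<^sub>m 1\<^sub>m (n j) \<in> carrier (GL (n j))"
      using c[of j] Suc.prems by (simp add: carrier_GL)
    have c1: "?c j \<in> carrier (GL_prod k n)"
      by (rule GL_prodI) (auto simp: c)
    have c2: "embed k n j (c j \<cdot>\<^sub>m 1\<^sub>m (n j)) \<in> carrier (GL_prod k n)"
      by (rule embed_GL) (rule cj)
    have "?c (Suc j) = (\<lambda>i\<in>{..<k}. ?c j i * embed k n j (c j \<cdot>\<^sub>m 1\<^sub>m (n j)) i)"
    proof
      fix i
      show "?c (Suc j) i = (\<lambda>i\<in>{..<k}. ?c j i * embed k n j (c j \<cdot>\<^sub>m 1\<^sub>m (n j)) i) i"
        by (auto simp: embed_def less_Suc_eq)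
    qed
    then have "\<pi> (?c (Suc j)) = \<pi> (?c j) * factor_rep k n \<pi> j (c j \<cdot>\<^sub>m 1\<^sub>m (n j))"
      by (simp only: rep_mult[OF hom c1 c2] factor_rep_embed)
    moreover have "\<pi> (?c j) \<in> carrier_mat m m" "factor_rep k n \<pi> j (c j \<cdot>\<^sub>m 1\<^sub>m (n j)) \<in> carrier_mat m m"
      unfolding factor_rep_embed by (rule rep_carrier[OF hom c1], rule rep_carrier[OF hom c2])
    ultimately have "\<pi> (?c (Suc j)) $$ (a, b) =
        (\<Sum>i<m. \<pi> (?c j) $$ (a, i) * factor_rep k n \<pi> j (c j \<cdot>\<^sub>m 1\<^sub>m (n j)) $$ (i, b))"
      using ab Suc.prems by (simp add: scalar_prod_def lessThan_atLeast0)
    also have "\<dots> = (\<Sum>i<m. if i = a then (if a = b then (\<Prod>l<j. c l ^ e l a) * c j ^ e j a else 0) else 0)"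
    proof (intro sum.cong refl)
      fix i assume i: "i \<in> {..<m}"
      have 1: "\<pi> (?c j) $$ (a, i) = (if a = i then \<Prod>l<j. c l ^ e l a else 0)"
        by (rule Suc.IH) (use Suc.prems i in auto)
      have 2: "factor_rep k n \<pi> j (c j \<cdot>\<^sub>m 1\<^sub>m (n j)) $$ (i, b) = (if i = b then c j ^ e j i else 0)"
        by (rule scalar) (use Suc.prems i c in auto)
      show "\<pi> (?c j) $$ (a, i) * factor_rep k n \<pi> j (c j \<cdot>\<^sub>m 1\<^sub>m (n j)) $$ (i, b) =
          (if i = a then (if a = b then (\<Prod>l<j. c l ^ e l a) * c j ^ e j a else 0) else 0)"
        unfolding 1 2 by auto
    qed
    also have "\<dots> = (if a = b then \<Prod>l<Suc j. c l ^ e l a else 0)"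
      using ab by simp
    finally show ?case .
  qed
  have "?c k = (\<lambda>l\<in>{..<k}. c l \<cdot>\<^sub>m 1\<^sub>m (n l))" by auto
  with diag[OF order.refl ab(2)] show ?thesis by (simp only:)
qed

text \<open>The generic point is rescaled to determinant \<open>1\<close> by \<open>n\<^sub>l\<close>-th roots of the determinants. The \<open>r\<close>-th powers
of the coordinates, \<open>r = \<Prod>\<^sub>l n\<^sub>l\<close>, no longer involve these roots; sending them to \<open>0\<close> is a homomorphism by
\<open>relation_constant_term\<close>, and in a valuation ring an element with a power in the maximal ideal is itself in the
maximal ideal.\<close>

lemma place_exists:
  assumes n: "\<And>l. l < k \<Longrightarrow> 1 \<le> n l" and vc: "v \<in> carrier_vec m"
    and vanish: "\<And>M \<beta>. 0 < sum \<beta> {..<m} \<Longrightarrow> invariant M \<beta> v = 0"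
    and v: "\<And>j. j < m \<Longrightarrow> v $ j \<in> gaussian_rationals"
  obtains G g where "ring_graph G" "\<forall>c\<in>gaussian_rationals. (c, c) \<in> G"
    "\<forall>a b. (a, b) \<in> G \<longrightarrow> b \<noteq> 0 \<longrightarrow> (inverse a, inverse b) \<in> G"
    "\<forall>x. x \<notin> Domain G \<longrightarrow> (inverse x, 0) \<in> G"
    "g \<in> SL_prod k n" "\<forall>i<m. ((\<pi> g *\<^sub>v v) $ i, 0) \<in> G"
proof -
  let ?K = gaussian_rationals
  note K = subsemiring_gaussian_rationals
  note KD = subsemiringD[OF K]
  obtain X where generic: "\<And>p. p \<noteq> 0 \<Longrightarrow> mpoly_vars p \<subseteq> Vars k n \<Longrightarrow> p \<in> coeffs_in ?K \<Longrightarrow> mpoly_eval X p \<noteq> 0"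
    using generic_point[OF finite_Vars countable_gaussian_rationals KD(1), of k n] by blast
  define h where "h = mats_of k n X"
  define D where "D l = mpoly_eval X (Delta n l)" for l
  have "Delta n l \<in> coeffs_in ?K" for l
    using det_mpoly_Ints[of "n l" "Pair l"] Ints_gaussian_rationals by (auto simp: coeffs_in_def Delta_def)
  then have D0: "D l \<noteq> 0" if "l < k" for l
    unfolding D_def using that by (intro generic Delta_nonzero vars_Delta)
  then have h: "h \<in> carrier (GL_prod k n)"
    unfolding h_def D_def by (rule mats_of_GL)
  have deth: "det (h l) = D l" if "l < k" for l
    using that by (simp add: h_def mats_of_def D_def Delta_def eval_det_mpoly)
  have "\<exists>y. y ^ n l = D l" if "l < k" for l
    using complex_nth_root_exists[of "n l" "D l"] n[OF that] by auto
  then obtain y where y: "\<And>l. l < k \<Longrightarrow> y l ^ n l = D l"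
    by metis
  have y0: "y l \<noteq> 0" if "l < k" for l
    using y[OF that] D0[OF that] n[OF that] by (auto simp: zero_power)
  define z where "z = (\<lambda>l\<in>{..<k}. inverse (y l) \<cdot>\<^sub>m 1\<^sub>m (n l))"
  have z: "z \<in> carrier (GL_prod k n)"
    unfolding z_def by (rule GL_prodI) (auto simp: y0)
  define g where "g = (\<lambda>l\<in>{..<k}. z l * h l)"
  have g: "g \<in> SL_prod k n"
  proof -
    have "g l \<in> SL (n l)" if l: "l < k" for l
    proof -
      note hl = GL_prodD(1)[OF h l] and zl = GL_prodD(1)[OF z l]
      have "det (g l) = det (z l) * det (h l)"
        using l det_mult[OF zl hl] by (simp add: g_def)
      also have "det (z l) = inverse (y l) ^ n l"
        using l by (simp add: z_def)
      also have "inverse (y l) ^ n l * det (h l) = 1"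
        using y[OF l] D0[OF l] deth[OF l] by (simp add: power_inverse)
      finally show ?thesis
        using l mult_carrier_mat[OF zl hl] by (simp add: SL_def g_def)
    qed
    then show ?thesis by (auto simp: g_def)
  qed
  define \<phi> where "\<phi> i = (\<pi> g *\<^sub>v v) $ i" for i
  have \<phi>: "\<phi> i = (\<Prod>l<k. inverse (y l) ^ e l i) * (\<pi> h *\<^sub>v v) $ i" if i: "i < m" for i
  proof -
    note hc = rep_carrier[OF hom h] and zc = rep_carrier[OF hom z]
    have hv: "\<pi> h *\<^sub>v v \<in> carrier_vec m" using hc vc by auto
    have "\<pi> g *\<^sub>v v = \<pi> z *\<^sub>v (\<pi> h *\<^sub>v v)"
      unfolding g_def rep_mult[OF hom z h] by (rule assoc_mult_mat_vec[OF zc hc vc])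
    then have "\<phi> i = (\<Sum>j<m. \<pi> z $$ (i, j) * (\<pi> h *\<^sub>v v) $ j)"
      using i zc hv hc vc by (simp add: \<phi>_def scalar_prod_def lessThan_atLeast0)
    also have "\<dots> = (\<Sum>j<m. if j = i then (\<Prod>l<k. inverse (y l) ^ e l i) * (\<pi> h *\<^sub>v v) $ j else 0)"
      using i rep_scalars[of "\<lambda>l. inverse (y l)" i] y0
      by (intro sum.cong refl) (auto simp: z_def)
    finally show ?thesis using i by simp
  qed
  define r where "r = (\<Prod>l<k. n l)"
  have r: "0 < r" using n by (auto simp: r_def Suc_le_eq intro!: prod_pos)
  define \<psi> where "\<psi> i = (of_nat N ^ k * \<phi> i) ^ r" for i
  have \<psi>: "\<psi> i * (\<Prod>l<k. D l ^ (e l i * (r div n l))) = mpoly_eval X (coord v i) ^ r" if i: "i < m" for i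
  proof -
    have "D l ^ (e l i * (r div n l)) = (y l ^ e l i) ^ r" if l: "l < k" for l
    proof -
      have "n l dvd r" unfolding r_def using l by (intro dvd_prodI) auto
      then have eq: "n l * (e l i * (r div n l)) = e l i * r"
        by (metis dvd_mult_div_cancel mult.left_commute)
      show ?thesis
        unfolding y[OF l, symmetric] power_mult[symmetric] eq ..
    qed
    then have "(\<Prod>l<k. D l ^ (e l i * (r div n l))) = (\<Prod>l<k. y l ^ e l i) ^ r"
      unfolding prod_power_distrib by (intro prod.cong) auto
    then have "\<psi> i * (\<Prod>l<k. D l ^ (e l i * (r div n l))) = (of_nat N ^ k * (\<phi> i * (\<Prod>l<k. y l ^ e l i))) ^ r"
      by (simp add: \<psi>_def power_mult_distrib)
    also have "\<phi> i * (\<Prod>l<k. y l ^ e l i) = (\<pi> h *\<^sub>v v) $ i"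
    proof -
      have "(\<Prod>l<k. inverse (y l) ^ e l i) * (\<Prod>l<k. y l ^ e l i) = 1"
        unfolding prod.distrib[symmetric] using y0
        by (intro prod.neutral) (auto simp: power_mult_distrib[symmetric])
      then show ?thesis
        unfolding \<phi>[OF i] by (metis (no_types, lifting) mult.assoc mult.commute mult.right_neutral)
    qed
    also have "of_nat N ^ k * (\<pi> h *\<^sub>v v) $ i = mpoly_eval X (coord v i)"
      using eval_coord[OF h vc i] eval_mats_of[OF coord_vars[OF i]] by (simp add: h_def)
    finally show ?thesis .
  qed
  \<comment> \<open>evaluation at \<open>\<psi>\<close> against evaluation at \<open>0\<close>\<close>
  define G0 where "G0 = {(mpoly_eval \<psi> q, lookup q 0) | q. q \<in> coeffs_in ?K \<and> mpoly_vars q \<subseteq> {..<m}}"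
  note KP = subsemiring_coeffs_in[OF K]
  have G0I: "(mpoly_eval \<psi> q, lookup q 0) \<in> G0" if "q \<in> coeffs_in ?K" "mpoly_vars q \<subseteq> {..<m}" for q
    using that unfolding G0_def by blast
  have "ring_graph G0"
    unfolding ring_graph_def
  proof (intro conjI allI impI)
    show "(0, 0) \<in> G0"
      using G0I[of 0] subsemiringD(1)[OF KP] by (simp add: mpoly_eval_simps(2))
    show "(1, 1) \<in> G0"
      using G0I[of 1] subsemiringD(2)[OF KP] by (simp add: mpoly_eval_simps(4))
    show "(a + a', b + b') \<in> G0" if ab: "(a, b) \<in> G0" "(a', b') \<in> G0" for a b a' b'
    proof -
      obtain p q where *: "a = mpoly_eval \<psi> p" "b = lookup p 0" "p \<in> coeffs_in ?K" "mpoly_vars p \<subseteq> {..<m}"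
        "a' = mpoly_eval \<psi> q" "b' = lookup q 0" "q \<in> coeffs_in ?K" "mpoly_vars q \<subseteq> {..<m}"
        using ab unfolding G0_def by blast
      then show ?thesis
        using G0I[of "p + q"] subsemiringD(3)[OF KP, of p q] mpoly_vars_add[of p q]
        by (simp add: mpoly_eval_simps(1) lookup_add subset_trans)
    qed
    show "(a * a', b * b') \<in> G0" if ab: "(a, b) \<in> G0" "(a', b') \<in> G0" for a b a' b'
    proof -
      obtain p q where *: "a = mpoly_eval \<psi> p" "b = lookup p 0" "p \<in> coeffs_in ?K" "mpoly_vars p \<subseteq> {..<m}"
        "a' = mpoly_eval \<psi> q" "b' = lookup q 0" "q \<in> coeffs_in ?K" "mpoly_vars q \<subseteq> {..<m}"
        using ab unfolding G0_def by blast
      have "lookup (p * q) 0 = b * b'"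
        unfolding lookup_0_eval * by (rule mpoly_eval_simps(5))
      then show ?thesis
        using G0I[of "p * q"] subsemiringD(4)[OF KP, of p q] mpoly_vars_mult[of p q] *
        by (simp add: mpoly_eval_simps(5) subset_trans)
    qed
    show "(- a, - b) \<in> G0" if ab: "(a, b) \<in> G0" for a b
    proof -
      obtain p where *: "a = mpoly_eval \<psi> p" "b = lookup p 0" "p \<in> coeffs_in ?K" "mpoly_vars p \<subseteq> {..<m}"
        using ab unfolding G0_def by blast
      have "- p \<in> coeffs_in ?K"
        using *(3) gaussian_rationals_uminus by (auto simp: coeffs_in_def)
      moreover have "mpoly_vars (- p) = mpoly_vars p"
        by (simp add: mpoly_vars_def in_keys_iff)
      ultimately show ?thesis
        using G0I[of "- p"] * by (simp add: mpoly_eval_uminus)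
    qed
    show "b = 0" if "(0, b) \<in> G0" for b
    proof -
      obtain q where q: "0 = mpoly_eval \<psi> q" "b = lookup q 0" "q \<in> coeffs_in ?K" "mpoly_vars q \<subseteq> {..<m}"
        using \<open>(0, b) \<in> G0\<close> unfolding G0_def by blast
      show ?thesis
        unfolding q(2)
        by (rule relation_constant_term[OF generic vanish v r _ q(3,4) q(1)[symmetric]])
          (use \<psi> in \<open>auto simp: D_def\<close>)
    qed
  qed
  then obtain G where G: "G0 \<subseteq> G" "ring_graph G"
    "\<And>a b. (a, b) \<in> G \<Longrightarrow> b \<noteq> 0 \<Longrightarrow> (inverse a, inverse b) \<in> G"
    "\<And>x. x \<notin> Domain G \<Longrightarrow> (inverse x, 0) \<in> G"
    by (rule chevalley_extension) blast
  have cG: "(c, c) \<in> G" if "c \<in> ?K" for c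
    using G0I[of "single 0 c"] coeffs_in_single[OF KD(1) that, of 0] G(1) by auto
  have \<phi>G: "(\<phi> i, 0) \<in> G" if i: "i < m" for i
  proof -
    have "lookup (mvar i :: (nat, complex) mpoly) 0 = 0"
      by (simp add: lookup_0_eval)
    then have \<psi>0: "(\<psi> i, 0) \<in> G"
      using G0I[of "mvar i"] coeffs_in_mvar[OF K, of i] mpoly_vars_mvar[of i] i G(1) by auto
    define a where "a = of_nat N ^ k * \<phi> i"
    have ar: "(a ^ r, 0) \<in> G" using \<psi>0 by (simp add: \<psi>_def a_def)
    have a: "(a, 0) \<in> G"
    proof (cases "a \<in> Domain G")
      case True
      then obtain b where b: "(a, b) \<in> G" by blast
      have "b ^ r = 0"
        by (rule ring_graph_unique[OF G(2) ring_graph_power[OF G(2) b] ar])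
      then show ?thesis using b by simp
    next
      case False
      then have "a \<noteq> 0" using ring_graphD(1)[OF G(2)] by auto
      have "(inverse a ^ r * a ^ r, 0 * 0) \<in> G"
        using ring_graphD(4)[OF G(2) ring_graph_power[OF G(2) G(4)[OF False], of r] ar] r by (simp add: zero_power)
      then have "(1, 0) \<in> G"
        using \<open>a \<noteq> 0\<close> by (simp add: power_mult_distrib[symmetric])
      then show ?thesis
        using ring_graph_unique[OF G(2) ring_graphD(2)[OF G(2)]] by fastforce
    qed
    have "inverse (of_int (int N)) \<in> ?K"
      by (rule inverse_of_int_gaussian_rationals)
    then have "(inverse (of_nat N) ^ k, inverse (of_nat N) ^ k) \<in> G"
      by (intro ring_graph_power[OF G(2)] cG) simp
    from ring_graphD(4)[OF G(2) this a] show ?thesis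
      using N(1) by (simp add: a_def mult.assoc[symmetric] power_mult_distrib[symmetric])
  qed
  show thesis
  proof (rule that[OF G(2) _ _ _ g])
    show "\<forall>c\<in>?K. (c, c) \<in> G" using cG by blast
    show "\<forall>a b. (a, b) \<in> G \<longrightarrow> b \<noteq> 0 \<longrightarrow> (inverse a, inverse b) \<in> G" using G(3) by blast
    show "\<forall>x. x \<notin> Domain G \<longrightarrow> (inverse x, 0) \<in> G" using G(4) by blast
    show "\<forall>i<m. ((\<pi> g *\<^sub>v v) $ i, 0) \<in> G" using \<phi>G by (simp add: \<phi>_def)
  qed
qed

end

section \<open>Diagonal tori and weight vectors\<close>

text \<open>Elimination in a Vandermonde system with integer nodes only divides by differences of nodes, which are
units because they are rational.\<close>

lemma ideal_vandermonde:
  assumes G: "ring_graph G" and inv: "\<And>a. (inverse (of_int a), inverse (of_int a)) \<in> G" "\<And>a. (of_int a, of_int a) \<in> G"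
    and "finite A" "inj_on w A"
    and "\<And>s. ((\<Sum>t\<in>A. of_nat (w t) ^ s * z t), 0) \<in> G" "t \<in> A"
  shows "(z t, 0) \<in> G"
  using assms(4-)
proof (induction A arbitrary: z t rule: finite_induct)
  case (insert a A)
  have sub: "(x - y, 0) \<in> G" if "(x, 0) \<in> G" "(y, 0) \<in> G" for x y
    using ring_graph_diff[OF G that] by simp
  have z: "(z t, 0) \<in> G" if t: "t \<in> A" for t
  proof -
    have "((\<Sum>t\<in>A. of_nat (w t) ^ s * (of_int (int (w t) - int (w a)) * z t)), 0) \<in> G" for s
    proof -
      let ?S = "\<lambda>s. \<Sum>t\<in>insert a A. of_nat (w t) ^ s * z t"
      have "(of_int (int (w a)) * ?S s, of_int (int (w a)) * 0) \<in> G"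
        by (rule ring_graphD(4)[OF G inv(2) insert.prems(2)])
      then have "(of_int (int (w a)) * ?S s, 0) \<in> G"
        by (simp only: mult_zero_right)
      from sub[OF insert.prems(2)[of "Suc s"] this]
      have "(?S (Suc s) - of_int (int (w a)) * ?S s, 0) \<in> G" .
      also have "?S (Suc s) - of_int (int (w a)) * ?S s =
          (\<Sum>t\<in>insert a A. of_nat (w t) ^ s * (of_int (int (w t) - int (w a)) * z t))"
        unfolding sum_distrib_left sum_subtractf[symmetric]
        by (rule sum.cong) (simp_all add: algebra_simps)
      also have "\<dots> = (\<Sum>t\<in>A. of_nat (w t) ^ s * (of_int (int (w t) - int (w a)) * z t))"
        using insert.hyps by simp
      finally show ?thesis .
    qed
    note * = this
    have "inj_on w A"
      using insert.prems(1) by (rule inj_on_subset) blast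
    from insert.IH[of "\<lambda>t. of_int (int (w t) - int (w a)) * z t" t, OF this * t]
    have "(of_int (int (w t) - int (w a)) * z t, 0) \<in> G" .
    from ring_graphD(4)[OF G inv(1)[of "int (w t) - int (w a)"] this]
    have "(inverse (of_int (int (w t) - int (w a))) * (of_int (int (w t) - int (w a)) * z t), 0) \<in> G"
      by simp
    moreover have "of_int (int (w t) - int (w a)) \<noteq> (0 :: complex)"
      using insert.prems(1) t insert.hyps by (auto simp: inj_on_def)
    ultimately show ?thesis
      by (simp add: mult.assoc[symmetric] del: of_int_diff)
  qed
  show ?case
  proof (cases "t = a")
    case True
    have "((\<Sum>t\<in>A. z t), 0) \<in> G"
      using ring_graph_sum[OF G, of A z "\<lambda>_. 0"] z by simp
    from sub[OF insert.prems(2)[of 0] this] show ?thesis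
      using insert.hyps True by simp
  next
    case False
    then show ?thesis using z insert.prems(3) by blast
  qed
qed simp

definition torus_index :: "nat \<Rightarrow> (nat \<Rightarrow> nat) \<Rightarrow> (nat \<times> nat) set" where
  "torus_index k n = (SIGMA l:{..<k}. {..<n l})"

definition torus :: "nat \<Rightarrow> (nat \<Rightarrow> nat) \<Rightarrow> (nat \<times> nat \<Rightarrow> complex) \<Rightarrow> nat \<Rightarrow> complex mat" where
  "torus k n t = (\<lambda>l\<in>{..<k}. mat (n l) (n l) (\<lambda>(i, j). if i = j then t (l, i) else 0))"

text \<open>The character of the diagonal torus given by a monomial. The codomain is left general because characters
are evaluated both at complex numbers and at natural numbers.\<close>

definition torus_char :: "nat \<Rightarrow> (nat \<Rightarrow> nat) \<Rightarrow> (nat \<times> nat \<times> nat) monomial \<Rightarrow> (nat \<times> nat \<Rightarrow> 'a::comm_semiring_1) \<Rightarrow> 'a" where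
  "torus_char k n a t = (\<Prod>(l, i)\<in>torus_index k n. t (l, i) ^ lookup a (l, i, i))"

lemma finite_torus_index [simp]: "finite (torus_index k n)"
  by (simp add: torus_index_def)

lemma torus_char_mult: "torus_char k n a (\<lambda>x. s x * t x) = torus_char k n a s * torus_char k n a t"
  by (simp add: torus_char_def power_mult_distrib prod.distrib case_prod_unfold)

lemma torus_char_power: "torus_char k n a (\<lambda>x. t x ^ s) = torus_char k n a t ^ s"
  by (simp add: torus_char_def prod_power_distrib case_prod_unfold power_mult[symmetric] mult.commute)

lemma det_diagonal:
  assumes "A \<in> carrier_mat n n" "\<And>i j. i < n \<Longrightarrow> j < n \<Longrightarrow> i \<noteq> j \<Longrightarrow> A $$ (i, j) = 0"
  shows "det A = (\<Prod>i<n. A $$ (i, i) :: complex)"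
proof -
  have "det A = prod_list (diag_mat A)"
    by (rule det_upper_triangular[OF _ assms(1)]) (use assms in \<open>auto intro!: upper_triangularI\<close>)
  then show ?thesis
    using assms(1) by (simp add: prod_list_diag_prod lessThan_atLeast0)
qed

lemma torus_det: "l < k \<Longrightarrow> det (torus k n t l) = (\<Prod>i<n l. t (l, i))"
  by (subst det_diagonal[of _ "n l"]) (auto simp: torus_def)

lemma torus_GL:
  assumes "\<And>l i. l < k \<Longrightarrow> i < n l \<Longrightarrow> t (l, i) \<noteq> 0"
  shows "torus k n t \<in> carrier (GL_prod k n)"
proof -
  have "(\<lambda>l\<in>{..<k}. torus k n t l) \<in> carrier (GL_prod k n)"
  proof (rule GL_prodI)
    show "torus k n t l \<in> carrier_mat (n l) (n l)" if "l < k" for l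
      using that by (simp add: torus_def)
    show "det (torus k n t l) \<noteq> 0" if "l < k" for l
      using that assms by (simp add: torus_det)
  qed
  moreover have "(\<lambda>l\<in>{..<k}. torus k n t l) = torus k n t"
    by (auto simp: torus_def)
  ultimately show ?thesis by simp
qed

lemma torus_mult:
  assumes "l < k"
  shows "torus k n s l * torus k n t l = torus k n (\<lambda>x. s x * t x) l"
proof (rule eq_matI)
  fix i j assume ij: "i < dim_row (torus k n (\<lambda>x. s x * t x) l)" "j < dim_col (torus k n (\<lambda>x. s x * t x) l)"
  then have ij: "i < n l" "j < n l" using assms by (auto simp: torus_def)
  have "(torus k n s l * torus k n t l) $$ (i, j) = (\<Sum>r<n l. (if i = r then s (l, i) else 0) * (if r = j then t (l, r) else 0))"
    using ij assms by (simp add: torus_def scalar_prod_def lessThan_atLeast0)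
  also have "\<dots> = (\<Sum>r<n l. if r = i then (if i = j then s (l, i) * t (l, i) else 0) else 0)"
    by (intro sum.cong) auto
  also have "\<dots> = torus k n (\<lambda>x. s x * t x) l $$ (i, j)"
    using ij assms by (simp add: torus_def)
  finally show "(torus k n s l * torus k n t l) $$ (i, j) = torus k n (\<lambda>x. s x * t x) l $$ (i, j)" .
qed (use assms in \<open>auto simp: torus_def\<close>)

context rep_polys
begin

text \<open>The monomials that survive on diagonal matrices.\<close>

definition weights :: "(nat \<times> nat \<times> nat) monomial set" where
  "weights = {a \<in> (\<Union>i<m. \<Union>j<m. keys (rep_poly i j)). \<forall>x\<in>keys a. fst (snd x) = snd (snd x)}"

lemma finite_weights [simp]: "finite weights"
  by (simp add: weights_def)

lemma weights_keys: "a \<in> weights \<Longrightarrow> keys a \<subseteq> (\<lambda>(l, i). (l, i, i)) ` torus_index k n"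
proof
  fix x assume a: "a \<in> weights" and x: "x \<in> keys a"
  then obtain i j where "i < m" "j < m" "a \<in> keys (rep_poly i j)"
    by (auto simp: weights_def)
  then have "x \<in> Vars k n"
    using rep_poly_vars[of i j] x by (auto simp: mpoly_vars_def)
  moreover have "fst (snd x) = snd (snd x)"
    using a x by (auto simp: weights_def)
  ultimately show "x \<in> (\<lambda>(l, i). (l, i, i)) ` torus_index k n"
    by (auto simp: Vars_def torus_index_def image_iff)
qed

lemma monom_eval_torus:
  assumes "a \<in> weights"
  shows "monom_eval (entries (torus k n t)) a = torus_char k n a t"
proof -
  have "monom_eval (entries (torus k n t)) a =
      (\<Prod>x\<in>(\<lambda>(l, i). (l, i, i)) ` torus_index k n. entries (torus k n t) x ^ lookup a x)"
    by (rule monom_eval_superset[OF _ weights_keys[OF assms]]) simp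
  also have "\<dots> = (\<Prod>(l, i)\<in>torus_index k n. entries (torus k n t) (l, i, i) ^ lookup a (l, i, i))"
    by (subst prod.reindex) (auto simp: inj_on_def case_prod_unfold)
  also have "\<dots> = torus_char k n a t"
    unfolding torus_char_def
    by (intro prod.cong) (auto simp: entries_def torus_def torus_index_def)
  finally show ?thesis .
qed

lemma eval_torus:
  assumes "i < m" "j < m"
  shows "mpoly_eval (entries (torus k n t)) (rep_poly i j) = (\<Sum>a\<in>weights. torus_char k n a t * lookup (rep_poly i j) a)"
proof -
  let ?S = "\<Union>i<m. \<Union>j<m. keys (rep_poly i j)"
  have "mpoly_eval (entries (torus k n t)) (rep_poly i j) =
      (\<Sum>a\<in>?S. lookup (rep_poly i j) a * monom_eval (entries (torus k n t)) a)"
    by (rule mpoly_eval_superset) (use assms in auto)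
  also have "\<dots> = (\<Sum>a\<in>weights. lookup (rep_poly i j) a * monom_eval (entries (torus k n t)) a)"
  proof (rule sum.mono_neutral_right)
    show "\<forall>a\<in>?S - weights. lookup (rep_poly i j) a * monom_eval (entries (torus k n t)) a = 0"
    proof
      fix a assume a: "a \<in> ?S - weights"
      then obtain x i' j' where x: "x \<in> keys a" "fst (snd x) \<noteq> snd (snd x)" "i' < m" "j' < m" "a \<in> keys (rep_poly i' j')"
        by (auto simp: weights_def)
      then have "x \<in> Vars k n"
        using rep_poly_vars[of i' j'] by (auto simp: mpoly_vars_def)
      then have "entries (torus k n t) x = 0"
        using x(2) by (auto simp: Vars_def entries_def torus_def)
      then have "monom_eval (entries (torus k n t)) a = 0"
        unfolding monom_eval_def using x(1)
        by (intro prod_zero bexI[of _ x]) (auto simp: in_keys_iff zero_power)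
      then show "lookup (rep_poly i j) a * monom_eval (entries (torus k n t)) a = 0" by simp
    qed
  qed (auto simp: weights_def)
  finally show ?thesis
    by (simp add: monom_eval_torus mult.commute)
qed

text \<open>The \<open>i\<close>-th coordinate of the component of \<open>u\<close> of weight \<open>a\<close>, times \<open>N\<^sup>k\<close>.\<close>

definition weight_coord :: "(nat \<times> nat \<times> nat) monomial \<Rightarrow> complex vec \<Rightarrow> nat \<Rightarrow> complex" where
  "weight_coord a u i = (\<Sum>j<m. lookup (rep_poly i j) a * u $ j)"

lemma rep_torus:
  assumes t: "torus k n t \<in> carrier (GL_prod k n)" and u: "u \<in> carrier_vec m" and i: "i < m"
  shows "of_nat N ^ k * (\<pi> (torus k n t) *\<^sub>v u) $ i = (\<Sum>a\<in>weights. torus_char k n a t * weight_coord a u i)"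
proof -
  have "of_nat N ^ k * (\<pi> (torus k n t) *\<^sub>v u) $ i = (\<Sum>j<m. mpoly_eval (entries (torus k n t)) (rep_poly i j) * u $ j)"
    using rep_carrier[OF hom t] u i
    by (simp add: eval_rep_poly[OF t] scalar_prod_def lessThan_atLeast0 sum_distrib_left mult.assoc)
  also have "\<dots> = (\<Sum>j<m. \<Sum>a\<in>weights. torus_char k n a t * lookup (rep_poly i j) a * u $ j)"
    using i by (simp add: eval_torus sum_distrib_right)
  also have "\<dots> = (\<Sum>a\<in>weights. torus_char k n a t * weight_coord a u i)"
    by (subst sum.swap) (simp add: weight_coord_def sum_distrib_left mult.assoc)
  finally show ?thesis .
qed

text \<open>By unique factorisation, distinct weights take distinct values at a diagonal matrix with distinct primes as
entries.\<close>

lemma separating_primes: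
  obtains p :: "nat \<times> nat \<Rightarrow> nat" where "\<forall>x\<in>torus_index k n. prime (p x)"
    "inj_on (\<lambda>a. torus_char k n a p) weights"
proof -
  let ?I = "torus_index k n"
  obtain B where B: "finite B" "card B = card ?I" "B \<subseteq> {p :: nat. prime p}"
    using infinite_arbitrarily_large[OF primes_infinite, of "card ?I"] by blast
  obtain p where p: "p ` ?I \<subseteq> B" "inj_on p ?I"
    using card_le_inj[of ?I B] B by auto
  have prime: "prime (p x)" if "x \<in> ?I" for x
    using p(1) B(3) that by blast
  have mult: "multiplicity (p x) (torus_char k n a p) = lookup a (fst x, snd x, snd x)" if x: "x \<in> ?I" for a x
  proof -
    define f where "f y = (let z = inv_into ?I p y in lookup a (fst z, snd z, snd z))" for y
    have f: "f (p z) = lookup a (fst z, snd z, snd z)" if "z \<in> ?I" for z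
      using p(2) that by (simp add: f_def)
    have "torus_char k n a p = (\<Prod>y\<in>p ` ?I. y ^ f y)"
      unfolding torus_char_def prod.reindex[OF p(2)]
      by (intro prod.cong) (auto simp: f)
    then have "multiplicity (p x) (torus_char k n a p) = (if p x \<in> p ` ?I then f (p x) else 0)"
      using prime[OF x] prime by (simp only:, intro multiplicity_prod_prime_powers) auto
    then show ?thesis using x f by simp
  qed
  have "inj_on (\<lambda>a. torus_char k n a p) weights"
  proof (rule inj_onI, rule poly_mapping_eqI)
    fix a b y assume ab: "a \<in> weights" "b \<in> weights" "torus_char k n a p = torus_char k n b p"
    show "lookup a y = lookup b y"
    proof (cases "y \<in> (\<lambda>(l, i). (l, i, i)) ` ?I")
      case True
      then show ?thesis
        using mult[of _ a] mult[of _ b] ab(3) by force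
    next
      case False
      then have "y \<notin> keys a" "y \<notin> keys b"
        using weights_keys ab(1,2) by blast+
      then show ?thesis by (simp add: in_keys_iff)
    qed
  qed
  then show thesis using that prime by blast
qed

end

section \<open>Orbits on which all invariants vanish\<close>

lemma torus_char_of_nat: "torus_char k n a (\<lambda>x. of_nat (p x)) = of_nat (torus_char k n a p)"
  by (simp add: torus_char_def of_nat_prod case_prod_unfold)

lemma torus_char_exp:
  "torus_char k n a (\<lambda>x. complex_of_real (exp (- of_int (\<mu> x)))) =
     complex_of_real (exp (- of_int (\<Sum>x\<in>torus_index k n. int (lookup a (fst x, snd x, snd x)) * \<mu> x)))"
proof -
  have "torus_char k n a (\<lambda>x. complex_of_real (exp (- of_int (\<mu> x)))) =
      complex_of_real (\<Prod>x\<in>torus_index k n. exp (- (of_nat (lookup a (fst x, snd x, snd x)) * of_int (\<mu> x))))"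
  proof -
    have "exp (- of_int (\<mu> x)) ^ r = exp (- (real r * of_int (\<mu> x)))" for x r
      using exp_of_nat_mult[of r "- real_of_int (\<mu> x)"] by simp
    then show ?thesis
      by (simp add: torus_char_def case_prod_unfold of_real_power[symmetric] del: of_real_power)
  qed
  also have "(\<Prod>x\<in>torus_index k n. exp (- (real (lookup a (fst x, snd x, snd x)) * of_int (\<mu> x)))) =
      exp (- of_int (\<Sum>x\<in>torus_index k n. int (lookup a (fst x, snd x, snd x)) * \<mu> x))"
    by (simp add: exp_sum[symmetric] sum_negf)
  finally show ?thesis .
qed

text \<open>\<open>n l\<close> times the orthogonal projection to the functions with sum zero on each factor; the multiple keeps
integer values.\<close>

definition traceless :: "(nat \<Rightarrow> nat) \<Rightarrow> (nat \<times> nat \<Rightarrow> int) \<Rightarrow> nat \<times> nat \<Rightarrow> int" where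
  "traceless n \<mu> x = int (n (fst x)) * \<mu> x - (\<Sum>i<n (fst x). \<mu> (fst x, i))"

lemma sum_torus_index: "(\<Sum>x\<in>torus_index k n. f x) = (\<Sum>l<k. \<Sum>i<n l. f (l, i))"
  unfolding torus_index_def by (subst sum.Sigma) auto

lemma sum_traceless: "(\<Sum>i<n l. traceless n \<mu> (l, i)) = 0"
  by (simp add: traceless_def sum_subtractf sum_distrib_left)

lemma traceless_adjoint:
  "(\<Sum>x\<in>torus_index k n. f x * traceless n \<mu> x) = (\<Sum>x\<in>torus_index k n. traceless n f x * \<mu> x)"
proof -
  have "(\<Sum>i<n l. f (l, i) * traceless n \<mu> (l, i)) = (\<Sum>i<n l. traceless n f (l, i) * \<mu> (l, i))" for l
    by (simp add: traceless_def algebra_simps sum_subtractf sum_distrib_left[symmetric] sum_distrib_right[symmetric])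
  then show ?thesis by (simp add: sum_torus_index)
qed

context rep_polys
begin

text \<open>With \<open>P g0 = T Q\<close> over the valuation ring, \<open>\<pi>(T)u = \<pi>(P)\<pi>(g0)v\<close> has coordinates in the maximal ideal for
\<open>u = \<pi>(Q)v\<close>, hence so have its weight components (\<open>weight_part\<close>). If a weight component of the reduction
\<open>ub\<close> of \<open>u\<close> is non-zero, then that of \<open>u\<close> is a unit, so the weight itself takes a value in the maximal ideal at
\<open>T\<close> (\<open>char_ideal\<close>). A positive combination of such weights that is constant on each factor would take the
value \<open>1\<close> at \<open>T\<close>, because the components of \<open>T\<close> have determinant \<open>1\<close>; so Gordan's alternative yields a
one-parameter subgroup of determinant \<open>1\<close> that contracts \<open>ub\<close>.\<close>

theorem orbit_accumulates_at_zero: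
  assumes n: "\<And>l. l < k \<Longrightarrow> 1 \<le> n l" and vc: "v \<in> carrier_vec m"
    and vanish: "\<And>M \<beta>. 0 < sum \<beta> {..<m} \<Longrightarrow> invariant M \<beta> v = 0"
    and v: "\<And>j. j < m \<Longrightarrow> v $ j \<in> gaussian_rationals"
  obtains g where "\<And>s :: nat. g s \<in> SL_prod k n" "\<And>i. i < m \<Longrightarrow> (\<lambda>s. (\<pi> (g s) *\<^sub>v v) $ i) \<longlonglongrightarrow> 0"
proof -
  obtain G g0 where G: "ring_graph G" and cG': "\<forall>c\<in>gaussian_rationals. (c, c) \<in> G"
    and inv': "\<forall>a b. (a, b) \<in> G \<longrightarrow> b \<noteq> 0 \<longrightarrow> (inverse a, inverse b) \<in> G"
    and val': "\<forall>x. x \<notin> Domain G \<longrightarrow> (inverse x, 0) \<in> G"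
    and g0: "g0 \<in> SL_prod k n" and \<phi>': "\<forall>i<m. ((\<pi> g0 *\<^sub>v v) $ i, 0) \<in> G"
    by (rule place_exists[OF n vc vanish v])
  note cG = cG'[rule_format] and inv = inv'[rule_format] and val = val'[rule_format] and \<phi> = \<phi>'[rule_format]
  note GD = ring_graphD[OF G]
  let ?O = "Domain G"
  have K1: "subsemiring ?O"
    unfolding subsemiring_def using GD(1,2) by (auto intro: GD(3,4))
  have K: "valuation_subring ?O"
    unfolding valuation_subring_def using K1 val by (auto intro: GD(5))
  have coeffG: "(lookup p t, lookup p t) \<in> G" if "p \<in> coeffs_in gaussian_rationals" for p :: "('x, complex) mpoly" and t
    using that by (intro cG) (simp add: coeffs_in_def)
  have intG: "(of_int a, of_int a) \<in> G" for a
    using Ints_gaussian_rationals by (intro cG) auto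
  have inv_intG: "(inverse (of_int a), inverse (of_int a)) \<in> G" for a
    by (intro cG inverse_of_int_gaussian_rationals)
  have ideal: "(x * y, 0) \<in> G" if "x \<in> ?O" "(y, 0) \<in> G" for x y
  proof -
    obtain b where "(x, b) \<in> G" using \<open>x \<in> ?O\<close> by blast
    from GD(4)[OF this that(2)] show ?thesis by simp
  qed
  have Nk: "(inverse (of_nat N ^ k), inverse (of_nat N ^ k)) \<in> G"
    using inv_intG[of "int N ^ k"] by simp
  have unN: "inverse (of_nat N ^ k) * (of_nat N ^ k * x) = (x :: complex)" for x
    using N(1) by simp
  define res where "res a = (SOME b. (a, b) \<in> G)" for a
  have res: "(a, res a) \<in> G" if "a \<in> ?O" for a
    using that unfolding res_def by (auto intro: someI)
  have g0c: "g0 \<in> carrier (GL_prod k n)"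
    by (rule SL_prod_subset[OF g0])
  have g0l: "g0 l \<in> carrier_mat (n l) (n l)" "det (g0 l) = 1" if "l < k" for l
    using g0 that by (auto simp: PiE_iff SL_def)
  define good where "good l z \<longleftrightarrow> fst z \<in> SL_over (n l) ?O \<and> fst (snd z) \<in> SL_over (n l) ?O \<and>
      snd (snd z) \<in> carrier_mat (n l) (n l) \<and> fst z * g0 l = snd (snd z) * fst (snd z) \<and>
      (\<forall>i<n l. \<forall>j<n l. i \<noteq> j \<longrightarrow> snd (snd z) $$ (i, j) = 0)" for l z
  have "\<exists>z. good l z" if l: "l < k" for l
  proof (rule cartan_decomposition[OF K g0l(1)[OF l]])
    fix P Q T
    assume "P \<in> SL_over (n l) ?O" "Q \<in> SL_over (n l) ?O" "T \<in> carrier_mat (n l) (n l)"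
      "P * g0 l = T * Q" "\<And>i j. i < n l \<Longrightarrow> j < n l \<Longrightarrow> i \<noteq> j \<Longrightarrow> T $$ (i, j) = 0"
    then show ?thesis by (intro exI[of _ "(P, Q, T)"]) (simp add: good_def)
  qed
  then obtain F where F: "\<And>l. l < k \<Longrightarrow> good l (F l)"
    by metis
  define P where "P l = fst (F l)" for l
  define Q where "Q l = fst (snd (F l))" for l
  define T where "T l = snd (snd (F l))" for l
  have P: "P l \<in> SL_over (n l) ?O" and Q: "Q l \<in> SL_over (n l) ?O" and T: "T l \<in> carrier_mat (n l) (n l)"
    and PT: "P l * g0 l = T l * Q l" and off: "\<And>i j. i < n l \<Longrightarrow> j < n l \<Longrightarrow> i \<noteq> j \<Longrightarrow> T l $$ (i, j) = 0"
    if "l < k" for l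
    using F[OF that] by (auto simp: good_def P_def Q_def T_def)
  note Pc = P[unfolded SL_over_def, simplified] and Qc = Q[unfolded SL_over_def, simplified]
  define \<tau> where "\<tau> x = T (fst x) $$ (snd x, snd x)" for x
  have T\<tau>: "torus k n \<tau> l = T l" if "l < k" for l
    using T[OF that] off[OF that] that by (intro eq_matI) (auto simp: torus_def \<tau>_def)
  have detT: "det (T l) = 1" if l: "l < k" for l
  proof -
    have "det (T l) * det (Q l) = det (P l) * det (g0 l)"
      using det_mult[of "T l" "n l" "Q l"] det_mult[of "P l" "n l" "g0 l"] T[OF l] Pc[OF l] Qc[OF l] g0l[OF l] PT[OF l] by simp
    then show ?thesis using Pc[OF l] Qc[OF l] g0l[OF l] by simp
  qed
  have prod\<tau>: "(\<Prod>i<n l. \<tau> (l, i)) = 1" if "l < k" for l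
    using torus_det[OF that, of n \<tau>] detT[OF that] T\<tau>[OF that] by simp
  have \<tau>0: "\<tau> (l, i) \<noteq> 0" if "l < k" "i < n l" for l i
  proof
    assume "\<tau> (l, i) = 0"
    then have "(\<Prod>i<n l. \<tau> (l, i)) = 0" using that(2) by (intro prod_zero) auto
    then show False using prod\<tau>[OF that(1)] by simp
  qed
  define Pm where "Pm = (\<lambda>l\<in>{..<k}. P l)"
  define Qm where "Qm = (\<lambda>l\<in>{..<k}. Q l)"
  define Qb where "Qb = (\<lambda>l\<in>{..<k}. mat (n l) (n l) (\<lambda>ij. res (Q l $$ ij)))"
  have PmG: "Pm \<in> carrier (GL_prod k n)" and QmG: "Qm \<in> carrier (GL_prod k n)"
    unfolding Pm_def Qm_def using Pc Qc by (auto simp: carrier_GL)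
  have TG: "torus k n \<tau> \<in> carrier (GL_prod k n)"
    by (rule torus_GL) (rule \<tau>0)
  have QQ: "(entries Qm x, entries Qb x) \<in> G" if "x \<in> Vars k n" for x
    using that Qc by (auto simp: entries_def Qm_def Qb_def Vars_def intro!: res)
  have Qbc: "Qb l \<in> carrier_mat (n l) (n l)" if "l < k" for l
    using that by (simp add: Qb_def)
  have detQb: "det (Qb l) = 1" if l: "l < k" for l
  proof -
    have "Delta n l \<in> coeffs_in gaussian_rationals"
      using det_mpoly_Ints[of "n l" "Pair l"] Ints_gaussian_rationals by (auto simp: coeffs_in_def Delta_def)
    then have "(mpoly_eval (entries Qm) (Delta n l), mpoly_eval (entries Qb) (Delta n l)) \<in> G"
      using vars_Delta[OF l, of n] by (intro ring_graph_eval[OF G coeffG] QQ) auto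
    moreover have "mpoly_eval (entries Qm) (Delta n l) = 1"
      using eval_Delta[of Qm l n, OF GL_prodD(1)[OF QmG l]] Qc[OF l] l by (simp add: Qm_def)
    ultimately have "(1, det (Qb l)) \<in> G"
      using eval_Delta[of Qb l n, OF Qbc[OF l]] by simp
    then show ?thesis
      using ring_graph_unique[OF G GD(2)] by metis
  qed
  have QbG: "Qb \<in> carrier (GL_prod k n)"
  proof -
    have "(\<lambda>l\<in>{..<k}. Qb l) \<in> carrier (GL_prod k n)"
      by (rule GL_prodI) (simp_all add: Qbc detQb)
    moreover have "(\<lambda>l\<in>{..<k}. Qb l) = Qb" by (auto simp: Qb_def)
    ultimately show ?thesis by simp
  qed
  define u where "u = \<pi> Qm *\<^sub>v v"
  define ub where "ub = \<pi> Qb *\<^sub>v v"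
  have uc: "u \<in> carrier_vec m" and ubc: "ub \<in> carrier_vec m"
    using rep_carrier[OF hom QmG] rep_carrier[OF hom QbG] vc by (auto simp: u_def ub_def)
  have uub: "(u $ i, ub $ i) \<in> G" if i: "i < m" for i
  proof -
    have "(mpoly_eval (entries Qm) (coord v i), mpoly_eval (entries Qb) (coord v i)) \<in> G"
      using coord_vars[OF i, of v] coord_in[OF subsemiring_gaussian_rationals Ints_gaussian_rationals v i]
      by (intro ring_graph_eval[OF G coeffG] QQ) auto
    from GD(4)[OF Nk this] show ?thesis
      unfolding eval_coord[OF QmG vc i] eval_coord[OF QbG vc i] unN by (simp only: u_def ub_def)
  qed
  have repO: "\<pi> A $$ (i, j) \<in> ?O"
    if A: "A \<in> carrier (GL_prod k n)" and AO: "\<And>x. x \<in> Vars k n \<Longrightarrow> entries A x \<in> ?O" and ij: "i < m" "j < m" for A i j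
  proof -
    have "rep_poly i j \<in> coeffs_in ?O"
      using rep_poly_Ints[OF ij] intG by (auto simp: coeffs_in_def elim!: Ints_cases) (metis DomainI Ints_cases)
    then have "mpoly_eval (entries A) (rep_poly i j) \<in> ?O"
      using rep_poly_vars[OF ij] AO by (intro mpoly_eval_in[OF K1]) auto
    then have "inverse (of_nat N ^ k) * mpoly_eval (entries A) (rep_poly i j) \<in> ?O"
      using Nk by (intro subsemiringD(4)[OF K1]) auto
    then show ?thesis
      unfolding eval_rep_poly[OF A ij] unN .
  qed
  have rep_ideal: "((\<pi> A *\<^sub>v y) $ i, 0) \<in> G"
    if A: "A \<in> carrier (GL_prod k n)" "\<And>x. x \<in> Vars k n \<Longrightarrow> entries A x \<in> ?O"
      and y: "y \<in> carrier_vec m" "\<And>j. j < m \<Longrightarrow> (y $ j, 0) \<in> G" and i: "i < m" for A y i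
  proof -
    have "(\<pi> A *\<^sub>v y) $ i = (\<Sum>j<m. \<pi> A $$ (i, j) * y $ j)"
      using rep_carrier[OF hom A(1)] y(1) i by (simp add: scalar_prod_def lessThan_atLeast0)
    moreover have "((\<Sum>j<m. \<pi> A $$ (i, j) * y $ j), \<Sum>j<m. 0) \<in> G"
      using repO[OF A i] y(2) by (intro ring_graph_sum[OF G] ideal) auto
    ultimately show ?thesis by simp
  qed
  define w where "w = \<pi> (torus k n \<tau>) *\<^sub>v u"
  have wc: "w \<in> carrier_vec m"
    using rep_carrier[OF hom TG] uc by (auto simp: w_def)
  have w: "(w $ i, 0) \<in> G" if i: "i < m" for i
  proof -
    have "(\<lambda>l\<in>{..<k}. torus k n \<tau> l * Qm l) = (\<lambda>l\<in>{..<k}. Pm l * g0 l)"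
      using PT T\<tau> by (auto simp: Qm_def Pm_def fun_eq_iff)
    then have "\<pi> (torus k n \<tau>) * \<pi> Qm = \<pi> Pm * \<pi> g0"
      unfolding rep_mult[OF hom TG QmG, symmetric] rep_mult[OF hom PmG g0c, symmetric] by (rule arg_cong)
    then have "w = \<pi> Pm *\<^sub>v (\<pi> g0 *\<^sub>v v)"
      unfolding w_def u_def
      using assoc_mult_mat_vec[OF rep_carrier[OF hom TG] rep_carrier[OF hom QmG] vc]
        assoc_mult_mat_vec[OF rep_carrier[OF hom PmG] rep_carrier[OF hom g0c] vc] by simp
    moreover have "entries Pm x \<in> ?O" if "x \<in> Vars k n" for x
      using that Pc by (auto simp: entries_def Pm_def Vars_def)
    moreover have "\<pi> g0 *\<^sub>v v \<in> carrier_vec m"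
      using rep_carrier[OF hom g0c] vc by auto
    ultimately show ?thesis
      using rep_ideal[OF PmG _ _ \<phi> i] by simp
  qed
  obtain p :: "nat \<times> nat \<Rightarrow> nat" where p: "\<forall>x\<in>torus_index k n. prime (p x)" "inj_on (\<lambda>a. torus_char k n a p) weights"
    by (rule separating_primes)
  have p0: "p (l, i) \<noteq> 0" if "l < k" "i < n l" for l i
    using p(1)[rule_format, of "(l, i)"] that by (auto simp: torus_index_def)
  \<comment> \<open>The matrices with powers of distinct primes on the diagonal are integral and separate the weights.\<close>
  have weight_part: "(torus_char k n a \<tau> * weight_coord a u i, 0) \<in> G" if a: "a \<in> weights" and i: "i < m" for a i
  proof -
    let ?t = "\<lambda>s x. of_nat (p x) ^ s :: complex"
    have tG: "torus k n (?t s) \<in> carrier (GL_prod k n)" for s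
      by (rule torus_GL) (simp add: p0)
    have "((\<Sum>a\<in>weights. of_nat (torus_char k n a p) ^ s * (torus_char k n a \<tau> * weight_coord a u i)), 0) \<in> G" for s
    proof -
      have "of_nat b ^ s \<in> ?O" for b
        using subsemiring_power[OF K1 subsemiring_of_nat[OF K1]] .
      then have "entries (torus k n (?t s)) x \<in> ?O" if "x \<in> Vars k n" for x
        using that GD(1) by (auto simp: Vars_def entries_def torus_def)
      then have 1: "((\<pi> (torus k n (?t s)) *\<^sub>v w) $ i, 0) \<in> G"
        by (rule rep_ideal[OF tG _ wc w i])
      have "(\<lambda>l\<in>{..<k}. torus k n (?t s) l * torus k n \<tau> l) = torus k n (\<lambda>x. ?t s x * \<tau> x)"
        using torus_mult[of _ k n "?t s" \<tau>] by (auto simp: torus_def[of k n "\<lambda>x. ?t s x * \<tau> x"] fun_eq_iff)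
      then have "\<pi> (torus k n (?t s)) * \<pi> (torus k n \<tau>) = \<pi> (torus k n (\<lambda>x. ?t s x * \<tau> x))"
        unfolding rep_mult[OF hom tG TG, symmetric] by (rule arg_cong)
      then have "\<pi> (torus k n (?t s)) *\<^sub>v w = \<pi> (torus k n (\<lambda>x. ?t s x * \<tau> x)) *\<^sub>v u"
        unfolding w_def assoc_mult_mat_vec[OF rep_carrier[OF hom tG] rep_carrier[OF hom TG] uc, symmetric]
        by simp
      moreover have "torus k n (\<lambda>x. ?t s x * \<tau> x) \<in> carrier (GL_prod k n)"
        by (rule torus_GL) (simp add: p0 \<tau>0)
      ultimately have 2: "of_nat N ^ k * (\<pi> (torus k n (?t s)) *\<^sub>v w) $ i =
          (\<Sum>a\<in>weights. torus_char k n a (\<lambda>x. ?t s x * \<tau> x) * weight_coord a u i)"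
        using rep_torus[OF _ uc i] by simp
      have "of_nat N ^ k \<in> ?O"
        using subsemiring_power[OF K1 subsemiring_of_nat[OF K1]] .
      from ideal[OF this 1] show ?thesis
        unfolding 2 torus_char_mult torus_char_power torus_char_of_nat by (simp only: mult.assoc)
    qed
    from ideal_vandermonde[OF G inv_intG intG finite_weights p(2) this a] show ?thesis .
  qed
  define S where "S = {a \<in> weights. \<exists>i<m. weight_coord a ub i \<noteq> 0}"
  have "finite S" by (simp add: S_def)
  have char_ideal: "(torus_char k n a \<tau>, 0) \<in> G" if "a \<in> S" for a
  proof -
    obtain i where i: "i < m" "weight_coord a ub i \<noteq> 0" "a \<in> weights"
      using \<open>a \<in> S\<close> by (auto simp: S_def)
    have "lookup (rep_poly i j) a \<in> gaussian_rationals" if "j < m" for j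
      using coeffs_in_lookup[OF rep_poly_Ints[OF i(1) that]] Ints_gaussian_rationals by blast
    then have wG: "(weight_coord a u i, weight_coord a ub i) \<in> G"
      unfolding weight_coord_def by (intro ring_graph_sum[OF G] GD(4) cG uub) auto
    then have nz: "weight_coord a u i \<noteq> 0"
      using GD(6) i(2) by metis
    from GD(4)[OF weight_part[OF i(3,1)] inv[OF wG i(2)]] show ?thesis
      using nz by (simp add: mult.assoc)
  qed
  define f where "f a x = int (lookup a (fst x, snd x, snd x))" for a :: "(nat \<times> nat \<times> nat) monomial" and x
  \<comment> \<open>The value at \<open>\<tau>\<close> of the combination is a product of powers of the determinants, hence \<open>1\<close>.\<close>
  have no_comb: False if c: "a0 \<in> S" "0 < c a0" and comb: "\<And>x. x \<in> torus_index k n \<Longrightarrow> (\<Sum>a\<in>S. int (c a) * traceless n (f a) x) = 0"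
    for c a0
  proof -
    define b where "b x = (\<Sum>a\<in>S. c a * lookup a (fst x, snd x, snd x))" for x
    have const: "b (l, i) = b (l, 0)" if l: "l < k" "i < n l" for l i
    proof -
      have eq: "int (n l) * int (b (l, i)) = (\<Sum>i<n l. int (b (l, i)))" if "i < n l" for i
      proof -
        have "0 = (\<Sum>a\<in>S. int (c a) * traceless n (f a) (l, i))"
          using comb[of "(l, i)"] l(1) that by (simp add: torus_index_def)
        also have "\<dots> = int (n l) * int (b (l, i)) - (\<Sum>a\<in>S. \<Sum>i<n l. int (c a) * f a (l, i))"
          by (simp add: traceless_def b_def f_def algebra_simps sum_subtractf sum_distrib_left)
        also have "(\<Sum>a\<in>S. \<Sum>i<n l. int (c a) * f a (l, i)) = (\<Sum>i<n l. int (b (l, i)))"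
          by (subst sum.swap) (simp add: b_def f_def)
        finally show ?thesis by simp
      qed
      have "0 < n l" using n[OF l(1)] by simp
      then have "int (n l) * int (b (l, i)) = int (n l) * int (b (l, 0))"
        using eq[OF l(2)] eq[of 0] by simp
      then show ?thesis using \<open>0 < n l\<close> by simp
    qed
    have "((\<Prod>a\<in>S. torus_char k n a \<tau> ^ c a), (\<Prod>a\<in>S. 0 ^ c a)) \<in> G"
      using char_ideal by (intro ring_graph_prod[OF G] ring_graph_power[OF G])
    moreover have "(\<Prod>a\<in>S. 0 ^ c a) = (0 :: complex)"
      using c \<open>finite S\<close> by (intro prod_zero) (auto simp: zero_power)
    moreover have "(\<Prod>a\<in>S. torus_char k n a \<tau> ^ c a) = 1"
    proof -
      have "(\<Prod>a\<in>S. torus_char k n a \<tau> ^ c a) = (\<Prod>a\<in>S. \<Prod>x\<in>torus_index k n. \<tau> x ^ (c a * lookup a (fst x, snd x, snd x)))"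
        by (simp add: torus_char_def case_prod_unfold prod_power_distrib power_mult[symmetric] mult.commute)
      also have "\<dots> = (\<Prod>x\<in>torus_index k n. \<tau> x ^ b x)"
        by (subst prod.swap) (simp add: b_def power_sum)
      also have "\<dots> = (\<Prod>l<k. \<Prod>i<n l. \<tau> (l, i) ^ b (l, i))"
        unfolding torus_index_def by (subst prod.Sigma) (auto simp: case_prod_unfold)
      also have "\<dots> = (\<Prod>l<k. (\<Prod>i<n l. \<tau> (l, i)) ^ b (l, 0))"
        unfolding prod_power_distrib
      proof (intro prod.cong refl)
        fix l i assume "l \<in> {..<k}" "i \<in> {..<n l}"
        then have "b (l, i) = b (l, 0)" by (intro const) auto
        then show "\<tau> (l, i) ^ b (l, i) = \<tau> (l, i) ^ b (l, 0)" by (rule arg_cong)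
      qed
      also have "\<dots> = 1"
        by (intro prod.neutral) (simp add: prod\<tau>)
      finally show ?thesis .
    qed
    ultimately have "(1, 0) \<in> G" by simp
    then show False
      using ring_graph_unique[OF G GD(2)] by fastforce
  qed
  consider (pos) \<mu> where "\<forall>a\<in>S. 0 < (\<Sum>x\<in>torus_index k n. traceless n (f a) x * \<mu> x)"
    | (comb) c where "\<exists>a\<in>S. 0 < c a" "\<forall>x\<in>torus_index k n. (\<Sum>a\<in>S. int (c a) * traceless n (f a) x) = 0"
    using gordan_alternative[OF \<open>finite S\<close> finite_torus_index[of k n], of "\<lambda>a. traceless n (f a)"] by blast
  then show thesis
  proof cases
    case comb
    then show ?thesis using no_comb by blast
  next
    case pos
    \<comment> \<open>the one-parameter subgroup with exponents \<open>traceless n \<mu>\<close>, taken at integer times\<close>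
    define t where "t x = complex_of_real (exp (- of_int (traceless n \<mu> x)))" for x
    define T' where "T' s = torus k n (\<lambda>x. t x ^ s)" for s :: nat
    have T'G: "T' s \<in> carrier (GL_prod k n)" for s
      unfolding T'_def by (rule torus_GL) (simp add: t_def)
    have detT': "det (T' s l) = 1" if "l < k" for s l
    proof -
      have "(\<Prod>i<n l. t (l, i)) = complex_of_real (exp (\<Sum>i<n l. - of_int (traceless n \<mu> (l, i))))"
        unfolding t_def by (simp add: exp_sum)
      also have "(\<Sum>i<n l. - real_of_int (traceless n \<mu> (l, i))) = - of_int (\<Sum>i<n l. traceless n \<mu> (l, i))"
        by (simp add: sum_negf)
      finally have "(\<Prod>i<n l. t (l, i)) = 1"
        by (simp add: sum_traceless)
      then show ?thesis
        unfolding T'_def torus_det[OF that] by (simp add: prod_power_distrib[symmetric])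
    qed
    define g where "g s = (\<lambda>l\<in>{..<k}. T' s l * Qb l)" for s
    have "g s \<in> SL_prod k n" for s
    proof -
      have "T' s l * Qb l \<in> SL (n l)" if l: "l < k" for l
        using mult_carrier_mat[OF GL_prodD(1)[OF T'G l] Qbc[OF l]] det_mult[OF GL_prodD(1)[OF T'G l] Qbc[OF l]]
          detT'[OF l] detQb[OF l] by (simp add: SL_def)
      then show ?thesis by (auto simp: g_def)
    qed
    moreover have "(\<lambda>s. (\<pi> (g s) *\<^sub>v v) $ i) \<longlonglongrightarrow> 0" if i: "i < m" for i
    proof -
      have eq: "(\<pi> (g s) *\<^sub>v v) $ i = inverse (of_nat N ^ k) * (\<Sum>a\<in>S. torus_char k n a t ^ s * weight_coord a ub i)" for s
      proof -
        have "\<pi> (g s) *\<^sub>v v = \<pi> (T' s) *\<^sub>v ub"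
          unfolding g_def rep_mult[OF hom T'G QbG] ub_def
          by (rule assoc_mult_mat_vec[OF rep_carrier[OF hom T'G] rep_carrier[OF hom QbG] vc])
        moreover have "of_nat N ^ k * (\<pi> (T' s) *\<^sub>v ub) $ i = (\<Sum>a\<in>weights. torus_char k n a t ^ s * weight_coord a ub i)"
          unfolding T'_def rep_torus[OF T'G[unfolded T'_def] ubc i] torus_char_power ..
        moreover have "\<dots> = (\<Sum>a\<in>S. torus_char k n a t ^ s * weight_coord a ub i)"
          using i by (intro sum.mono_neutral_right) (auto simp: S_def)
        ultimately show ?thesis
          by (metis unN)
      qed
      have "(\<lambda>s. torus_char k n a t ^ s) \<longlonglongrightarrow> 0" if a: "a \<in> S" for a
      proof (rule LIMSEQ_power_zero)
        have "torus_char k n a t = complex_of_real (exp (- of_int (\<Sum>x\<in>torus_index k n. f a x * traceless n \<mu> x)))"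
          unfolding t_def torus_char_exp f_def ..
        moreover have "0 < (\<Sum>x\<in>torus_index k n. f a x * traceless n \<mu> x)"
          unfolding traceless_adjoint using pos a by blast
        ultimately show "norm (torus_char k n a t) < 1"
          by (simp del: of_int_sum of_int_mult)
      qed
      then have "(\<lambda>s. inverse (of_nat N ^ k) * (\<Sum>a\<in>S. torus_char k n a t ^ s * weight_coord a ub i)) \<longlonglongrightarrow>
          inverse (of_nat N ^ k) * (\<Sum>a\<in>S. 0 * weight_coord a ub i)"
        by (intro tendsto_mult tendsto_const tendsto_sum)
      then show ?thesis unfolding eq by simp
    qed
    ultimately show ?thesis by (rule that)
  qed
qed

end

section \<open>Norms and the capacity bound\<close>

text \<open>Expand both arguments in the standard basis.\<close>

lemma ip_norm_le_sum:
  assumes ip: "hermitian_inner_product m ip"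
  obtains C where "\<And>w. w \<in> carrier_vec m \<Longrightarrow> ip_norm ip w \<le> C * (\<Sum>i<m. cmod (w $ i))"
proof -
  have add: "ip (u + u') w = ip u w + ip u' w" if "u \<in> carrier_vec m" "u' \<in> carrier_vec m" "w \<in> carrier_vec m" for u u' w
    using ip that unfolding hermitian_inner_product_def by blast
  have smult: "ip (c \<cdot>\<^sub>v u) w = c * ip u w" if "u \<in> carrier_vec m" "w \<in> carrier_vec m" for c u w
    using ip that unfolding hermitian_inner_product_def by blast
  have cnj: "ip w u = cnj (ip u w)" if "u \<in> carrier_vec m" "w \<in> carrier_vec m" for u w
    using ip that unfolding hermitian_inner_product_def by blast
  let ?e = "\<lambda>i. unit_vec m i :: complex vec"
  have expand: "ip w u = (\<Sum>i<m. w $ i * ip (?e i) u)" if w: "w \<in> carrier_vec m" and u: "u \<in> carrier_vec m" for w u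
  proof -
    define part where "part s = vec m (\<lambda>i. if i < s then w $ i else 0)" for s
    have "ip (part s) u = (\<Sum>i<s. w $ i * ip (?e i) u)" if "s \<le> m" for s
      using that
    proof (induction s)
      case 0
      have "part 0 = 0 \<cdot>\<^sub>v part 0"
        by (intro eq_vecI) (auto simp: part_def)
      then have "ip (part 0) u = 0 * ip (part 0) u"
        using smult[of "part 0" u 0] u by (simp add: part_def)
      then show ?case by simp
    next
      case (Suc s)
      have "part (Suc s) = part s + w $ s \<cdot>\<^sub>v ?e s"
        using Suc.prems by (intro eq_vecI) (auto simp: part_def less_Suc_eq)
      then have "ip (part (Suc s)) u = ip (part s) u + w $ s * ip (?e s) u"
        using add[of "part s" "w $ s \<cdot>\<^sub>v ?e s" u] smult[of "?e s" u] u by (simp add: part_def)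
      then show ?case using Suc by simp
    qed
    moreover have "part m = w"
      using w by (intro eq_vecI) (auto simp: part_def)
    ultimately show ?thesis by (metis order.refl)
  qed
  define C where "C = (\<Sum>i<m. \<Sum>j<m. cmod (ip (?e j) (?e i)))"
  have "ip_norm ip w \<le> sqrt C * (\<Sum>i<m. cmod (w $ i))" if w: "w \<in> carrier_vec m" for w
  proof -
    let ?s = "\<Sum>i<m. cmod (w $ i)"
    have le: "cmod (w $ i) \<le> ?s" if "i < m" for i
      using that by (intro member_le_sum) auto
    have s0: "0 \<le> ?s" by (simp add: sum_nonneg)
    have ewi: "cmod (ip (?e i) w) \<le> ?s * (\<Sum>j<m. cmod (ip (?e j) (?e i)))" if "i < m" for i
    proof -
      have "cmod (ip (?e i) w) = cmod (ip w (?e i))"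
        using cnj[of w "?e i"] w by simp
      also have "\<dots> = cmod (\<Sum>j<m. w $ j * ip (?e j) (?e i))"
        using expand[OF w, of "?e i"] by simp
      also have "\<dots> \<le> (\<Sum>j<m. ?s * cmod (ip (?e j) (?e i)))"
        using le by (intro order.trans[OF norm_sum] sum_mono) (auto simp: norm_mult intro!: mult_right_mono)
      finally show ?thesis by (simp add: sum_distrib_left)
    qed
    have "Re (ip w w) \<le> cmod (ip w w)" by (rule complex_Re_le_cmod)
    also have "\<dots> = cmod (\<Sum>i<m. w $ i * ip (?e i) w)"
      using expand[OF w w] by simp
    also have "\<dots> \<le> (\<Sum>i<m. ?s * (?s * (\<Sum>j<m. cmod (ip (?e j) (?e i)))))"
      using le ewi s0 by (intro order.trans[OF norm_sum] sum_mono) (auto simp: norm_mult intro!: mult_mono)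
    also have "\<dots> = C * ?s\<^sup>2"
      by (simp add: C_def sum_distrib_left[symmetric] power2_eq_square)
    finally have "sqrt (Re (ip w w)) \<le> sqrt (C * ?s\<^sup>2)"
      by (rule real_sqrt_le_mono)
    then show ?thesis
      using s0 by (simp add: ip_norm_def real_sqrt_mult)
  qed
  then show thesis using that by blast
qed

lemma ip_norm_nonneg:
  assumes ip: "hermitian_inner_product m ip" and w: "w \<in> carrier_vec m"
  shows "0 \<le> ip_norm ip w"
proof (cases "w = 0\<^sub>v m")
  case True
  have "ip (0 \<cdot>\<^sub>v w) w = 0 * ip w w"
    using ip w unfolding hermitian_inner_product_def by blast
  moreover have "0 \<cdot>\<^sub>v w = w" using True by auto
  ultimately show ?thesis by (simp add: ip_norm_def)
next
  case False
  then have "0 < Re (ip w w)"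
    using ip w unfolding hermitian_inner_product_def by blast
  then show ?thesis by (simp add: ip_norm_def)
qed

text \<open>If \<open>n0 = 1\<close>, the logarithm on the right vanishes, but so do all terms on the left that are not covered by
\<open>ln (R m \<K>)\<close>; otherwise \<open>ln 2 \<le> ln (d n0)\<close> absorbs the constants.\<close>

lemma final_estimate:
  fixes d R m k :: nat and n :: "nat \<Rightarrow> nat" and \<K> :: real
  assumes k: "1 \<le> k" and n: "\<And>l. l < k \<Longrightarrow> 1 \<le> n l" and d: "1 \<le> d" and R: "1 \<le> R" and m: "1 \<le> m" and \<K>: "1 \<le> \<K>"
  defines "n0 \<equiv> \<Sum>l<k. n l"
  shows "ln (4 ^ (d * (\<Sum>l<k. n l - 1)) * (\<Prod>l<k. real (n l) ^ d) * (real m * real R * real n0 ^ (2 * d)) ^ k * \<K>)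
    \<le> 5 * (real k ^ 2 * real d * real n0 ^ 2 * ln (real d * real n0) + real k * ln (real R * real m * \<K>))"
proof -
  let ?L = "ln (real d * real n0)"
  have le: "n l \<le> n0" if "l < k" for l
    unfolding n0_def using that by (intro member_le_sum) auto
  have n0: "1 \<le> n0"
    using n[of 0] le[of 0] k by simp
  have "real n0 \<le> real d * real n0"
    using mult_right_mono[of 1 "real d" "real n0"] d by simp
  then have Ln0: "ln (real n0) \<le> ?L"
    using n0 by (subst ln_le_cancel_iff) auto
  have L0: "0 \<le> ?L"
    using ln_ge_zero[of "real n0"] n0 Ln0 by linarith
  have A: "real (\<Sum>l<k. n l - 1) * ln 4 \<le> 2 * real n0 * ?L"
  proof (cases "(\<Sum>l<k. n l - 1) = 0")
    case True
    then show ?thesis using L0 by simp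
  next
    case False
    have "(\<Sum>l<k. n l - 1) + k = n0"
    proof -
      have "(\<Sum>l<k. n l - 1) + (\<Sum>l<k. 1) = (\<Sum>l<k. n l - 1 + 1)"
        by (rule sum.distrib[symmetric])
      also have "\<dots> = n0"
        unfolding n0_def
      proof (intro sum.cong refl)
        fix l assume "l \<in> {..<k}"
        then show "n l - 1 + 1 = n l" using n[of l] by simp
      qed
      finally show ?thesis by simp
    qed
    then have "2 \<le> n0" and le': "(\<Sum>l<k. n l - 1) \<le> n0"
      using False k by linarith+
    then have "ln 2 \<le> ln (real n0)"
      by (subst ln_le_cancel_iff) auto
    moreover have "ln (4 :: real) = 2 * ln 2"
      using ln_realpow[of 2 2] by simp
    ultimately have "ln 4 \<le> 2 * ?L"
      using Ln0 by linarith
    moreover have "real (\<Sum>l<k. n l - 1) \<le> real n0"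
      using le' by (simp only: of_nat_le_iff)
    ultimately have "real (\<Sum>l<k. n l - 1) * ln 4 \<le> real n0 * (2 * ?L)"
      by (intro mult_mono) auto
    then show ?thesis by simp
  qed
  have "(\<Sum>l<k. ln (real (n l))) \<le> (\<Sum>l<k. ?L)"
  proof (rule sum_mono)
    fix l assume "l \<in> {..<k}"
    then have "ln (real (n l)) \<le> ln (real n0)"
      using le[of l] n[of l] by (subst ln_le_cancel_iff) auto
    with Ln0 show "ln (real (n l)) \<le> ?L" by linarith
  qed
  then have B: "(\<Sum>l<k. ln (real (n l))) \<le> real k * ?L" by simp
  have pos: "0 < real (n l)" if "l < k" for l using n[OF that] by simp
  have lnp: "ln (\<Prod>l<k. real (n l) ^ d) = real d * (\<Sum>l<k. ln (real (n l)))"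
    using pos by (subst ln_prod) (auto simp: ln_realpow sum_distrib_left)
  have ppos: "0 < (\<Prod>l<k. real (n l) ^ d)"
    using pos by (intro prod_pos) auto
  have expand: "ln (4 ^ (d * s) * p * (real m * real R * real n0 ^ (2 * d)) ^ k * \<K>) =
      real d * (real s * ln 4) + ln p + real k * (ln (real m) + ln (real R) + 2 * real d * ln (real n0)) + ln \<K>"
    if "0 < p" for s p
    using that m R n0 \<K> by (simp add: ln_mult ln_realpow algebra_simps)
  have "ln (4 ^ (d * (\<Sum>l<k. n l - 1)) * (\<Prod>l<k. real (n l) ^ d) * (real m * real R * real n0 ^ (2 * d)) ^ k * \<K>)
      = real d * (real (\<Sum>l<k. n l - 1) * ln 4) + real d * (\<Sum>l<k. ln (real (n l))) +
        real k * (ln (real m) + ln (real R) + 2 * real d * ln (real n0)) + ln \<K>"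
    unfolding expand[OF ppos] lnp ..
  also have "\<dots> \<le> real d * (2 * real n0 * ?L) + real d * (real k * ?L) + real k * (2 * real d * ?L) +
      (real k * (ln (real m) + ln (real R)) + ln \<K>)"
  proof -
    have "real d * (real (\<Sum>l<k. n l - 1) * ln 4) \<le> real d * (2 * real n0 * ?L)"
      using A by (intro mult_left_mono) auto
    moreover have "real d * (\<Sum>l<k. ln (real (n l))) \<le> real d * (real k * ?L)"
      using B by (intro mult_left_mono) auto
    moreover have "real k * (2 * real d * ln (real n0)) \<le> real k * (2 * real d * ?L)"
      using Ln0 by (intro mult_left_mono) auto
    moreover have "real k * (ln (real m) + ln (real R) + 2 * real d * ln (real n0)) =
        real k * (ln (real m) + ln (real R)) + real k * (2 * real d * ln (real n0))"
      by (rule distrib_left)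
    ultimately show ?thesis by linarith
  qed
  also have "\<dots> \<le> 5 * (real k ^ 2 * real d * real n0 ^ 2 * ?L) + 5 * (real k * ln (real R * real m * \<K>))"
  proof (rule add_mono)
    have kk: "real n0 \<le> real k ^ 2 * real n0 ^ 2" "real k \<le> real k ^ 2 * real n0 ^ 2"
    proof -
      have "n0 * 1 \<le> n0 ^ 2 * k ^ 2" "k * 1 \<le> k ^ 2 * n0 ^ 2"
        using k n0 by (intro mult_mono; simp add: power2_eq_square)+
      then show "real n0 \<le> real k ^ 2 * real n0 ^ 2" "real k \<le> real k ^ 2 * real n0 ^ 2"
        by (simp_all add: mult.commute flip: of_nat_power of_nat_mult)
    qed
    have dL: "0 \<le> real d * ?L" using L0 by simp
    have "real d * (2 * real n0 * ?L) + real d * (real k * ?L) + real k * (2 * real d * ?L) = (2 * real n0 + 3 * real k) * (real d * ?L)"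
      by (simp add: algebra_simps)
    also have "\<dots> \<le> (5 * (real k ^ 2 * real n0 ^ 2)) * (real d * ?L)"
      using kk by (intro mult_right_mono dL) linarith
    finally show "real d * (2 * real n0 * ?L) + real d * (real k * ?L) + real k * (2 * real d * ?L) \<le> 5 * (real k ^ 2 * real d * real n0 ^ 2 * ?L)"
      by (simp add: mult_ac)
    have ln0: "0 \<le> ln (real R)" "0 \<le> ln (real m)" "0 \<le> ln \<K>"
      using R m \<K> by auto
    have "ln (real R * real m * \<K>) = ln (real R) + ln (real m) + ln \<K>"
      using R m \<K> by (simp add: ln_mult)
    moreover have "1 * ln \<K> \<le> real k * ln \<K>"
      using k ln0 by (intro mult_right_mono) auto
    moreover have "0 \<le> real k * ln (real R)" "0 \<le> real k * ln (real m)" "0 \<le> real k * ln \<K>"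
      using ln0 by auto
    ultimately show "real k * (ln (real m) + ln (real R)) + ln \<K> \<le> 5 * (real k * ln (real R * real m * \<K>))"
      by (simp add: distrib_left)
  qed
  finally show ?thesis by (simp add: distrib_left)
qed

theorem corollary7p19:
  shows "\<exists>C::real. 0 < C \<and>
    (\<forall>(k::nat) (n::nat \<Rightarrow> nat) (m::nat) (d::nat) (R::nat) (\<K>::real)
        (\<pi> :: (nat \<Rightarrow> complex mat) \<Rightarrow> complex mat)
        (ip :: complex vec \<Rightarrow> complex vec \<Rightarrow> complex) (v :: complex vec).
       1 \<le> k \<longrightarrow> (\<forall>l<k. 1 \<le> n l) \<longrightarrow> 1 \<le> d \<longrightarrow>
       admissible_rep k n m d R \<pi> \<longrightarrow>
       hermitian_inner_product m ip \<longrightarrow>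
       SU_invariant k n m \<pi> ip \<longrightarrow>
       1 \<le> \<K> \<longrightarrow> (\<forall>w\<in>carrier_vec m. norm2 w \<le> \<K> * ip_norm ip w) \<longrightarrow>
       v \<in> carrier_vec m \<longrightarrow> (\<forall>i<m. v $ i \<in> gaussian_integers) \<longrightarrow>
       0 < capacity k n \<pi> (ip_norm ip) v \<longrightarrow>
       - ln (capacity k n \<pi> (ip_norm ip) v)
         \<le> C * (real k ^ 2 * real d * real (\<Sum>l<k. n l) ^ 2 * ln (real d * real (\<Sum>l<k. n l))
                + real k * ln (real R * real m * \<K>)))"
proof (intro exI[of _ 5] conjI allI impI)
  fix k n m d R \<K> \<pi> ip and v :: "complex vec"
  assume k: "1 \<le> k" and n: "\<forall>l<k. 1 \<le> n l" and d: "1 \<le> d" and adm: "admissible_rep k n m d R \<pi>"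
    and ip: "hermitian_inner_product m ip" and \<K>: "1 \<le> \<K>" "\<forall>w\<in>carrier_vec m. norm2 w \<le> \<K> * ip_norm ip w"
    and v: "v \<in> carrier_vec m" "\<forall>i<m. v $ i \<in> gaussian_integers"
    and cap: "0 < capacity k n \<pi> (ip_norm ip) v"
  obtain N q e where "rep_polys k n m d R \<pi> N q e"
    using admissible_rep_polys[OF adm] by blast
  then interpret rep_polys k n m d R \<pi> N q e .
  let ?cap = "capacity k n \<pi> (ip_norm ip) v"
  have gv: "\<pi> g *\<^sub>v v \<in> carrier_vec m" if "g \<in> SL_prod k n" for g
    using rep_carrier[OF hom SL_prod_subset[OF that]] v(1) by auto
  have bdd: "bdd_below ((\<lambda>g. ip_norm ip (\<pi> g *\<^sub>v v)) ` SL_prod k n)"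
    by (rule bdd_belowI2[of _ 0]) (rule ip_norm_nonneg[OF ip gv])
  \<comment> \<open>Otherwise the orbit accumulates at the origin, where the norm is continuous.\<close>
  have "\<exists>M \<beta>. 0 < sum \<beta> {..<m} \<and> invariant M \<beta> v \<noteq> 0"
  proof (rule ccontr)
    assume "\<not> ?thesis"
    then have vanish: "\<And>M \<beta>. 0 < sum \<beta> {..<m} \<Longrightarrow> invariant M \<beta> v = 0" by blast
    have "v $ j \<in> gaussian_rationals" if "j < m" for j
      using v(2) that by (auto simp: gaussian_integers_def gaussian_rationals_def intro: subsetD[OF Ints_subset_Rats])
    then obtain g where g: "\<And>s :: nat. g s \<in> SL_prod k n"
      "\<And>i. i < m \<Longrightarrow> (\<lambda>s. (\<pi> (g s) *\<^sub>v v) $ i) \<longlonglongrightarrow> 0"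
      using orbit_accumulates_at_zero[of v] n v(1) vanish by metis
    obtain C where C: "\<And>w. w \<in> carrier_vec m \<Longrightarrow> ip_norm ip w \<le> C * (\<Sum>i<m. cmod (w $ i))"
      using ip_norm_le_sum[OF ip] by blast
    have "(\<lambda>s. C * (\<Sum>i<m. cmod ((\<pi> (g s) *\<^sub>v v) $ i))) \<longlonglongrightarrow> C * (\<Sum>i<m. cmod 0)"
      by (intro tendsto_intros g(2)) auto
    moreover have "?cap \<le> C * (\<Sum>i<m. cmod ((\<pi> (g s) *\<^sub>v v) $ i))" for s
      unfolding capacity_def
      by (rule order.trans[OF cINF_lower[OF bdd g(1)] C[OF gv[OF g(1)]]])
    ultimately have "?cap \<le> C * (\<Sum>i<m. cmod 0)"
      by (intro LIMSEQ_le_const) auto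
    then show False using cap by simp
  qed
  then obtain M \<beta> where M: "0 < sum \<beta> {..<m}" "invariant M \<beta> v \<noteq> 0" by blast
  let ?n0 = "\<Sum>l<k. n l"
  let ?E = "4 ^ (d * (\<Sum>l<k. n l - 1)) * (\<Prod>l<k. real (n l) ^ d) * (real m * real R * real ?n0 ^ (2 * d)) ^ k"
  have n': "1 \<le> n l \<and> n l \<le> ?n0" if "l < k" for l
    using n that by (auto intro: member_le_sum)
  have E: "1 \<le> ?E * norm2 (\<pi> g *\<^sub>v v)" if g: "g \<in> SL_prod k n" for g
    by (rule orbit_norm_ge[OF n' v(1) _ M(2,1) g]) (use v(2) in auto)
  have id: "(\<lambda>l\<in>{..<k}. 1\<^sub>m (n l)) \<in> SL_prod k n"
    by (auto simp: SL_def)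
  have E0: "0 \<le> ?E"
    by (intro mult_nonneg_nonneg prod_nonneg) auto
  have "?E \<noteq> 0"
  proof
    assume "?E = 0"
    with E[OF id] have "(1 :: real) \<le> 0"
      by (simp only: mult_zero_left)
    then show False by simp
  qed
  with E0 have Epos: "0 < ?E" by linarith
  have m: "1 \<le> m"
  proof (rule ccontr)
    assume "\<not> 1 \<le> m"
    then have "(real m * real R * real ?n0 ^ (2 * d)) ^ k = 0"
      using k by (simp add: zero_power)
    then show False
      using \<open>?E \<noteq> 0\<close> by (simp only: mult_zero_right)
  qed
  have R: "1 \<le> R" using N by linarith
  have low: "inverse (?E * \<K>) \<le> ip_norm ip (\<pi> g *\<^sub>v v)" if g: "g \<in> SL_prod k n" for g
  proof -
    have "1 \<le> ?E * norm2 (\<pi> g *\<^sub>v v)" by (rule E[OF g])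
    also have "\<dots> \<le> ?E * (\<K> * ip_norm ip (\<pi> g *\<^sub>v v))"
      using \<K>(2) gv[OF g] E0 by (intro mult_left_mono) auto
    finally have "1 \<le> (?E * \<K>) * ip_norm ip (\<pi> g *\<^sub>v v)" by (simp only: mult.assoc)
    moreover have "0 < ?E * \<K>" by (rule mult_pos_pos[OF Epos]) (use \<K>(1) in simp)
    ultimately show ?thesis
      by (metis inverse_eq_divide mult.commute pos_divide_le_eq)
  qed
  have le_cap: "inverse (?E * \<K>) \<le> ?cap"
    unfolding capacity_def
  proof (rule cINF_greatest)
    show "SL_prod k n \<noteq> {}" using id by blast
  qed (rule low)
  have EK: "0 < ?E * \<K>"
    by (rule mult_pos_pos[OF Epos]) (use \<K>(1) in simp)
  have "ln (inverse (?E * \<K>)) \<le> ln ?cap"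
    by (rule ln_le_cancel_iff[THEN iffD2, OF positive_imp_inverse_positive[OF EK] cap le_cap])
  then have "- ln ?cap \<le> ln (?E * \<K>)"
    using EK by (simp only: ln_inverse)
  also have "\<dots> \<le> 5 * (real k ^ 2 * real d * real ?n0 ^ 2 * ln (real d * real ?n0) + real k * ln (real R * real m * \<K>))"
    using n by (intro final_estimate k d R m \<K>(1)) auto
  finally show "- ln ?cap \<le> 5 * (real k ^ 2 * real d * real ?n0 ^ 2 * ln (real d * real ?n0) + real k * ln (real R * real m * \<K>))" .
qed simp

end
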